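(* Let $m,n>0$, and let $D$, $\Gamma$, $O'$ and $(\Gamma,\zeta,\Omega)$ be as described in the context. Assume that $\Omega_1$ is contained in the open segment $O'A_1$ and that $\Omega_2$ is contained in the open segment $A_2O'$. Then the problem $$(m\partial_x+n\partial_y)\partial_x\partial_y u=0\ \text{ in } D,\qquad u=g\ \text{ on }\partial D$$ has a (unique) generalized solution $u\in C^2(\overline{D})$ for every $g\in C^2(\partial D)$ if and only if either $\zeta_1\circ\zeta_2$ or $\zeta_2\circ\zeta_1$ has a fixed point not in $\Omega$.
   Context: Let $O=(0,0)$, $A_1=(1,0)$, $A_2=(0,1)$. $\Gamma$ is a $C^2$ curve in $\mathbb{R}^2$ (with a tangent space $T_q(\Gamma)$ at every point $q$) that intersects the axes exactly at $A_1$ and $A_2$, and $\Gamma=\{(\alpha_1(z),\alpha_2(z)): z\in[-1,1]\}$ where $\alpha_1,\alpha_2\in C^2([-1,1])$, $\alpha_1'\ge 0$, $\alpha_2'\le 0$; the parametrization runs from $A_2$ (at $z=-1$) to $A_1$ (at $z=1$). $D$ is the curvilinear triangle $OA_1A_2$ bounded by the segments $OA_1$, $OA_2$ and $\Gamma$. $C^2(\partial D)$ denotes the continuous functions on $\partial D$ whose restrictions to each of the three closed sides $OA_1$, $OA_2$, $\Gamma$ are $C^2$. Generalized solution: $u\in C(\overline{D})$ with $u|_{\partial D}=g$ and $-\int_D u\,(m\partial_x+n\partial_y)\partial_x\partial_y\varphi\,dx\,dy=0$ for every $\varphi\in C_0^\infty(D)$. For $p=(x,y)\in\overline{D}$ put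 $\pi_1p=(x,0)$, $\pi_2p=(0,y)$, and let $\pi_3p$ be the unique point of intersection of $\Gamma$ with the line $\{p+(mt,nt):t\in\mathbb{R}\}$. Define $\zeta_1=\pi_3\circ\pi_1$, $\zeta_2=\pi_3\circ\pi_2$, maps of $\Gamma$ into itself. The guiding sets are $\Omega_1=\{q\in\Gamma:(0,1)\in T_q(\Gamma)\}$ (vertical tangent) and $\Omega_2=\{q\in\Gamma:(1,0)\in T_q(\Gamma)\}$ (horizontal tangent), and $\Omega=\Omega_1\cup\Omega_2$. There is $z_0\in[-1,1]$ with $(\alpha_1(z_0),\alpha_2(z_0))=\zeta_1(A_2)=\zeta_2(A_1)$; this point is denoted $O'$. The open segment $A_2O'$ is the image in $\Gamma$ of $[-1,z_0)$, and the open segment $O'A_1$ is the image in $\Gamma$ of $(z_0,1]$ under the parametrization. *)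

theory Defs
  imports "HOL-Analysis.Analysis"
begin

section \<open>The curve and the curvilinear triangle\<close>

definition C2_interval :: "real \<Rightarrow> real \<Rightarrow> (real \<Rightarrow> real) \<Rightarrow> bool" where
  "C2_interval a b f \<longleftrightarrow>
     (\<exists>f' f''. (\<forall>t\<in>{a..b}. (f has_real_derivative f' t) (at t within {a..b})) \<and>
               (\<forall>t\<in>{a..b}. (f' has_real_derivative f'' t) (at t within {a..b})) \<and>
               continuous_on {a..b} f'')"

text \<open>Derivative relative to \<open>[-1,1]\<close>, hence one-sided at the two end points.\<close>

definition param_deriv :: "(real \<Rightarrow> real) \<Rightarrow> real \<Rightarrow> real" where
  "param_deriv f z = vector_derivative f (at z within {-1..1})"

definition curve :: "(real \<Rightarrow> real) \<Rightarrow> (real \<Rightarrow> real) \<Rightarrow> (real \<times> real) set" where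
  "curve \<alpha>1 \<alpha>2 = (\<lambda>z. (\<alpha>1 z, \<alpha>2 z)) ` {-1..1}"

text \<open>The condition that the velocity never vanishes makes the parametrized set a \<open>C\<^sup>2\<close> curve
  with a tangent line at every point.\<close>

definition admissible_curve :: "(real \<Rightarrow> real) \<Rightarrow> (real \<Rightarrow> real) \<Rightarrow> bool" where
  "admissible_curve \<alpha>1 \<alpha>2 \<longleftrightarrow>
     C2_interval (-1) 1 \<alpha>1 \<and> C2_interval (-1) 1 \<alpha>2 \<and>
     (\<forall>z\<in>{-1..1}. param_deriv \<alpha>1 z \<ge> 0 \<and> param_deriv \<alpha>2 z \<le> 0 \<and>
                   (param_deriv \<alpha>1 z, param_deriv \<alpha>2 z) \<noteq> (0, 0)) \<and>
     (\<alpha>1 (-1), \<alpha>2 (-1)) = (0, 1) \<and> (\<alpha>1 1, \<alpha>2 1) = (1, 0) \<and>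
     curve \<alpha>1 \<alpha>2 \<inter> {p. fst p = 0 \<or> snd p = 0} = {(1, 0), (0, 1)}"

definition tangent_space ::
    "(real \<Rightarrow> real) \<Rightarrow> (real \<Rightarrow> real) \<Rightarrow> real \<times> real \<Rightarrow> (real \<times> real) set" where
  "tangent_space \<alpha>1 \<alpha>2 q =
     (\<Union>z\<in>{z\<in>{-1..1}. (\<alpha>1 z, \<alpha>2 z) = q}. span {(param_deriv \<alpha>1 z, param_deriv \<alpha>2 z)})"

definition curvilinear_triangle :: "(real \<times> real) set \<Rightarrow> (real \<times> real) set" where
  "curvilinear_triangle \<Gamma> = inside (closed_segment (0, 0) (1, 0) \<union> closed_segment (0, 0) (0, 1) \<union> \<Gamma>)"

section \<open>The maps and the guiding sets\<close>

definition proj1 :: "real \<times> real \<Rightarrow> real \<times> real" where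
  "proj1 p = (fst p, 0)"

definition proj2 :: "real \<times> real \<Rightarrow> real \<times> real" where
  "proj2 p = (0, snd p)"

definition proj3 :: "real \<Rightarrow> real \<Rightarrow> (real \<times> real) set \<Rightarrow> real \<times> real \<Rightarrow> real \<times> real" where
  "proj3 m n \<Gamma> p = (THE q. q \<in> \<Gamma> \<and> (\<exists>t. q = p + (m * t, n * t)))"

definition zeta1 :: "real \<Rightarrow> real \<Rightarrow> (real \<times> real) set \<Rightarrow> real \<times> real \<Rightarrow> real \<times> real" where
  "zeta1 m n \<Gamma> = proj3 m n \<Gamma> \<circ> proj1"

definition zeta2 :: "real \<Rightarrow> real \<Rightarrow> (real \<times> real) set \<Rightarrow> real \<times> real \<Rightarrow> real \<times> real" where
  "zeta2 m n \<Gamma> = proj3 m n \<Gamma> \<circ> proj2"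

definition Omega1 :: "(real \<Rightarrow> real) \<Rightarrow> (real \<Rightarrow> real) \<Rightarrow> (real \<times> real) set" where
  "Omega1 \<alpha>1 \<alpha>2 = {q \<in> curve \<alpha>1 \<alpha>2. (0, 1) \<in> tangent_space \<alpha>1 \<alpha>2 q}"

definition Omega2 :: "(real \<Rightarrow> real) \<Rightarrow> (real \<Rightarrow> real) \<Rightarrow> (real \<times> real) set" where
  "Omega2 \<alpha>1 \<alpha>2 = {q \<in> curve \<alpha>1 \<alpha>2. (1, 0) \<in> tangent_space \<alpha>1 \<alpha>2 q}"

definition Omega :: "(real \<Rightarrow> real) \<Rightarrow> (real \<Rightarrow> real) \<Rightarrow> (real \<times> real) set" where
  "Omega \<alpha>1 \<alpha>2 = Omega1 \<alpha>1 \<alpha>2 \<union> Omega2 \<alpha>1 \<alpha>2"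

section \<open>Function spaces\<close>

definition pdx :: "(real \<times> real \<Rightarrow> real) \<Rightarrow> real \<times> real \<Rightarrow> real" where
  "pdx f p = frechet_derivative f (at p) (1, 0)"

definition pdy :: "(real \<times> real \<Rightarrow> real) \<Rightarrow> real \<times> real \<Rightarrow> real" where
  "pdy f p = frechet_derivative f (at p) (0, 1)"

text \<open>To be used for open sets \<open>S\<close> only, as \<^const>\<open>pdx\<close> and \<^const>\<open>pdy\<close> are two-sided.\<close>

primrec Ck_on :: "nat \<Rightarrow> (real \<times> real) set \<Rightarrow> (real \<times> real \<Rightarrow> real) \<Rightarrow> bool" where
  "Ck_on 0 S f \<longleftrightarrow> continuous_on S f"
| "Ck_on (Suc k) S f \<longleftrightarrow>
     (\<forall>p\<in>S. f differentiable (at p)) \<and> Ck_on k S (pdx f) \<and> Ck_on k S (pdy f)"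

definition extends_to_closure :: "(real \<times> real) set \<Rightarrow> (real \<times> real \<Rightarrow> real) \<Rightarrow> bool" where
  "extends_to_closure S f \<longleftrightarrow> (\<exists>F. continuous_on (closure S) F \<and> (\<forall>p\<in>S. F p = f p))"

text \<open>\<open>C\<^sup>2\<close> up to the boundary: \<open>u\<close> is \<open>C\<^sup>2\<close> in the open set \<open>S\<close> and all its partial derivatives of
  order at most two extend continuously to the closure (\<open>u\<close> itself is the extension in order zero).\<close>

definition C2_closure :: "(real \<times> real) set \<Rightarrow> (real \<times> real \<Rightarrow> real) \<Rightarrow> bool" where
  "C2_closure S u \<longleftrightarrow>
     continuous_on (closure S) u \<and> Ck_on 2 S u \<and>
     (\<forall>v\<in>{pdx u, pdy u, pdx (pdx u), pdx (pdy u), pdy (pdx u), pdy (pdy u)}.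
        extends_to_closure S v)"

definition C2_boundary ::
    "(real \<Rightarrow> real) \<Rightarrow> (real \<Rightarrow> real) \<Rightarrow> (real \<times> real \<Rightarrow> real) \<Rightarrow> bool" where
  "C2_boundary \<alpha>1 \<alpha>2 g \<longleftrightarrow>
     continuous_on (frontier (curvilinear_triangle (curve \<alpha>1 \<alpha>2))) g \<and>
     C2_interval 0 1 (\<lambda>x. g (x, 0)) \<and> C2_interval 0 1 (\<lambda>y. g (0, y)) \<and>
     C2_interval (-1) 1 (\<lambda>z. g (\<alpha>1 z, \<alpha>2 z))"

definition test_function :: "(real \<times> real) set \<Rightarrow> (real \<times> real \<Rightarrow> real) \<Rightarrow> bool" where
  "test_function S \<phi> \<longleftrightarrow>
     (\<forall>k. Ck_on k UNIV \<phi>) \<and> compact (closure {p. \<phi> p \<noteq> 0}) \<and> closure {p. \<phi> p \<noteq> 0} \<subseteq> S"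

section \<open>Generalized solutions\<close>

definition generalized_solution ::
    "real \<Rightarrow> real \<Rightarrow> (real \<times> real) set \<Rightarrow> (real \<times> real \<Rightarrow> real) \<Rightarrow> (real \<times> real \<Rightarrow> real) \<Rightarrow> bool" where
  "generalized_solution m n S g u \<longleftrightarrow>
     continuous_on (closure S) u \<and> (\<forall>p\<in>frontier S. u p = g p) \<and>
     (\<forall>\<phi>. test_function S \<phi> \<longrightarrow>
        - (LINT p:S|lborel. u p * (m * pdx (pdx (pdy \<phi>)) p + n * pdy (pdx (pdy \<phi>)) p)) = 0)"

definition C2_solution ::
    "real \<Rightarrow> real \<Rightarrow> (real \<times> real) set \<Rightarrow> (real \<times> real \<Rightarrow> real) \<Rightarrow> (real \<times> real \<Rightarrow> real) \<Rightarrow> bool" where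
  "C2_solution m n S g u \<longleftrightarrow> C2_closure S u \<and> generalized_solution m n S g u"

text \<open>The values of a function outside the closure of \<open>S\<close> carry no information, so uniqueness means
  equality on the closure.\<close>

definition has_unique_C2_solution ::
    "real \<Rightarrow> real \<Rightarrow> (real \<times> real) set \<Rightarrow> (real \<times> real \<Rightarrow> real) \<Rightarrow> bool" where
  "has_unique_C2_solution m n S g \<longleftrightarrow>
     (\<exists>u. C2_solution m n S g u \<and>
          (\<forall>v. C2_solution m n S g v \<longrightarrow> (\<forall>p\<in>closure S. v p = u p)))"

end

theory Submission
  imports Defs
begin

text \<open>The quantity \<open>s = n x - m y\<close> increases along \<open>\<Gamma>\<close>; parametrize \<open>\<Gamma>\<close> by it and write \<open>a = n \<alpha>\<^sub>1\<close>,
  \<open>b = - m \<alpha>\<^sub>2\<close>, so that \<open>a + b = s\<close>, \<open>0 \<le> a' \<le> 1\<close>, and \<open>\<zeta>\<^sub>1\<close>, \<open>\<zeta>\<^sub>2\<close> become \<open>a\<close>, \<open>b\<close>. The mixed derivative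
  of a solution is constant along \<open>(m, n)\<close>, whence
  \<open>u(x, y) = u(x, 0) + u(0, y) - u(0, 0) + F(n x - m y) - F(n x) - F(- m y) + F(0)\<close>, and the condition on
  \<open>\<Gamma>\<close> is \<open>F(s) = F(a(s)) + F(b(s)) - F(0) + G(s)\<close>. Its derivative \<open>f = a' f \<circ> a + b' f \<circ> b + G'\<close> is the Poisson
  equation of a Markov chain preserving Lebesgue measure. Under the hypotheses on the guiding sets the chain
  always reaches the fixed points of \<open>a \<circ> b\<close> and \<open>b \<circ> a\<close>. If one of them lies outside \<open>\<Omega>\<close>, it is unique and
  the transition operator contracts a combination of the oscillation of \<open>f\<close> and the maximum of \<open>\<bar>f'\<bar>\<close>, so
  that the Neumann series converges. Otherwise the chain alternates between some \<open>s\<close> and \<open>t\<close>, and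
  \<open>G' s + G' t = 0\<close> is an obstruction.\<close>

section \<open>Differentiation on compact intervals\<close>

text \<open>The point \<open>s = 0\<close> is \<open>O'\<close>. The hypotheses on the guiding sets
  say that \<open>a' > 0\<close> on \<open>{-m..0}\<close> and \<open>a' < 1\<close> on
  \<open>{0..n}\<close>, so from either half the chain crosses to the other with probability bounded
  below. Differentiating the transition operator once more produces the weights
  \<open>(a')^2\<close> and \<open>(1 - a')^2\<close>, whose total is below 1 exactly where
  \<open>0 < a' < 1\<close>, that is off \<open>\<Omega>\<close>, and a further term,
  \<open>a''\<close> times a difference of values of \<open>f\<close>. The obstacle is that neither
  quantity contracts by itself: the derivative is fed by the oscillation, and the oscillation
  shrinks only up to the variation of \<open>f\<close> near the fixed pair, which the derivative
  controls. This is what forces the weighted combination. On the side of the differential equation,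
  \<open>u\<close> is only \<open>C\<^sup>2\<close>, so the third-order equation is available only
  in weak form; the constancy of the mixed derivative along \<open>(m, n)\<close> is extracted by
  testing with functions whose derivative along \<open>(m, n)\<close> is a difference of two
  bumps.\<close>

definition C2_with :: "real \<Rightarrow> real \<Rightarrow> (real \<Rightarrow> real) \<Rightarrow> (real \<Rightarrow> real) \<Rightarrow> (real \<Rightarrow> real) \<Rightarrow> bool" where
  "C2_with l r F f e \<longleftrightarrow>
     (\<forall>t\<in>{l..r}. (F has_real_derivative f t) (at t within {l..r})) \<and>
     (\<forall>t\<in>{l..r}. (f has_real_derivative e t) (at t within {l..r})) \<and> continuous_on {l..r} e"

lemma C2_interval_iff: "C2_interval l r F \<longleftrightarrow> (\<exists>f e. C2_with l r F f e)"
  by (simp add: C2_interval_def C2_with_def)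

lemma C2_withD:
  assumes "C2_with l r F f e"
  shows "\<And>t. t \<in> {l..r} \<Longrightarrow> (F has_real_derivative f t) (at t within {l..r})"
    and "\<And>t. t \<in> {l..r} \<Longrightarrow> (f has_real_derivative e t) (at t within {l..r})"
    and "continuous_on {l..r} e" "continuous_on {l..r} F" "continuous_on {l..r} f"
proof -
  show 1: "\<And>t. t \<in> {l..r} \<Longrightarrow> (F has_real_derivative f t) (at t within {l..r})"
    and 2: "\<And>t. t \<in> {l..r} \<Longrightarrow> (f has_real_derivative e t) (at t within {l..r})"
    and "continuous_on {l..r} e"
    using assms by (auto simp: C2_with_def)
  show "continuous_on {l..r} F" "continuous_on {l..r} f"
    using DERIV_continuous_on[OF 1] DERIV_continuous_on[OF 2] by blast+
qed

lemma mvt_within: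
  fixes f :: "real \<Rightarrow> real"
  assumes "\<And>t. t \<in> {l..r} \<Longrightarrow> (f has_real_derivative f' t) (at t within {l..r})"
    and "l \<le> x" "x < y" "y \<le> r"
  shows "\<exists>z\<in>{x<..<y}. f y - f x = f' z * (y - x)"
proof -
  have "(f has_derivative (*) (f' t)) (at t within {x..y})" if "x \<le> t" "t \<le> y" for t
  proof -
    have "(f has_real_derivative f' t) (at t within {x..y})"
      using assms(1)[of t] that assms(2-4) by (auto intro: has_field_derivative_subset)
    then show ?thesis by (simp add: has_field_derivative_def)
  qed
  from mvt_simple[OF \<open>x < y\<close> this] show ?thesis by auto
qed

lemma const_of_deriv_zero_within:
  fixes f :: "real \<Rightarrow> real"
  assumes "\<And>t. t \<in> {l..r} \<Longrightarrow> (f has_real_derivative 0) (at t within {l..r})"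
    and "x \<in> {l..r}" "y \<in> {l..r}"
  shows "f x = f y"
  using assms(2,3)
proof (induction x y rule: linorder_wlog)
  case (le x y)
  then show ?case
    using mvt_within[OF assms(1), where x=x and y=y] by (cases "x = y") auto
qed auto

lemma chain_within:
  fixes F :: "real \<Rightarrow> real"
  assumes "\<And>t. t \<in> {l..r} \<Longrightarrow> (F has_real_derivative f t) (at t within {l..r})"
    and "(h has_real_derivative h') (at s within S)" and "h ` S \<subseteq> {l..r}" and "s \<in> S"
  shows "((\<lambda>s. F (h s)) has_real_derivative h' * f (h s)) (at s within S)"
proof -
  have "(F has_real_derivative f (h s)) (at (h s) within h ` S)"
    using assms by (intro has_field_derivative_subset[OF assms(1)]) auto
  from DERIV_image_chain[OF this assms(2)] show ?thesis by (simp add: o_def mult.commute)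
qed

lemma deriv_within_unique:
  fixes f :: "real \<Rightarrow> real"
  assumes "(f has_real_derivative A) (at s within {l..r})" "(f has_real_derivative B) (at s within {l..r})"
    "l < r" "s \<in> {l..r}"
  shows "A = B"
proof -
  have "f' = f''" if "(f has_vector_derivative f') (at s within cbox l r)"
    "(f has_vector_derivative f'') (at s within cbox l r)" for f' f''
    using that assms(3,4)
    by (metis box_real(2) vector_derivative_within_cbox)
  then show ?thesis
    using assms by (auto simp: has_real_derivative_iff_has_vector_derivative)
qed

text \<open>With \<open>S_n\<close> the sum of the first \<open>n\<close> terms, extending the sum
  by \<open>M\<close> terms gives \<open>S_n \<le> S_M + \<theta> S_n\<close>, hence the uniform
  bound \<open>S_M / (1 - \<theta>)\<close>.\<close>

lemma summable_of_block_contraction: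
  fixes w :: "nat \<Rightarrow> real"
  assumes "\<And>k. 0 \<le> w k" "\<And>k. w (k + M) \<le> \<theta> * w k" "\<theta> < 1"
  shows "summable w"
proof (rule summableI_nonneg_bounded)
  fix n
  have "sum w {..<n} \<le> sum w {..<n + M}"
    by (intro sum_mono2) (auto simp: assms)
  also have "\<dots> = sum w {..<M} + (\<Sum>k<n. w (k + M))"
    using sum.atLeastLessThan_concat[of 0 M "n + M" w] sum.shift_bounds_nat_ivl[of w 0 M n]
    by (simp add: atLeast0LessThan)
  also have "\<dots> \<le> sum w {..<M} + (\<Sum>k<n. \<theta> * w k)"
    by (intro add_left_mono sum_mono assms)
  finally have "(1 - \<theta>) * sum w {..<n} \<le> sum w {..<M}"
    by (simp add: sum_distrib_left[symmetric] algebra_simps)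
  then show "sum w {..<n} \<le> sum w {..<M} / (1 - \<theta>)"
    using assms(3) by (simp add: field_simps)
qed (rule assms)

section \<open>The averaging operator\<close>

text \<open>The interval is the range of the parameter \<open>s\<close>, with \<open>0\<close> the
  parameter of \<open>O'\<close>. The slope \<open>a1\<close> vanishes at vertical tangents and
  equals 1 at horizontal ones, so \<open>a1_pos\<close> and \<open>a1_less_1\<close> express that
  \<open>Omega1\<close> lies beyond \<open>O'\<close> and \<open>Omega2\<close> before it.\<close>

locale averaging =
  fixes l r :: real and a a1 a2 :: "real \<Rightarrow> real"
  assumes l0: "l < 0" and r0: "0 < r"
    and a_C2: "C2_with l r a a1 a2"
    and a1_nonneg: "s \<in> {l..r} \<Longrightarrow> 0 \<le> a1 s"
    and a1_le_1: "s \<in> {l..r} \<Longrightarrow> a1 s \<le> 1"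
    and a1_pos: "s \<in> {l..0} \<Longrightarrow> 0 < a1 s"
    and a1_less_1: "s \<in> {0..r} \<Longrightarrow> a1 s < 1"
    and a_l: "a l = 0" and a_r: "a r = r"
begin

abbreviation "J \<equiv> {l..r}"

definition b where "b s = s - a s"

lemmas a_deriv = C2_withD(1)[OF a_C2] and a1_deriv = C2_withD(2)[OF a_C2]
  and a2_cont = C2_withD(3)[OF a_C2] and a_cont = C2_withD(4)[OF a_C2]
  and a1_cont = C2_withD(5)[OF a_C2]

lemma b_deriv: "s \<in> J \<Longrightarrow> (b has_real_derivative 1 - a1 s) (at s within J)"
  unfolding b_def by (intro derivative_intros a_deriv)

lemma b_cont: "continuous_on J b"
  unfolding b_def by (intro continuous_intros a_cont)

lemma a_mono: "s \<in> J \<Longrightarrow> t \<in> J \<Longrightarrow> s \<le> t \<Longrightarrow> a s \<le> a t"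
proof -
  assume *: "s \<in> J" "t \<in> J" "s \<le> t"
  show ?thesis
  proof (cases "s = t")
    case False
    with * obtain z where "z \<in> {s<..<t}" "a t - a s = a1 z * (t - s)"
      using mvt_within[OF a_deriv, of s t] by auto
    with * a1_nonneg[of z] have "a t - a s \<ge> 0" by auto
    then show ?thesis by simp
  qed simp
qed

lemma b_mono: "s \<in> J \<Longrightarrow> t \<in> J \<Longrightarrow> s \<le> t \<Longrightarrow> b s \<le> b t"
proof -
  assume *: "s \<in> J" "t \<in> J" "s \<le> t"
  show ?thesis
  proof (cases "s = t")
    case False
    with * obtain z where "z \<in> {s<..<t}" "b t - b s = (1 - a1 z) * (t - s)"
      using mvt_within[OF b_deriv, of s t] by auto
    with * a1_le_1[of z] have "b t - b s \<ge> 0" by auto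
    then show ?thesis by simp
  qed simp
qed

lemma a_range: "s \<in> J \<Longrightarrow> a s \<in> {0..r}"
  using a_mono[of l s] a_mono[of s r] a_l a_r l0 r0 by auto

lemma b_range: "s \<in> J \<Longrightarrow> b s \<in> {l..0}"
  using b_mono[of l s] b_mono[of s r] a_l a_r l0 r0 by (auto simp: b_def)

lemma a_J: "s \<in> J \<Longrightarrow> a s \<in> J" and b_J: "s \<in> J \<Longrightarrow> b s \<in> J"
  using a_range[of s] b_range[of s] l0 r0 by auto

lemma zero_J: "0 \<in> J" using l0 r0 by auto

text \<open>\<open>a \<circ> b\<close> maps \<open>{0..r}\<close> into itself, so the intermediate
  value theorem applies. The negative direction of the theorem rests on this: the pair
  \<open>s\<close>, \<open>b s\<close> found here carries the obstruction.\<close>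

lemma fixed_point_exists: "\<exists>s\<in>{0..r}. a (b s) = s"
proof -
  have "continuous_on J (\<lambda>s. a (b s))"
    using b_J by (intro continuous_on_compose2[OF a_cont b_cont]) blast
  then have cont: "continuous_on {0..r} (\<lambda>s. a (b s) - s)"
    using l0 by (intro continuous_on_diff continuous_on_id) (rule continuous_on_subset, auto)
  have "a (b r) - r \<le> 0" "0 \<le> a (b 0) - 0"
    using a_range[OF b_J[OF zero_J]] a_range[OF b_J[of r]] l0 r0 by auto
  from IVT2'[of "\<lambda>s. a (b s) - s" r 0 0, OF this less_imp_le[OF r0] cont]
  obtain s where "0 \<le> s" "s \<le> r" "a (b s) - s = 0" by blast
  then show ?thesis by (intro bexI[of _ s]) (simp_all only: atLeastAtMost_iff right_minus_eq)
qed

text \<open>Both \<open>a\<close> and \<open>b\<close> are nondecreasing and sum to the identity, so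
  neither can grow faster than its argument.\<close>

lemma ab_increment:
  assumes "s \<in> J" "t \<in> J" "s \<le> t"
  shows "a (b t) - a (b s) \<le> t - s" "a (b s) \<le> a (b t)"
proof -
  have 1: "b s \<le> b t" "a s \<le> a t" using assms b_mono a_mono by auto
  have "b (b s) \<le> b (b t)" using 1 assms b_mono b_J by auto
  then have "a (b t) - a (b s) \<le> b t - b s" by (simp add: b_def)
  also have "\<dots> \<le> t - s" using 1 by (simp add: b_def)
  finally show "a (b t) - a (b s) \<le> t - s" .
  show "a (b s) \<le> a (b t)" using 1 assms a_mono b_J by auto
qed

text \<open>Differentiating \<open>F s = F (a s) + F (b s) + G s\<close> gives \<open>f = T f + G'\<close>, where \<open>T\<close> is the transition operator
  from \<open>s\<close> to \<open>a s\<close> with probability \<open>a' s\<close> and to \<open>b s\<close> otherwise. The lazy version \<open>U = (1 + T) / 2\<close>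
  poses the same problem without the period 2 of the walk between the two half-intervals.\<close>

definition U where "U f = (\<lambda>s. (f s + a1 s * f (a s) + (1 - a1 s) * f (b s)) / 2)"
text \<open>The companion of \<open>U\<close> on antiderivatives: \<open>(V F)' = U F'\<close>.
  Subtracting \<open>F 0\<close> makes \<open>V\<close> preserve the values at both ends of
  \<open>J\<close>.\<close>

definition V where "V F = (\<lambda>s. (F s + F (a s) + F (b s) - F 0) / 2)"
text \<open>The leading part of the derivative of \<open>U f\<close>: the chain rule multiplies each
  transition probability by the slope of the transition map, which is the same number. Applied to
  the constant 1 it leaves \<open>1 - a1 (1 - a1)\<close>, which is below 1 exactly off
  \<open>\<Omega>\<close>.\<close>

definition Q where "Q e = (\<lambda>s. (e s + (a1 s)\<^sup>2 * e (a s) + (1 - a1 s)\<^sup>2 * e (b s)) / 2)"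
definition DU where "DU f e = (\<lambda>s. Q e s + a2 s * (f (a s) - f (b s)) / 2)"

text \<open>The derivative of \<open>(U ^^ k) f\<close> if \<open>e\<close> is that of
  \<open>f\<close>. The recursion refers to the iterate itself because of the curvature term with
  \<open>a2\<close> in \<open>DU\<close>.\<close>

primrec DUs where
  "DUs f e 0 = e"
| "DUs f e (Suc k) = DU ((U ^^ k) f) (DUs f e k)"

lemma step_C2:
  assumes "C2_with l r F f e"
  shows "C2_with l r (V F) (U f) (DU f e)"
proof -
  note F = C2_withD[OF assms]
  have im: "a ` J \<subseteq> J" "b ` J \<subseteq> J" using a_J b_J by auto
  note ch = chain_within[OF F(1) a_deriv im(1)] chain_within[OF F(1) b_deriv im(2)]
    chain_within[OF F(2) a_deriv im(1)] chain_within[OF F(2) b_deriv im(2)]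
  have "(V F has_real_derivative U f s) (at s within J)" if "s \<in> J" for s
  proof -
    have "(V F has_real_derivative (f s + a1 s * f (a s) + (1 - a1 s) * f (b s) - 0) / 2) (at s within J)"
      unfolding V_def using that by (intro DERIV_cdivide DERIV_diff DERIV_add DERIV_const F(1) ch) auto
    then show ?thesis by (simp add: U_def)
  qed
  moreover have "(U f has_real_derivative DU f e s) (at s within J)" if "s \<in> J" for s
  proof -
    have "(U f has_real_derivative (e s + (a2 s * f (a s) + (a1 s * e (a s)) * a1 s)
        + ((0 - a2 s) * f (b s) + ((1 - a1 s) * e (b s)) * (1 - a1 s))) / 2) (at s within J)"
      unfolding U_def using that
      by (intro DERIV_cdivide DERIV_diff DERIV_add DERIV_mult DERIV_const F(2) a1_deriv ch) auto
    then show ?thesis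
      by (rule DERIV_cong) (simp add: DU_def Q_def field_simps power2_eq_square)
  qed
  moreover have "continuous_on J (DU f e)"
    unfolding DU_def Q_def
    by (intro continuous_intros a1_cont a2_cont F a_cont b_cont
        continuous_on_compose2[OF F(3) a_cont] continuous_on_compose2[OF F(3) b_cont]
        continuous_on_compose2[OF F(5) a_cont] continuous_on_compose2[OF F(5) b_cont] im) auto
  ultimately show ?thesis by (simp add: C2_with_def)
qed

lemma iterate_C2:
  assumes "C2_with l r F f e"
  shows "C2_with l r ((V ^^ k) F) ((U ^^ k) f) (DUs f e k)"
  by (induction k) (simp_all add: assms step_C2)

lemma U_upper:
  assumes "\<And>s. s \<in> J \<Longrightarrow> f s \<le> M" "s \<in> J"
  shows "U f s \<le> M"
proof -
  have "a1 s * f (a s) \<le> a1 s * M" "(1 - a1 s) * f (b s) \<le> (1 - a1 s) * M"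
    using assms a_J b_J a1_nonneg a1_le_1 by (auto intro!: mult_left_mono)
  then have "f s + a1 s * f (a s) + (1 - a1 s) * f (b s) \<le> M + a1 s * M + (1 - a1 s) * M"
    using assms by force
  then show ?thesis by (simp add: U_def algebra_simps)
qed

lemma U_iter_upper:
  assumes "\<And>s. s \<in> J \<Longrightarrow> f s \<le> M" "s \<in> J"
  shows "(U ^^ k) f s \<le> M"
  using assms(2) by (induction k arbitrary: s) (auto simp: assms(1) intro: U_upper)

lemma U_uminus: "(U ^^ k) (\<lambda>s. - f s) s = - (U ^^ k) f s"
  by (induction k arbitrary: s) (auto simp: U_def field_simps)

lemma Q_mono:
  assumes "\<And>s. s \<in> J \<Longrightarrow> e s \<le> e' s" "s \<in> J"
  shows "Q e s \<le> Q e' s"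
  unfolding Q_def using assms a_J b_J
  by (intro divide_right_mono add_mono mult_left_mono) auto

lemma Q_1: "s \<in> J \<Longrightarrow> Q (\<lambda>_. 1) s = 1 - a1 s * (1 - a1 s)"
  by (simp add: Q_def power2_eq_square field_simps)

lemma Q_1_le: "s \<in> J \<Longrightarrow> Q (\<lambda>_. 1) s \<le> 1"
  using a1_nonneg[of s] a1_le_1[of s] by (simp add: Q_1)

lemma Q_lin: "Q (\<lambda>s. c * e s + d) s = c * Q e s + d * Q (\<lambda>_. 1) s"
  by (simp add: Q_def field_simps)

lemma Q_iter_le_1: "s \<in> J \<Longrightarrow> (Q ^^ k) (\<lambda>_. 1) s \<le> 1"
proof (induction k arbitrary: s)
  case (Suc k)
  then have "Q ((Q ^^ k) (\<lambda>_. 1)) s \<le> Q (\<lambda>_. 1) s" by (intro Q_mono) auto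
  with Suc.prems Q_1_le show ?case by fastforce
qed simp

text \<open>\<open>Q\<close> is positive and does not increase constants, and \<open>U\<close> does
  not increase the oscillation. So the initial derivative is damped by \<open>Q ^^ k\<close>, while
  each step adds at most one curvature term \<open>A / 2 * \<omega>\<close>.\<close>

lemma DUs_bound:
  assumes e: "\<And>s. s \<in> J \<Longrightarrow> \<bar>e s\<bar> \<le> L" and f: "\<And>s t. s \<in> J \<Longrightarrow> t \<in> J \<Longrightarrow> f s - f t \<le> \<omega>"
    and A: "\<And>s. s \<in> J \<Longrightarrow> \<bar>a2 s\<bar> \<le> A" and s: "s \<in> J"
  shows "\<bar>DUs f e k s\<bar> \<le> L * (Q ^^ k) (\<lambda>_. 1) s + real k * (A / 2 * \<omega>)"
  using s
proof (induction k arbitrary: s)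
  case (Suc k)
  define g where "g = (U ^^ k) f"
  have g: "\<bar>g x - g y\<bar> \<le> \<omega>" if "x \<in> J" "y \<in> J" for x y
  proof -
    have up: "g t \<le> f u + \<omega>" if "t \<in> J" "u \<in> J" for t u
      unfolding g_def by (rule U_iter_upper) (use f[of _ u] that in \<open>auto simp: algebra_simps\<close>)
    have "- g t \<le> \<omega> - g u" if "t \<in> J" "u \<in> J" for t u
      using U_iter_upper[of "\<lambda>s. - f s" "\<omega> - g u" t k] up[OF that(2)] that
      by (auto simp: U_uminus g_def[symmetric] algebra_simps)
    from this[of x y] this[of y x] that show ?thesis by linarith
  qed
  have A0: "0 \<le> A" and w0: "0 \<le> \<omega>" using A[OF Suc.prems] f[OF Suc.prems Suc.prems] by auto
  have "\<bar>Q (DUs f e k) s\<bar> \<le> Q (\<lambda>s. \<bar>DUs f e k s\<bar>) s"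
  proof -
    have "\<bar>x + y + z\<bar> \<le> \<bar>x\<bar> + \<bar>y\<bar> + \<bar>z\<bar>" for x y z :: real by linarith
    from this[of "DUs f e k s" "(a1 s)\<^sup>2 * DUs f e k (a s)" "(1 - a1 s)\<^sup>2 * DUs f e k (b s)"]
    show ?thesis unfolding Q_def by (simp add: abs_mult)
  qed
  also have "\<dots> \<le> Q (\<lambda>s. L * (Q ^^ k) (\<lambda>_. 1) s + real k * (A / 2 * \<omega>)) s"
    by (intro Q_mono Suc)
  also have "\<dots> \<le> L * (Q ^^ Suc k) (\<lambda>_. 1) s + real k * (A / 2 * \<omega>)"
    using Q_1_le[OF Suc.prems] A0 w0 by (simp add: Q_lin mult_left_le)
  finally have 1: "\<bar>Q (DUs f e k) s\<bar> \<le> L * (Q ^^ Suc k) (\<lambda>_. 1) s + real k * (A / 2 * \<omega>)" .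
  have "\<bar>a2 s * (g (a s) - g (b s))\<bar> \<le> A * \<omega>"
    unfolding abs_mult using A[OF Suc.prems] g a_J b_J Suc.prems A0 by (intro mult_mono) auto
  then have "\<bar>a2 s * (g (a s) - g (b s)) / 2\<bar> \<le> A / 2 * \<omega>" by simp
  then have "\<bar>Q (DUs f e k) s + a2 s * (g (a s) - g (b s)) / 2\<bar>
      \<le> L * (Q ^^ Suc k) (\<lambda>_. 1) s + real k * (A / 2 * \<omega>) + A / 2 * \<omega>"
    using 1 by linarith
  moreover have "real (Suc k) * (A / 2 * \<omega>) = real k * (A / 2 * \<omega>) + A / 2 * \<omega>"
    by (simp add: ring_distribs)
  ultimately show ?case by (simp only: DUs.simps DU_def g_def add.assoc)
qed (use e in auto)

end

text \<open>\<open>s0\<close> and \<open>b s0\<close> are exchanged by \<open>b\<close> and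
  \<open>a\<close>. Since \<open>s0\<close> is in the right half and \<open>b s0\<close> in the
  left, \<open>a1 s0 < 1\<close> and \<open>0 < a1 (b s0)\<close> hold anyway, so
  \<open>good\<close> says that one of the two points lies off \<open>\<Omega>\<close>.\<close>

locale averaging_good = averaging +
  fixes s0
  assumes s0_range: "s0 \<in> {0..r}" and s0_fixed: "a (b s0) = s0"
    and good: "0 < a1 s0 \<or> a1 (b s0) < 1"
begin

lemma s0_J: "s0 \<in> J" using s0_range l0 by auto

text \<open>As \<open>a \<circ> b\<close> has slope at most 1, it would have slope 1 between two fixed points.\<close>

lemma fixed_point_unique:
  assumes "s \<in> {0..r}" "a (b s) = s"
  shows "s = s0"
proof (rule ccontr)
  assume "s \<noteq> s0"
  define x y where "x = min s s0" and "y = max s s0"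
  have xy: "x < y" "x \<in> {0..r}" "y \<in> {0..r}" "a (b x) = x" "a (b y) = y" "s0 \<in> {x..y}"
    using assms \<open>s \<noteq> s0\<close> s0_range s0_fixed by (auto simp: x_def y_def min_def max_def)
  have sub: "{x..y} \<subseteq> J" using xy l0 by auto
  \<comment> \<open>A map with Lipschitz constant 1 that fixes both ends of an interval can neither
    lag behind the identity nor overtake it in between.\<close>
  have "a (b t) = t" if "t \<in> {x..y}" for t
    using ab_increment(1)[of x t] ab_increment(1)[of t y] that xy sub by force
  then have "((\<lambda>t. a (b t)) has_real_derivative 1) (at s0 within {x..y})"
    using xy(6) by (intro has_field_derivative_transform_within[OF DERIV_ident zero_less_one]) auto
  moreover have "((\<lambda>t. a (b t)) has_real_derivative (1 - a1 s0) * a1 (b s0)) (at s0 within {x..y})"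
    using b_J by (intro has_field_derivative_subset[OF chain_within[OF a_deriv b_deriv[OF s0_J] _ s0_J] sub])
      blast+
  ultimately have eq: "(1 - a1 s0) * a1 (b s0) = 1"
    using deriv_within_unique xy by blast
  have "0 \<le> a1 s0" "a1 s0 \<le> 1" "0 \<le> a1 (b s0)" "a1 (b s0) \<le> 1"
    using a1_nonneg a1_le_1 s0_J b_J by auto
  then have "(1 - a1 s0) * a1 (b s0) \<le> 1 - a1 s0" "(1 - a1 s0) * a1 (b s0) \<le> a1 (b s0)"
    by (auto intro!: mult_left_le mult_left_le_one_le)
  with eq good \<open>0 \<le> a1 s0\<close> \<open>a1 (b s0) \<le> 1\<close> show False by linarith
qed

section \<open>Attraction of all orbits of \<open>a \<circ> b\<close> by the fixed point\<close>

abbreviation "\<phi> \<equiv> \<lambda>s. a (b s)"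

lemma \<phi>_range: "s \<in> J \<Longrightarrow> \<phi> s \<in> {0..r}"
  using a_range b_J by blast

lemma \<phi>_iter_range: "s \<in> {0..r} \<Longrightarrow> (\<phi> ^^ k) s \<in> {0..r}"
proof (induction k)
  case (Suc k)
  then have "(\<phi> ^^ k) s \<in> J" using l0 by auto
  from \<phi>_range[OF this] show ?case by simp
qed simp

lemma \<phi>_iter_mono: "s \<in> {0..r} \<Longrightarrow> t \<in> {0..r} \<Longrightarrow> s \<le> t \<Longrightarrow> (\<phi> ^^ k) s \<le> (\<phi> ^^ k) t"
proof (induction k)
  case (Suc k)
  then show ?case
    using ab_increment(2)[of "(\<phi> ^^ k) s" "(\<phi> ^^ k) t"]
      \<phi>_iter_range[of s k] \<phi>_iter_range[of t k] l0 by auto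
qed simp

lemma \<phi>_iter_limit:
  assumes "s \<in> {0..r}" "(\<lambda>k. (\<phi> ^^ k) s) \<longlonglongrightarrow> L"
  shows "L = s0"
proof (rule fixed_point_unique)
  show L: "L \<in> {0..r}"
    using closed_sequentially[OF closed_atLeastAtMost _ assms(2)] \<phi>_iter_range[OF assms(1)] by blast
  have "continuous_on J \<phi>"
    using b_J by (intro continuous_on_compose2[OF a_cont b_cont]) blast
  moreover have "(\<phi> ^^ k) s \<in> J" for k
    using \<phi>_iter_range[OF assms(1), of k] l0 by simp
  ultimately have "(\<lambda>k. \<phi> ((\<phi> ^^ k) s)) \<longlonglongrightarrow> \<phi> L"
    using L l0 by (intro continuous_on_tendsto_compose[OF _ assms(2), of J \<phi>] always_eventually) auto
  moreover have "(\<lambda>k. \<phi> ((\<phi> ^^ k) s)) \<longlonglongrightarrow> L"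
    using LIMSEQ_Suc[OF assms(2)] by simp
  ultimately show "\<phi> L = L" by (rule LIMSEQ_unique)
qed

text \<open>The orbits of the two end points are monotone and bounded, so they converge to fixed
  points, and there is only one. As \<open>\<phi>\<close> is monotone they enclose every other
  orbit, which makes the convergence uniform on \<open>{0..r}\<close>.\<close>

lemma \<phi>_iter_tendsto:
  shows "(\<lambda>k. (\<phi> ^^ k) 0) \<longlonglongrightarrow> s0" "(\<lambda>k. (\<phi> ^^ k) r) \<longlonglongrightarrow> s0"
proof -
  have 0: "0 \<in> {0..r}" "r \<in> {0..r}" using r0 by auto
  have "\<phi> 0 \<in> {0..r}" "\<phi> r \<in> {0..r}" using \<phi>_range l0 r0 by auto
  then have "(\<phi> ^^ k) 0 \<le> (\<phi> ^^ k) (\<phi> 0)" "(\<phi> ^^ k) (\<phi> r) \<le> (\<phi> ^^ k) r" for k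
    using 0 by (auto intro!: \<phi>_iter_mono)
  then have "incseq (\<lambda>k. (\<phi> ^^ k) 0)" "decseq (\<lambda>k. (\<phi> ^^ k) r)"
    by (auto intro!: incseq_SucI decseq_SucI simp: funpow_swap1[of \<phi>])
  moreover have "(\<phi> ^^ k) 0 \<le> r" "0 \<le> (\<phi> ^^ k) r" for k
    using \<phi>_iter_range[OF 0(1), of k] \<phi>_iter_range[OF 0(2), of k] by auto
  ultimately have inc: "incseq (\<lambda>k. (\<phi> ^^ k) 0)" and dec: "decseq (\<lambda>k. (\<phi> ^^ k) r)"
    and bd: "\<And>k. (\<phi> ^^ k) 0 \<le> r" "\<And>k. 0 \<le> (\<phi> ^^ k) r"
    by blast+
  obtain L where "(\<lambda>k. (\<phi> ^^ k) 0) \<longlonglongrightarrow> L"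
    by (rule incseq_convergent[OF inc allI[OF bd(1)]])
  with \<phi>_iter_limit[OF 0(1)] show "(\<lambda>k. (\<phi> ^^ k) 0) \<longlonglongrightarrow> s0" by blast
  obtain L' where "(\<lambda>k. (\<phi> ^^ k) r) \<longlonglongrightarrow> L'"
    by (rule decseq_convergent[OF dec allI[OF bd(2)]])
  with \<phi>_iter_limit[OF 0(2)] show "(\<lambda>k. (\<phi> ^^ k) r) \<longlonglongrightarrow> s0" by blast
qed

text \<open>Following the transitions of positive probability, every point of \<open>J\<close> comes near \<open>s0\<close>
  within a uniformly bounded number of steps.\<close>

lemma reach:
  assumes mono: "\<And>k. E k \<subseteq> E (Suc k)"
    and Eb: "\<And>k s. s \<in> {0..r} \<Longrightarrow> b s \<in> E k \<Longrightarrow> s \<in> E (Suc k)"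
    and Ea: "\<And>k s. s \<in> {l..0} \<Longrightarrow> a s \<in> E k \<Longrightarrow> s \<in> E (Suc k)"
    and pos: "0 < \<delta>" and near: "\<And>s. s \<in> {0..r} \<Longrightarrow> \<bar>s - s0\<bar> < \<delta> \<Longrightarrow> s \<in> E k0"
  shows "\<exists>K. J \<subseteq> E K"
proof -
  have "\<forall>\<^sub>F k in sequentially. dist ((\<phi> ^^ k) 0) s0 < \<delta> \<and> dist ((\<phi> ^^ k) r) s0 < \<delta>"
    using \<phi>_iter_tendsto pos by (auto intro: eventually_conj tendstoD)
  then obtain N where N: "dist ((\<phi> ^^ N) 0) s0 < \<delta>" "dist ((\<phi> ^^ N) r) s0 < \<delta>"
    by (auto simp: eventually_sequentially)
  have start: "(\<phi> ^^ N) s \<in> E k0" if "s \<in> {0..r}" for s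
  proof (rule near[OF \<phi>_iter_range[OF that]])
    show "\<bar>(\<phi> ^^ N) s - s0\<bar> < \<delta>"
      using \<phi>_iter_mono[of 0 s N] \<phi>_iter_mono[of s r N] that N by (auto simp: dist_real_def)
  qed
  \<comment> \<open>One application of \<open>\<phi>\<close> is two transitions, \<open>b\<close>
    from the right half and then \<open>a\<close> from the left half; each raises the index of
    \<open>E\<close> by one.\<close>
  have pullback: "s \<in> E (2 * j + k)" if "s \<in> {0..r}" "(\<phi> ^^ j) s \<in> E k" for j k s
    using that
  proof (induction j arbitrary: s)
    case (Suc j)
    have "s \<in> J" using Suc.prems l0 by auto
    then have "\<phi> s \<in> E (2 * j + k)"
      using Suc.IH[of "\<phi> s"] Suc.prems(2) \<phi>_range by (simp add: funpow_swap1[of \<phi>])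
    then have "b s \<in> E (Suc (2 * j + k))"
      using Ea b_range \<open>s \<in> J\<close> by blast
    from Eb[OF Suc.prems(1) this] show ?case by simp
  qed simp
  let ?K = "2 * N + k0"
  \<comment> \<open>The additional index pays for points left of \<open>0\<close>, which first move
    by \<open>a\<close> into \<open>{0..r}\<close>.\<close>
  have "s \<in> E (Suc ?K)" if "s \<in> J" for s
  proof (cases "0 \<le> s")
    case True
    with that have "s \<in> {0..r}" by auto
    from pullback[OF this start[OF this]] mono show ?thesis by blast
  next
    case False
    with that have "s \<in> {l..0}" by auto
    with Ea pullback start a_range[OF that] show ?thesis by blast
  qed
  then show ?thesis by blast
qed

section \<open>Uniform chances of reaching the fixed pair, and the loss of mass there\<close>

lemma weights_bounded_below:
  obtains c where "0 < c" "c \<le> 1" "\<And>s. s \<in> {l..0} \<Longrightarrow> c \<le> a1 s" "\<And>s. s \<in> {0..r} \<Longrightarrow> c \<le> 1 - a1 s"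
proof -
  have "continuous_on {l..0} a1" "continuous_on {0..r} (\<lambda>s. 1 - a1 s)"
    using l0 r0 by (auto intro!: continuous_intros intro: continuous_on_subset[OF a1_cont])
  then obtain x y where x: "x \<in> {l..0}" "\<forall>s\<in>{l..0}. a1 x \<le> a1 s"
    and y: "y \<in> {0..r}" "\<forall>s\<in>{0..r}. 1 - a1 y \<le> 1 - a1 s"
    using continuous_attains_inf[of "{l..0}" a1] continuous_attains_inf[of "{0..r}" "\<lambda>s. 1 - a1 s"] l0 r0
    by auto
  have "a1 x \<le> 1" using x l0 r0 by (intro a1_le_1) auto
  then show ?thesis
    using that[of "min (a1 x) (1 - a1 y)"] x y a1_pos[of x] a1_less_1[of y]
    by (auto simp: min_le_iff_disj)
qed

lemma U_gap: "M - U g s = ((M - g s) + a1 s * (M - g (a s)) + (1 - a1 s) * (M - g (b s))) / 2"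
  by (simp add: U_def field_simps)

text \<open>A Doeblin condition: after \<open>K\<close> steps the lazy chain is within
  \<open>\<delta>\<close> of \<open>s0\<close> with probability at least \<open>\<eta>\<close>, and
  there \<open>f\<close> is at most \<open>\<beta>\<close> instead of \<open>M\<close>. The numbers
  \<open>K\<close> and \<open>\<eta>\<close> are uniform in \<open>f\<close>, \<open>M\<close> and
  \<open>\<beta>\<close>.\<close>

lemma minorization:
  assumes \<delta>: "0 < \<delta>"
  shows "\<exists>K \<eta>. 0 < \<eta> \<and> \<eta> \<le> 1 \<and>
    (\<forall>f M \<beta>. (\<forall>s\<in>J. f s \<le> M) \<longrightarrow> (\<forall>s\<in>J. \<bar>s - s0\<bar> < \<delta> \<longrightarrow> f s \<le> \<beta>) \<longrightarrow> \<beta> \<le> M \<longrightarrow>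
      (\<forall>s\<in>J. (U ^^ K) f s \<le> M - \<eta> * (M - \<beta>)))"
proof -
  obtain c where c: "0 < c" "c \<le> 1" "\<And>s. s \<in> {l..0} \<Longrightarrow> c \<le> a1 s" "\<And>s. s \<in> {0..r} \<Longrightarrow> c \<le> 1 - a1 s"
    using weights_bounded_below by blast
  define adm where "adm f M \<beta> \<longleftrightarrow> (\<forall>s\<in>J. f s \<le> M) \<and> (\<forall>s\<in>J. \<bar>s - s0\<bar> < \<delta> \<longrightarrow> f s \<le> \<beta>) \<and> \<beta> \<le> M"
    for f :: "real \<Rightarrow> real" and M \<beta>
  \<comment> \<open>\<open>c / 2\<close> bounds the probability of a prescribed move from below:
    \<open>c\<close> for the direction, \<open>1 / 2\<close> for the laziness.\<close>
  define E where "E k = {s \<in> J. \<forall>f M \<beta>. adm f M \<beta> \<longrightarrow> (c / 2) ^ k * (M - \<beta>) \<le> M - (U ^^ k) f s}" for k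
  have gap: "c * x \<le> w * y" if "x \<le> y" "c \<le> w" "0 \<le> x" for x y w :: real
    using that c(1) by (intro mult_mono) auto
  \<comment> \<open>By \<open>U_gap\<close> the new gap is half a sum of nonnegative terms, so one
    large gap suffices; the term for staying put makes \<open>E\<close> increase with
    \<open>k\<close>.\<close>
  have step: "s \<in> E (Suc k)"
    if s: "s \<in> E k \<or> s \<in> {0..r} \<and> b s \<in> E k \<or> s \<in> {l..0} \<and> a s \<in> E k" for s k
  proof -
    have J: "s \<in> J" using s l0 r0 by (auto simp: E_def)
    have "(c / 2) ^ Suc k * (M - \<beta>) \<le> M - U ((U ^^ k) f) s" if A: "adm f M \<beta>" for f M \<beta>
    proof -
      define x y where "x = (c / 2) ^ k * (M - \<beta>)" and "y t = M - (U ^^ k) f t" for t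
      have x0: "0 \<le> x" using A c(1) by (auto simp: adm_def x_def)
      have y0: "0 \<le> y t" if "t \<in> J" for t
        using U_iter_upper[of f M] A that by (auto simp: adm_def y_def)
      have E: "x \<le> y t" if "t \<in> E k" for t using that A by (auto simp: E_def x_def y_def)
      from s have "c * x \<le> 1 * y s \<or> c * x \<le> (1 - a1 s) * y (b s) \<or> c * x \<le> a1 s * y (a s)"
        using gap[OF E c(2) x0] gap[OF E c(4) x0] gap[OF E c(3) x0] by blast
      moreover have "0 \<le> y s" "0 \<le> a1 s * y (a s)" "0 \<le> (1 - a1 s) * y (b s)"
        using y0 J a_J b_J a1_nonneg a1_le_1 by simp_all
      ultimately have "c * x \<le> y s + a1 s * y (a s) + (1 - a1 s) * y (b s)" by linarith
      then have "c * x / 2 \<le> M - U ((U ^^ k) f) s"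
        unfolding U_gap y_def by (rule divide_right_mono) simp
      then show ?thesis by (simp add: x_def)
    qed
    with J show ?thesis by (auto simp: E_def)
  qed
  have "\<exists>K. J \<subseteq> E K"
  proof (rule reach[OF _ _ _ \<delta>])
    show "s \<in> E 0" if "s \<in> {0..r}" "\<bar>s - s0\<bar> < \<delta>" for s
      using that l0 by (auto simp: E_def adm_def)
  qed (use step in blast)+
  then obtain K where "J \<subseteq> E K" ..
  then have "\<forall>s\<in>J. (U ^^ K) f s \<le> M - (c / 2) ^ K * (M - \<beta>)" if "adm f M \<beta>" for f M \<beta>
    using that by (fastforce simp: E_def)
  moreover have "0 < (c / 2) ^ K" "(c / 2) ^ K \<le> 1" using c by (auto intro!: power_le_one)
  ultimately show ?thesis unfolding adm_def by blast
qed

text \<open>The deficit from mass 1 obeys a recursion like that of the gap for \<open>U\<close>,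
  with squared weights and the additional nonnegative loss \<open>a1 s * (1 - a1 s)\<close>.\<close>

lemma Q_gap: "1 - Q e s \<ge> ((1 - e s) + (a1 s)\<^sup>2 * (1 - e (a s)) + (1 - a1 s)\<^sup>2 * (1 - e (b s))) / 2"
  if "s \<in> J"
proof -
  have "1 - Q e s = ((1 - e s) + (a1 s)\<^sup>2 * (1 - e (a s)) + (1 - a1 s)\<^sup>2 * (1 - e (b s))) / 2
      + a1 s * (1 - a1 s)"
    by (simp add: Q_def field_simps power2_eq_square)
  then show ?thesis using a1_nonneg[OF that] a1_le_1[OF that] by simp
qed

text \<open>\<open>Q\<close> loses mass exactly where \<open>0 < a1 < 1\<close>. By
  \<open>good\<close> this happens near a member of the fixed pair, and every starting point reaches
  that place in bounded time with a weight bounded below, so the mass drops uniformly.\<close>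

lemma Q_contraction: "\<exists>N \<rho>. 0 < N \<and> 0 \<le> \<rho> \<and> \<rho> < 1 \<and> (\<forall>s\<in>J. (Q ^^ N) (\<lambda>_. 1) s \<le> \<rho>)"
proof -
  obtain c where c: "0 < c" "c \<le> 1" "\<And>s. s \<in> {l..0} \<Longrightarrow> c \<le> a1 s" "\<And>s. s \<in> {0..r} \<Longrightarrow> c \<le> 1 - a1 s"
    using weights_bounded_below by blast
  \<comment> \<open>A member of the fixed pair that lies off \<open>\<Omega>\<close>; the second
    strict inequality at \<open>p\<close> comes from the half that contains it.\<close>
  define p where "p = (if 0 < a1 s0 then s0 else b s0)"
  have p: "p \<in> J" "0 < a1 p" "a1 p < 1"
    using good s0_J b_J s0_range b_range[OF s0_J] a1_pos[of "b s0"] a1_less_1[of s0]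
    by (auto simp: p_def split: if_splits)
  \<comment> \<open>Half of the loss at \<open>p\<close>, so that by continuity the loss exceeds
    \<open>\<kappa>\<close> in a whole neighbourhood of \<open>p\<close>.\<close>
  define \<kappa> where "\<kappa> = a1 p * (1 - a1 p) / 2"
  have "a1 p * (1 - a1 p) \<le> 1" using p by (intro mult_le_one) auto
  then have \<kappa>: "0 < \<kappa>" "\<kappa> \<le> 1" using p by (auto simp: \<kappa>_def)
  let ?q = "\<lambda>k. (Q ^^ k) (\<lambda>_. 1)"
  \<comment> \<open>\<open>Suc k\<close>, because the loss near \<open>p\<close> itself takes one
    application of \<open>Q\<close>; each move towards \<open>p\<close> costs a squared
    weight.\<close>
  define E where "E k = {s \<in> J. (c\<^sup>2 / 2) ^ k * \<kappa> \<le> 1 - ?q (Suc k) s}" for k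
  have gap: "c\<^sup>2 * x \<le> w\<^sup>2 * y" if "x \<le> y" "c \<le> w" "0 \<le> x" for x y w :: real
    using that c(1) by (intro mult_mono power_mono) auto
  have step: "s \<in> E (Suc k)"
    if s: "s \<in> E k \<or> s \<in> {0..r} \<and> b s \<in> E k \<or> s \<in> {l..0} \<and> a s \<in> E k" for s k
  proof -
    have J: "s \<in> J" using s l0 r0 by (auto simp: E_def)
    define x y where "x = (c\<^sup>2 / 2) ^ k * \<kappa>" and "y t = 1 - ?q (Suc k) t" for t
    have x0: "0 \<le> x" using \<kappa> by (simp add: x_def)
    have y0: "0 \<le> y t" if "t \<in> J" for t
      using Q_iter_le_1[OF that, of "Suc k"] by (simp add: y_def del: funpow.simps)
    have E: "x \<le> y t" if "t \<in> E k" for t using that by (simp add: E_def x_def y_def del: funpow.simps)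
    from s have "c\<^sup>2 * x \<le> 1\<^sup>2 * y s \<or> c\<^sup>2 * x \<le> (1 - a1 s)\<^sup>2 * y (b s) \<or> c\<^sup>2 * x \<le> (a1 s)\<^sup>2 * y (a s)"
      using gap[OF E c(2) x0] gap[OF E c(4) x0] gap[OF E c(3) x0] by blast
    moreover have "0 \<le> y s" "0 \<le> (a1 s)\<^sup>2 * y (a s)" "0 \<le> (1 - a1 s)\<^sup>2 * y (b s)"
      using y0 J a_J b_J by simp_all
    ultimately have "c\<^sup>2 * x \<le> y s + (a1 s)\<^sup>2 * y (a s) + (1 - a1 s)\<^sup>2 * y (b s)"
      unfolding one_power2 by linarith
    then have "c\<^sup>2 * x / 2 \<le> 1 - Q (?q (Suc k)) s"
      unfolding y_def by (rule order_trans[OF divide_right_mono Q_gap[OF J]]) simp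
    then show ?thesis using J by (simp add: E_def x_def)
  qed
  have "continuous_on J (\<lambda>s. a1 s * (1 - a1 s))" by (intro continuous_intros a1_cont)
  then obtain \<epsilon> where \<epsilon>: "0 < \<epsilon>"
    "\<And>s. s \<in> J \<Longrightarrow> dist s p < \<epsilon> \<Longrightarrow> dist (a1 s * (1 - a1 s)) (a1 p * (1 - a1 p)) < \<kappa>"
    unfolding continuous_on_iff using p(1) \<kappa>(1) by metis
  have near_p: "s \<in> E 0" if "s \<in> J" "dist s p < \<epsilon>" for s
  proof -
    have "a1 p * (1 - a1 p) - a1 s * (1 - a1 s) < \<kappa>"
      using \<epsilon>(2)[OF that] unfolding dist_real_def by (subst (asm) abs_less_iff) (simp only: minus_diff_eq)
    moreover have "a1 p * (1 - a1 p) = 2 * \<kappa>" by (simp add: \<kappa>_def)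
    ultimately show ?thesis using that by (simp add: E_def Q_1)
  qed
  \<comment> \<open>\<open>reach\<close> starts from a neighbourhood of \<open>s0\<close>. If
    \<open>p = b s0\<close>, one transition by \<open>b\<close> lies between the two points, whence
    the starting index 1.\<close>
  have "\<exists>\<delta>>0. \<forall>s\<in>{0..r}. \<bar>s - s0\<bar> < \<delta> \<longrightarrow> s \<in> E 1"
  proof (cases "0 < a1 s0")
    case True
    then have "p = s0" by (simp add: p_def)
    then show ?thesis
      using near_p step[of _ 0] \<epsilon>(1) l0 by (intro exI[of _ \<epsilon>]) (auto simp: dist_real_def)
  next
    case False
    then have "p = b s0" by (simp add: p_def)
    obtain \<delta> where \<delta>: "0 < \<delta>" "\<And>s. s \<in> J \<Longrightarrow> dist s s0 < \<delta> \<Longrightarrow> dist (b s) (b s0) < \<epsilon>"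
      using b_cont s0_J \<epsilon>(1) unfolding continuous_on_iff by metis
    have "s \<in> E (Suc 0)" if "s \<in> {0..r}" "\<bar>s - s0\<bar> < \<delta>" for s
    proof -
      have "s \<in> J" using that l0 by auto
      then have "dist (b s) p < \<epsilon>" using that \<open>p = b s0\<close> \<delta>(2) by (simp add: dist_real_def)
      with near_p b_J \<open>s \<in> J\<close> step[of s 0] that(1) show ?thesis by blast
    qed
    with \<delta>(1) show ?thesis by auto
  qed
  then obtain \<delta> where \<delta>: "0 < \<delta>" "\<And>s. s \<in> {0..r} \<Longrightarrow> \<bar>s - s0\<bar> < \<delta> \<Longrightarrow> s \<in> E 1" by blast
  have "\<exists>K. J \<subseteq> E K"
    by (rule reach[of E \<delta> 1]) (use step \<delta> in blast)+
  then obtain K where K: "J \<subseteq> E K" ..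
  define \<rho> where "\<rho> = 1 - (c\<^sup>2 / 2) ^ K * \<kappa>"
  have "c\<^sup>2 \<le> 1" using c by (simp add: power_le_one)
  then have "(c\<^sup>2 / 2) ^ K * \<kappa> \<le> 1" using \<kappa> c by (intro mult_le_one power_le_one) auto
  moreover have "0 < (c\<^sup>2 / 2) ^ K * \<kappa>" using \<kappa> c by simp
  moreover have "\<forall>s\<in>J. ?q (Suc K) s \<le> \<rho>" using K by (auto simp: E_def \<rho>_def)
  ultimately show ?thesis by (intro exI[of _ "Suc K"] exI[of _ \<rho>]) (auto simp: \<rho>_def simp del: funpow.simps)
qed

section \<open>Contraction of oscillation and derivative together\<close>

lemma DUs_add: "DUs f e (j + k) = DUs ((U ^^ j) f) (DUs f e j) k"
  by (induction k) (simp_all add: funpow_add[symmetric] add.commute flip: comp_apply[of "U ^^ _" "U ^^ _"])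

lemma U_iter_osc:
  assumes "\<And>s t. s \<in> J \<Longrightarrow> t \<in> J \<Longrightarrow> f s - f t \<le> \<omega>" "s \<in> J" "t \<in> J"
  shows "(U ^^ k) f s - (U ^^ k) f t \<le> \<omega>"
proof -
  have up: "(U ^^ k) f s \<le> f u + \<omega>" if "u \<in> J" for u
    by (rule U_iter_upper) (use assms that in \<open>auto simp: algebra_simps\<close>)
  have "(U ^^ k) (\<lambda>s. - f s) t \<le> \<omega> - (U ^^ k) f s"
    by (rule U_iter_upper) (use assms(3) up in \<open>auto simp: algebra_simps\<close>)
  then show ?thesis by (simp add: U_uminus)
qed

lemma a2_bounded: obtains A where "0 \<le> A" "\<And>s. s \<in> J \<Longrightarrow> \<bar>a2 s\<bar> \<le> A"
proof -
  have "continuous_on J (\<lambda>s. \<bar>a2 s\<bar>)" by (intro continuous_intros a2_cont)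
  then obtain x where "x \<in> J" "\<forall>s\<in>J. \<bar>a2 s\<bar> \<le> \<bar>a2 x\<bar>"
    using continuous_attains_sup[of J "\<lambda>s. \<bar>a2 s\<bar>"] l0 r0 by auto
  then show ?thesis using that[of "\<bar>a2 x\<bar>"] by auto
qed

text \<open>An inequality of Lasota--Yorke type.\<close>

lemma deriv_iter_bound:
  obtains N \<rho> C where "0 < N" "0 \<le> \<rho>" "\<rho> < 1" "0 \<le> C"
    "\<And>f e \<omega> L j s. (\<And>s t. s \<in> J \<Longrightarrow> t \<in> J \<Longrightarrow> f s - f t \<le> \<omega>) \<Longrightarrow> (\<And>s. s \<in> J \<Longrightarrow> \<bar>e s\<bar> \<le> L) \<Longrightarrow>
      s \<in> J \<Longrightarrow> \<bar>DUs f e (N * j) s\<bar> \<le> \<rho> ^ j * L + C * \<omega>"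
proof -
  obtain N \<rho> where N: "0 < N" "0 \<le> \<rho>" "\<rho> < 1" "\<forall>s\<in>J. (Q ^^ N) (\<lambda>_. 1) s \<le> \<rho>"
    using Q_contraction by blast
  obtain A where A: "0 \<le> A" "\<And>s. s \<in> J \<Longrightarrow> \<bar>a2 s\<bar> \<le> A" using a2_bounded by blast
  \<comment> \<open>The solution of \<open>\<rho> * C + N * (A / 2) = C\<close>: a block of
    \<open>N\<close> steps multiplies the old bound by \<open>\<rho>\<close> and adds
    \<open>N\<close> curvature terms, so this \<open>C\<close> reproduces itself in the
    induction.\<close>
  define C where "C = N * (A / 2) / (1 - \<rho>)"
  have C0: "0 \<le> C" using N A by (auto simp: C_def)
  have "1 - \<rho> \<noteq> 0" using N by simp
  then have C: "N * (A / 2) = (1 - \<rho>) * C" by (simp add: C_def divide_simps)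
  have "\<bar>DUs f e (N * j) s\<bar> \<le> \<rho> ^ j * L + C * \<omega>"
    if f: "\<And>s t. s \<in> J \<Longrightarrow> t \<in> J \<Longrightarrow> f s - f t \<le> \<omega>" and e: "\<And>s. s \<in> J \<Longrightarrow> \<bar>e s\<bar> \<le> L" and s: "s \<in> J"
    for f e \<omega> L j s
    using s
  proof (induction j arbitrary: s)
    case 0
    have "0 \<le> \<omega>" using f[OF s0_J s0_J] by simp
    then show ?case using e[OF 0] C0 by (simp add: add_increasing2)
  next
    case (Suc j)
    let ?L = "\<rho> ^ j * L + C * \<omega>"
    have L0: "0 \<le> ?L" using Suc.IH[OF s0_J] by linarith
    have "\<bar>DUs f e (N * j + N) s\<bar> \<le> ?L * (Q ^^ N) (\<lambda>_. 1) s + real N * (A / 2 * \<omega>)"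
      unfolding DUs_add by (rule DUs_bound[OF Suc.IH U_iter_osc[OF f] A(2) Suc.prems])
    also have "\<dots> \<le> ?L * \<rho> + real N * (A / 2 * \<omega>)"
      using N Suc.prems L0 by (intro add_right_mono mult_left_mono) auto
    also have "real N * (A / 2 * \<omega>) = (1 - \<rho>) * C * \<omega>" using C by (simp only: mult.assoc[symmetric])
    also have "?L * \<rho> + (1 - \<rho>) * C * \<omega> = \<rho> ^ Suc j * L + C * \<omega>" by (simp add: algebra_simps)
    finally show ?case by (simp add: add.commute)
  qed
  from that[OF N(1-3) C0 this] show ?thesis .
qed

text \<open>Phrased for arbitrary upper bounds \<open>\<omega>\<close> and \<open>L\<close> rather
  than for the exact oscillation and maximum, so that blocks can be chained by passing bounds
  on.\<close>

definition contracting :: "nat \<Rightarrow> real \<Rightarrow> real \<Rightarrow> bool" where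
  "contracting M \<kappa> \<theta> \<longleftrightarrow>
    (\<forall>F f e \<omega> L. C2_with l r F f e \<longrightarrow> (\<forall>s\<in>J. \<forall>t\<in>J. f s - f t \<le> \<omega>) \<longrightarrow> (\<forall>s\<in>J. \<bar>e s\<bar> \<le> L) \<longrightarrow>
      (\<exists>\<omega>' L'. (\<forall>s\<in>J. \<forall>t\<in>J. (U ^^ M) f s - (U ^^ M) f t \<le> \<omega>') \<and>
        (\<forall>s\<in>J. \<bar>DUs f e M s\<bar> \<le> L') \<and> \<omega>' + \<kappa> * L' \<le> \<theta> * (\<omega> + \<kappa> * L)))"

text \<open>The radius \<open>\<delta>\<close> of the minorization is chosen from \<open>C\<close> and \<open>\<rho>\<close> alone; only then is \<open>\<eta>\<close> known, and
  the weight \<open>\<kappa>\<close> of the derivative is a small multiple of it.\<close>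

lemma block_contraction:
  "\<exists>M \<kappa> \<theta>. 0 < M \<and> 0 < \<kappa> \<and> 0 \<le> \<theta> \<and> \<theta> < 1 \<and>
    contracting M \<kappa> \<theta>"
proof -
  obtain N \<rho> C where N: "0 < N" "0 \<le> \<rho>" "\<rho> < 1" "0 \<le> C"
    and LY: "\<And>f e \<omega> L j s. (\<And>s t. s \<in> J \<Longrightarrow> t \<in> J \<Longrightarrow> f s - f t \<le> \<omega>) \<Longrightarrow> (\<And>s. s \<in> J \<Longrightarrow> \<bar>e s\<bar> \<le> L) \<Longrightarrow>
      s \<in> J \<Longrightarrow> \<bar>DUs f e (N * j) s\<bar> \<le> \<rho> ^ j * L + C * \<omega>"
    using deriv_iter_bound by metis
  \<comment> \<open>Chosen so that
    \<open>2 * \<delta> * \<eta> = (1 - \<rho>) / 2 * \<kappa>\<close> for the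
    \<open>\<kappa>\<close> below: the Lipschitz error of the minorization consumes half of the gain
    \<open>1 - \<rho>\<close> in the derivative.\<close>
  define \<delta> where "\<delta> = (1 - \<rho>) / (8 * (C + 1))"
  have \<delta>: "0 < \<delta>" using N by (simp add: \<delta>_def)
  from minorization[OF \<delta>] obtain K \<eta> where minorization: "0 < \<eta> \<and> \<eta> \<le> 1 \<and>
    (\<forall>f M \<beta>. (\<forall>s\<in>J. f s \<le> M) \<longrightarrow> (\<forall>s\<in>J. \<bar>s - s0\<bar> < \<delta> \<longrightarrow> f s \<le> \<beta>) \<longrightarrow> \<beta> \<le> M \<longrightarrow>
      (\<forall>s\<in>J. (U ^^ K) f s \<le> M - \<eta> * (M - \<beta>)))"
    by (elim exE) (rule that)
  then have \<eta>: "0 < \<eta>" "\<eta> \<le> 1" by simp_all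
  note minor = minorization[THEN conjunct2, THEN conjunct2, rule_format]
  \<comment> \<open>Using \<open>min M \<beta>\<close> in the minorization removes the side
    condition \<open>\<beta> \<le> M\<close>.\<close>
  have minor': "(U ^^ K) f s \<le> (1 - \<eta>) * M + \<eta> * \<beta>"
    if "\<And>s. s \<in> J \<Longrightarrow> f s \<le> M" "\<And>s. s \<in> J \<Longrightarrow> \<bar>s - s0\<bar> < \<delta> \<Longrightarrow> f s \<le> \<beta>" "s \<in> J" for f M \<beta> s
  proof -
    have "(U ^^ K) f s \<le> M - \<eta> * (M - min M \<beta>)"
      by (rule minor) (use that in auto)
    also have "\<dots> \<le> M - \<eta> * (M - \<beta>)" using \<eta> by simp
    finally show ?thesis by (simp add: algebra_simps)
  qed
  \<comment> \<open>A multiple of \<open>N\<close>, since the derivative bound works in blocks of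
    length \<open>N\<close>, and at least \<open>K\<close>, the time of the minorization; with
    \<open>K + 1\<close> at least one factor \<open>\<rho>\<close> is present even if
    \<open>K = 0\<close>.\<close>
  define M where "M = N * (K + 1)"
  \<comment> \<open>Makes \<open>\<kappa> * C \<le> \<eta> / 2\<close>, so the oscillation fed into
    the derivative costs at most half of the gain \<open>\<eta>\<close>.\<close>
  define \<kappa> where "\<kappa> = \<eta> / (2 * (C + 1))"
  define \<theta> where "\<theta> = max (1 - \<eta> / 2) ((1 + \<rho>) / 2)"
  have \<kappa>: "0 < \<kappa>" using \<eta> N by (simp add: \<kappa>_def)
  have \<theta>: "0 \<le> \<theta>" "\<theta> < 1" using \<eta> N by (auto simp: \<theta>_def)
  have "1 * (K + 1) \<le> N * (K + 1)" using N(1) by (intro mult_le_mono1) simp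
  then have KM: "K \<le> M" by (simp add: M_def)
  have "\<exists>\<omega>' L'. (\<forall>s\<in>J. \<forall>t\<in>J. (U ^^ M) f s - (U ^^ M) f t \<le> \<omega>') \<and>
        (\<forall>s\<in>J. \<bar>DUs f e M s\<bar> \<le> L') \<and> \<omega>' + \<kappa> * L' \<le> \<theta> * (\<omega> + \<kappa> * L)"
    if F: "C2_with l r F f e" and f: "\<And>s t. s \<in> J \<Longrightarrow> t \<in> J \<Longrightarrow> f s - f t \<le> \<omega>"
      and e: "\<And>s. s \<in> J \<Longrightarrow> \<bar>e s\<bar> \<le> L" for F f e \<omega> L
  proof -
    have L0: "0 \<le> L" and w0: "0 \<le> \<omega>" using e[OF s0_J] f[OF s0_J s0_J] by auto
    have lip: "\<bar>f s - f s0\<bar> \<le> \<delta> * L" if "s \<in> J" "\<bar>s - s0\<bar> < \<delta>" for s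
    proof -
      have "norm (f s - f s0) \<le> L * norm (s - s0)"
        using e that(1) s0_J C2_withD(2)[OF F]
        by (intro field_differentiable_bound[of J f e]) auto
      also have "\<dots> \<le> L * \<delta>" using that(2) L0 by (intro mult_left_mono) auto
      finally show ?thesis by (simp add: mult.commute)
    qed
    obtain p q where p: "p \<in> J" "\<forall>s\<in>J. f s \<le> f p" and q: "q \<in> J" "\<forall>s\<in>J. f q \<le> f s"
      using continuous_attains_sup[OF compact_Icc _ C2_withD(5)[OF F]]
        continuous_attains_inf[OF compact_Icc _ C2_withD(5)[OF F]] s0_J by blast
    let ?w = "(1 - \<eta>) * \<omega> + 2 * \<delta> * \<eta> * L"
    \<comment> \<open>The minorization is applied to \<open>f\<close> and to \<open>- f\<close>,
      with maximum \<open>f p\<close> and minimum \<open>f q\<close>. The value \<open>f s0\<close>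
      enters both bounds and cancels, leaving the factor \<open>1 - \<eta>\<close> and a Lipschitz
      error.\<close>
    have osc: "(U ^^ K) f s - (U ^^ K) f t \<le> ?w" if "s \<in> J" "t \<in> J" for s t
    proof -
      have 1: "(U ^^ K) f s \<le> (1 - \<eta>) * f p + \<eta> * (f s0 + \<delta> * L)"
        using p lip \<open>s \<in> J\<close> by (intro minor') (force simp: abs_le_iff)+
      have "(U ^^ K) (\<lambda>s. - f s) t \<le> (1 - \<eta>) * (- f q) + \<eta> * (- f s0 + \<delta> * L)"
        using q lip \<open>t \<in> J\<close> by (intro minor') (force simp: abs_le_iff)+
      then have 2: "- (U ^^ K) f t \<le> (1 - \<eta>) * (- f q) + \<eta> * (- f s0 + \<delta> * L)"
        by (simp only: U_uminus)
      have "(1 - \<eta>) * (f p - f q) \<le> (1 - \<eta>) * \<omega>"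
        using f p q \<eta> by (intro mult_left_mono) auto
      with 1 2 show ?thesis by (simp add: algebra_simps)
    qed
    have "(U ^^ M) f s - (U ^^ M) f t \<le> ?w" if "s \<in> J" "t \<in> J" for s t
    proof -
      have "(U ^^ M) f = (U ^^ (M - K)) ((U ^^ K) f)"
        using KM by (simp flip: funpow_add add: comp_apply[symmetric, of "U ^^ _" "U ^^ _"] del: comp_apply)
      then show ?thesis using U_iter_osc[OF osc that] by simp
    qed
    moreover have "\<bar>DUs f e M s\<bar> \<le> \<rho> * L + C * \<omega>" if "s \<in> J" for s
    proof -
      have "\<bar>DUs f e M s\<bar> \<le> \<rho> ^ (K + 1) * L + C * \<omega>"
        unfolding M_def by (rule LY[OF f e that])
      moreover have "\<rho> ^ (K + 1) \<le> \<rho>" using N by (simp add: mult_left_le power_le_one)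
      ultimately show ?thesis using mult_right_mono[OF _ L0] by fastforce
    qed
    moreover have "?w + \<kappa> * (\<rho> * L + C * \<omega>) \<le> \<theta> * (\<omega> + \<kappa> * L)"
    proof -
      have "\<kappa> * C \<le> \<eta> / 2"
        using N \<eta> by (simp add: \<kappa>_def field_simps)
      then have "1 - \<eta> + \<kappa> * C \<le> \<theta>" by (auto simp: \<theta>_def)
      then have A: "(1 - \<eta> + \<kappa> * C) * \<omega> \<le> \<theta> * \<omega>" using w0 by (rule mult_right_mono)
      have "2 * \<delta> * \<eta> = (1 - \<rho>) / 2 * \<kappa>"
        using N by (simp add: \<delta>_def \<kappa>_def field_simps)
      then have "2 * \<delta> * \<eta> + \<kappa> * \<rho> = (1 + \<rho>) / 2 * \<kappa>" by (simp add: field_simps)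
      also have "\<dots> \<le> \<theta> * \<kappa>" using \<kappa> by (intro mult_right_mono) (auto simp: \<theta>_def)
      finally have B: "(2 * \<delta> * \<eta> + \<kappa> * \<rho>) * L \<le> \<theta> * \<kappa> * L" using L0 by (rule mult_right_mono)
      from A B show ?thesis by (simp add: algebra_simps)
    qed
    ultimately show ?thesis by blast
  qed
  then have "contracting M \<kappa> \<theta>"
    unfolding contracting_def by (intro allI impI) blast
  moreover have "0 < M" using N by (simp add: M_def)
  ultimately show ?thesis
    using \<kappa> \<theta> by (intro exI[of _ M] exI[of _ \<kappa>] exI[of _ \<theta>] conjI)
qed

text \<open>Whole blocks give geometric decay of the weighted combination; the fewer than
  \<open>M\<close> remaining steps lose only a constant factor. One summable sequence then dominates
  oscillation and derivative of all iterates.\<close>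

lemma decay:
  assumes F: "C2_with l r F f e"
  obtains w where "summable w" "\<And>k s t. s \<in> J \<Longrightarrow> t \<in> J \<Longrightarrow> (U ^^ k) f s - (U ^^ k) f t \<le> w k"
    "\<And>k s. s \<in> J \<Longrightarrow> \<bar>DUs f e k s\<bar> \<le> w k"
proof -
  obtain M \<kappa> \<theta> where M: "0 < M" "0 < \<kappa>" "0 \<le> \<theta>" "\<theta> < 1" and "contracting M \<kappa> \<theta>"
    using block_contraction by blast
  note block = this(5)[unfolded contracting_def, rule_format]
  obtain A where A: "0 \<le> A" "\<And>s. s \<in> J \<Longrightarrow> \<bar>a2 s\<bar> \<le> A" using a2_bounded by blast
  have "compact ((\<lambda>s. \<bar>f s\<bar> + \<bar>e s\<bar>) ` J)"
    by (intro compact_continuous_image continuous_intros C2_withD[OF F] compact_Icc)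
  then obtain B where B: "\<And>s. s \<in> J \<Longrightarrow> \<bar>f s\<bar> + \<bar>e s\<bar> \<le> B"
    using compact_imp_bounded bounded_real by (metis (no_types, lifting) abs_le_D1 image_eqI)
  define W where "W = 2 * B + \<kappa> * B"
  have W: "\<exists>\<omega> L. (\<forall>s\<in>J. \<forall>t\<in>J. (U ^^ (M * j)) f s - (U ^^ (M * j)) f t \<le> \<omega>) \<and>
        (\<forall>s\<in>J. \<bar>DUs f e (M * j) s\<bar> \<le> L) \<and> \<omega> + \<kappa> * L \<le> \<theta> ^ j * W" for j
  proof (induction j)
    case 0
    have "f s - f t \<le> 2 * B" "\<bar>e s\<bar> \<le> B" if "s \<in> J" "t \<in> J" for s t
      using B[OF that(1)] B[OF that(2)] by linarith+
    then show ?case by (intro exI[of _ "2 * B"] exI[of _ B]) (auto simp: W_def)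
  next
    case (Suc j)
    then obtain \<omega> L where w: "\<forall>s\<in>J. \<forall>t\<in>J. (U ^^ (M * j)) f s - (U ^^ (M * j)) f t \<le> \<omega>"
        "\<forall>s\<in>J. \<bar>DUs f e (M * j) s\<bar> \<le> L" "\<omega> + \<kappa> * L \<le> \<theta> ^ j * W" by blast
    from block[OF iterate_C2[OF F, of "M * j"], of \<omega> L] w(1,2)
    obtain \<omega>' L' where w': "\<forall>s\<in>J. \<forall>t\<in>J. (U ^^ M) ((U ^^ (M * j)) f) s - (U ^^ M) ((U ^^ (M * j)) f) t \<le> \<omega>'"
        "\<forall>s\<in>J. \<bar>DUs ((U ^^ (M * j)) f) (DUs f e (M * j)) M s\<bar> \<le> L'" "\<omega>' + \<kappa> * L' \<le> \<theta> * (\<omega> + \<kappa> * L)"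
      by blast
    have "(U ^^ M) ((U ^^ (M * j)) f) = (U ^^ (M * Suc j)) f"
      by (simp add: funpow_add)
    moreover have "DUs ((U ^^ (M * j)) f) (DUs f e (M * j)) M = DUs f e (M * Suc j)"
      by (simp add: DUs_add[symmetric] add.commute)
    moreover have "\<theta> * (\<omega> + \<kappa> * L) \<le> \<theta> ^ Suc j * W"
      using mult_left_mono[OF w(3) M(3)] by simp
    ultimately show ?case
      using w' by (intro exI[of _ \<omega>'] exI[of _ L']) auto
  qed
  \<comment> \<open>If the weighted combination is at most \<open>X\<close> at the start of a block,
    then the oscillation is at most \<open>X\<close> and the derivative at most
    \<open>X / \<kappa>\<close>; the last summand covers the curvature terms of at most
    \<open>M\<close> further steps.\<close>
  define c where "c = 1 + 1 / \<kappa> + M * (A / 2)"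
  define w where "w k = \<theta> ^ (k div M) * W * c" for k
  have c0: "0 \<le> c" using M A by (simp add: c_def)
  have B0: "0 \<le> B" using B[OF s0_J] by linarith
  have W0: "0 \<le> W" using B0 M by (simp add: W_def)
  have bounds: "(s \<in> J \<longrightarrow> t \<in> J \<longrightarrow> (U ^^ k) f s - (U ^^ k) f t \<le> w k) \<and> (s \<in> J \<longrightarrow> \<bar>DUs f e k s\<bar> \<le> w k)" for k s t
  proof (intro conjI impI)
    define j i where "j = k div M" and "i = k mod M"
    have k: "k = M * j + i" and i: "i \<le> M" using M by (auto simp: j_def i_def less_imp_le)
    from W[of j] obtain \<omega> L where wL: "\<And>s t. s \<in> J \<Longrightarrow> t \<in> J \<Longrightarrow> (U ^^ (M * j)) f s - (U ^^ (M * j)) f t \<le> \<omega>"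
        "\<And>s. s \<in> J \<Longrightarrow> \<bar>DUs f e (M * j) s\<bar> \<le> L" "\<omega> + \<kappa> * L \<le> \<theta> ^ j * W" by blast
    have L0: "0 \<le> L" and w0: "0 \<le> \<omega>" using wL(1)[OF s0_J s0_J] wL(2)[OF s0_J] by auto
    let ?X = "\<theta> ^ j * W"
    have X: "0 \<le> ?X" using W0 M by simp
    have "0 \<le> \<kappa> * L" using L0 M by simp
    then have wX: "\<omega> \<le> ?X" and "\<kappa> * L \<le> ?X" using wL(3) w0 by linarith+
    then have LX: "L \<le> ?X / \<kappa>" using M by (simp add: field_simps)
    have wk: "w k = ?X + ?X / \<kappa> + M * (A / 2) * ?X" by (simp add: w_def j_def c_def algebra_simps)
    have Ufk: "(U ^^ k) f = (U ^^ i) ((U ^^ (M * j)) f)"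
      by (subst k, subst add.commute) (simp add: funpow_add)
    have pos: "0 \<le> ?X / \<kappa>" "0 \<le> M * (A / 2) * ?X" using X M A by simp_all
    show "(U ^^ k) f s - (U ^^ k) f t \<le> w k" if "s \<in> J" "t \<in> J"
      unfolding Ufk using U_iter_osc[where f="(U ^^ (M * j)) f" and k=i, OF wL(1) that] wX wk pos by linarith
    show "\<bar>DUs f e k s\<bar> \<le> w k" if "s \<in> J"
    proof -
      have "\<bar>DUs f e k s\<bar> \<le> L * (Q ^^ i) (\<lambda>_. 1) s + real i * (A / 2 * \<omega>)"
        unfolding k DUs_add by (rule DUs_bound[OF wL(2,1) A(2) that])
      also have "\<dots> \<le> L + M * (A / 2 * \<omega>)"
        using Q_iter_le_1[OF that, of i] L0 w0 A(1) i by (intro add_mono mult_left_le mult_right_mono) auto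
      also have "\<dots> \<le> ?X / \<kappa> + M * (A / 2 * ?X)"
        using LX wX A(1) by (intro add_mono mult_left_mono) auto
      finally show ?thesis using wk X by (simp add: mult.assoc)
    qed
  qed
  have "summable w"
  proof (rule summable_of_block_contraction[OF _ _ M(4)])
    show "0 \<le> w k" for k using M W0 c0 by (simp add: w_def)
    show "w (k + M) \<le> \<theta> * w k" for k using M by (simp add: w_def)
  qed
  then show ?thesis by (rule that) (simp_all add: bounds)
qed

text \<open>Such an \<open>F\<close> is fixed by \<open>V\<close>, so its derivative is fixed by
  \<open>U\<close>; the oscillation of the iterates tends to zero, but the iterates are all equal to
  \<open>f\<close>.\<close>

lemma homogeneous_solution_const:
  assumes F: "C2_with l r F f e" and eq: "\<And>s. s \<in> J \<Longrightarrow> F s = F (a s) + F (b s) - F 0"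
    and s: "s \<in> J" "t \<in> J"
  shows "f s = f t"
proof -
  have VF: "V F s = F s" if "s \<in> J" for s using eq[OF that] by (simp add: V_def)
  have U1: "U f s = f s" if "s \<in> J" for s
  proof (rule deriv_within_unique[OF _ C2_withD(1)[OF F that] _ that])
    show "(F has_real_derivative U f s) (at s within J)"
      using VF that
      by (intro has_field_derivative_transform_within[OF C2_withD(1)[OF step_C2[OF F]] zero_less_one]) auto
  qed (use l0 r0 in auto)
  have Uk: "(U ^^ k) f s = f s" if "s \<in> J" for k s
    using that
  proof (induction k arbitrary: s)
    case (Suc k)
    then have "(U ^^ k) f s = f s" "(U ^^ k) f (a s) = f (a s)" "(U ^^ k) f (b s) = f (b s)"
      using a_J b_J by blast+
    then have "U ((U ^^ k) f) s = U f s" by (simp only: U_def)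
    with U1 Suc.prems show ?case by simp
  qed simp
  obtain w where w: "summable w" "\<And>k s t. s \<in> J \<Longrightarrow> t \<in> J \<Longrightarrow> (U ^^ k) f s - (U ^^ k) f t \<le> w k"
    "\<And>k s. s \<in> J \<Longrightarrow> \<bar>DUs f e k s\<bar> \<le> w k"
    using decay[OF F] by blast
  have le: "f s - f t \<le> 0" if "s \<in> J" "t \<in> J" for s t
  proof (rule LIMSEQ_le_const[OF summable_LIMSEQ_zero[OF w(1)]], intro exI allI impI)
    show "f s - f t \<le> w n" for n
      using w(2)[OF that, of n] Uk[OF that(1), of n] Uk[OF that(2), of n] by simp
  qed
  from le[OF s] le[OF s(2,1)] show ?thesis by simp
qed

text \<open>The Neumann series of \<open>V\<close> applied to \<open>G\<close>. The sequence from
  \<open>decay\<close> dominates the series of first and second derivatives, so it may be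
  differentiated twice termwise and the sum is again \<open>C\<^sup>2\<close>.\<close>

lemma solvable:
  assumes G: "C2_with l r G g1 g2" and ends: "G l = 0" "G r = 0"
  obtains F f e where "C2_with l r F f e" "\<And>s. s \<in> J \<Longrightarrow> F s = F (a s) + F (b s) - F 0 + G s"
proof -
  define Fs fs es where "Fs k = (V ^^ k) G" and "fs k = (U ^^ k) g1" and "es k = DUs g1 g2 k" for k
  have C2: "C2_with l r (Fs k) (fs k) (es k)" for k
    unfolding Fs_def fs_def es_def by (rule iterate_C2[OF G])
  note Fd = C2_withD[OF C2]
  have b_ends: "b l = l" "b r = 0" by (simp_all add: b_def a_l a_r)
  \<comment> \<open>\<open>V\<close> preserves end values, so each term vanishes at both ends and
    its derivative has a zero; the oscillation of the derivative then bounds its absolute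
    value.\<close>
  have Fends: "Fs k l = 0 \<and> Fs k r = 0" for k
    by (induction k) (simp_all add: Fs_def ends V_def a_l a_r b_ends)
  obtain w where w: "summable w" "\<And>k s t. s \<in> J \<Longrightarrow> t \<in> J \<Longrightarrow> fs k s - fs k t \<le> w k"
    "\<And>k s. s \<in> J \<Longrightarrow> \<bar>es k s\<bar> \<le> w k"
    unfolding fs_def es_def using decay[OF G] by blast
  have f_le: "\<bar>fs k s\<bar> \<le> w k" if "s \<in> J" for k s
  proof -
    have "l < r" using l0 r0 by simp
    then obtain z where z: "z \<in> {l<..<r}" "Fs k r - Fs k l = fs k z * (r - l)"
      using mvt_within[where f="Fs k", OF Fd(1), of l r] by blast
    then have "fs k z = 0" using Fends \<open>l < r\<close> by simp
    moreover have "z \<in> J" using z by auto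
    ultimately show ?thesis using w(2)[OF that, of z k] w(2)[OF _ that, of z k] by auto
  qed
  have sum_f: "summable (\<lambda>k. fs k s)" and sum_e: "summable (\<lambda>k. es k s)" if "s \<in> J" for s
    by (rule summable_comparison_test[OF _ w(1)]; use f_le w(3) that in auto)+
  have lim: "uniform_limit J (\<lambda>n s. \<Sum>k<n. fs k s) (\<lambda>s. \<Sum>k. fs k s) sequentially"
    "uniform_limit J (\<lambda>n s. \<Sum>k<n. es k s) (\<lambda>s. \<Sum>k. es k s) sequentially"
    by (rule Weierstrass_m_test[OF _ w(1)]; use f_le w(3) in auto)+
  have "l \<in> J" using l0 r0 by simp
  obtain f where f: "\<And>s. s \<in> J \<Longrightarrow> (\<lambda>k. fs k s) sums f s"
      "\<And>s. s \<in> J \<Longrightarrow> (f has_real_derivative (\<Sum>k. es k s)) (at s within J)"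
    using has_field_derivative_series[OF convex_closed_interval(1)[of l r, unfolded cbox_interval] Fd(2) lim(2) \<open>l \<in> J\<close> sum_f[OF \<open>l \<in> J\<close>]]
    by blast
  have "summable (\<lambda>k. Fs k l)" using Fends by simp
  then obtain F where F: "\<And>s. s \<in> J \<Longrightarrow> (\<lambda>k. Fs k s) sums F s"
      "\<And>s. s \<in> J \<Longrightarrow> (F has_real_derivative (\<Sum>k. fs k s)) (at s within J)"
    using has_field_derivative_series[OF convex_closed_interval(1)[of l r, unfolded cbox_interval] Fd(1) lim(1) \<open>l \<in> J\<close>]
    by blast
  have "continuous_on J (\<lambda>s. \<Sum>k. es k s)"
    by (rule uniform_limit_theorem[OF _ lim(2)]) (auto intro!: always_eventually continuous_intros Fd(3))
  moreover have "(\<Sum>k. fs k s) = f s" if "s \<in> J" for s using f(1)[OF that] by (simp add: sums_iff)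
  ultimately have C2F: "C2_with l r F f (\<lambda>s. \<Sum>k. es k s)"
    using F(2) f(2) by (simp add: C2_with_def)
  \<comment> \<open>The lazy equation \<open>F = V F + G\<close> amounts to the original one with
    \<open>2 * G\<close>, which is why the series is halved at the end.\<close>
  have eq: "F s = F (a s) + F (b s) - F 0 + 2 * G s" if "s \<in> J" for s
  proof -
    have "(\<lambda>k. V (Fs k) s) sums V F s"
      unfolding V_def using that a_J b_J zero_J by (intro sums_divide sums_diff sums_add F(1)) auto
    moreover have "(\<lambda>k. V (Fs k) s) sums (F s - G s)"
      using F(1)[OF that] sums_Suc_iff[of "\<lambda>k. Fs k s" "F s - G s"] by (simp add: Fs_def)
    ultimately have "V F s = F s - G s" by (rule sums_unique2)
    then show ?thesis by (simp add: V_def field_simps)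
  qed
  show ?thesis
  proof (rule that)
    show "C2_with l r (\<lambda>s. F s / 2) (\<lambda>s. f s / 2) (\<lambda>s. (\<Sum>k. es k s) / 2)"
      unfolding C2_with_def
      by (intro conjI ballI DERIV_cdivide continuous_on_divide continuous_on_const C2_withD[OF C2F]) simp_all
    show "F s / 2 = F (a s) / 2 + F (b s) / 2 - F 0 / 2 + G s" if "s \<in> J" for s
      using eq[OF that] by (simp add: field_simps)
  qed
qed

end

section \<open>Integration by parts\<close>

lemma directional_derivative:
  fixes f :: "real \<times> real \<Rightarrow> real"
  assumes "f differentiable (at p)"
  shows "((\<lambda>t. f (p + t *\<^sub>R (c, d))) has_real_derivative c * pdx f p + d * pdy f p) (at 0)"
proof -
  let ?f' = "frechet_derivative f (at p)"
  have f': "(f has_derivative ?f') (at (p + 0 *\<^sub>R (c, d)))"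
    using assms by (simp only: frechet_derivative_works scaleR_zero_left add_0_right)
  have "((\<lambda>t. p + t *\<^sub>R (c, d)) has_derivative (\<lambda>t. t *\<^sub>R (c, d))) (at 0)"
    by (auto intro!: derivative_eq_intros)
  from diff_chain_at[OF this f'] have *: "((\<lambda>t. f (p + t *\<^sub>R (c, d))) has_derivative (\<lambda>t. ?f' (t *\<^sub>R (c, d)))) (at 0)"
    by (simp add: o_def)
  have lin: "linear ?f'" using assms by (rule linear_frechet_derivative)
  have "?f' (t *\<^sub>R (c, d)) = (c * pdx f p + d * pdy f p) * t" for t
  proof -
    have "t *\<^sub>R (c, d) = (t * c) *\<^sub>R (1, 0) + (t * d) *\<^sub>R (0, 1)" by simp
    then have "?f' (t *\<^sub>R (c, d)) = (t * c) *\<^sub>R ?f' (1, 0) + (t * d) *\<^sub>R ?f' (0, 1)"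
      by (simp only: linear_add[OF lin] linear_scale[OF lin])
    then show ?thesis by (simp add: pdx_def pdy_def algebra_simps)
  qed
  with * show ?thesis by (simp add: has_field_derivative_def)
qed

lemma pdx_pdy_eqI:
  assumes "(f has_derivative f') (at p)"
  shows "f differentiable (at p)" "pdx f p = f' (1, 0)" "pdy f p = f' (0, 1)"
  using frechet_derivative_at[OF assms] assms by (auto simp: pdx_def pdy_def differentiable_def)

lemma integrable_compact_support:
  fixes f :: "'a::euclidean_space \<Rightarrow> real"
  assumes "compact K" "continuous_on K f" "\<And>p. p \<notin> K \<Longrightarrow> f p = 0"
  shows "integrable lborel f"
proof -
  have "indicator K x *\<^sub>R f x = f x" for x using assms(3) by (cases "x \<in> K") simp_all
  then have "(\<lambda>x. indicator K x *\<^sub>R f x) = f" by (rule ext)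
  with borel_integrable_compact[OF assms(1,2)] show ?thesis by (simp only:)
qed

lemma integral_shift:
  fixes f :: "'a::euclidean_space \<Rightarrow> real"
  assumes "f \<in> borel_measurable borel"
  shows "(\<integral>p. f (c + p) \<partial>lborel) = (\<integral>p. f p \<partial>lborel)"
proof -
  have "(\<integral>p. f p \<partial>distr lborel borel ((+) c)) = (\<integral>p. f (c + p) \<partial>lborel)"
    by (rule integral_distr) (use assms in simp_all)
  then show ?thesis by (simp add: lborel_distr_plus)
qed

text \<open>By translation invariance every difference quotient has integral zero.\<close>

lemma integral_directional_derivative_eq_0:
  fixes g g' :: "'a::euclidean_space \<Rightarrow> real"
  assumes deriv: "\<And>p. ((\<lambda>t. g (p + t *\<^sub>R v)) has_real_derivative g' p) (at 0)"
    and cg: "continuous_on UNIV g" and cg': "continuous_on UNIV g'"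
    and K: "compact K" and g0: "\<And>p. p \<notin> K \<Longrightarrow> g p = 0" and g'0: "\<And>p. p \<notin> K \<Longrightarrow> g' p = 0"
  shows "(\<integral>p. g' p \<partial>lborel) = 0"
proof -
  have deriv_at: "((\<lambda>t. g (p + t *\<^sub>R v)) has_real_derivative g' (p + x *\<^sub>R v)) (at x)" for p x
  proof -
    have "((\<lambda>t. g (p + x *\<^sub>R v + t *\<^sub>R v)) has_real_derivative g' (p + x *\<^sub>R v)) (at (x - x))"
      using deriv by simp
    moreover have "((\<lambda>t. t - x) has_real_derivative 1) (at x)" by (auto intro!: derivative_eq_intros)
    ultimately have "((\<lambda>t. g (p + x *\<^sub>R v + (t - x) *\<^sub>R v)) has_real_derivative g' (p + x *\<^sub>R v) * 1) (at x)"
      by (rule DERIV_chain2)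
    then show ?thesis by (simp add: algebra_simps)
  qed
  have "compact (g' ` K)"
    using K cg' by (intro compact_continuous_image) (auto intro: continuous_on_subset)
  then obtain B0 where B0: "\<And>p. p \<in> K \<Longrightarrow> \<bar>g' p\<bar> \<le> B0"
    using compact_imp_bounded bounded_real by (metis image_eqI)
  define B where "B = max B0 0"
  have B: "\<bar>g' p\<bar> \<le> B" for p
    using B0[of p] g'0[of p] by (cases "p \<in> K") (auto simp: B_def)
  obtain R where R: "\<And>p. p \<in> K \<Longrightarrow> norm p \<le> R"
    using compact_imp_bounded[OF K] by (auto simp: bounded_iff)
  define h where "h k p = real (Suc k) * (g (inverse (real (Suc k)) *\<^sub>R v + p) - g p)" for k p
  \<comment> \<open>The steps of the difference quotients are at most 1, so outside this ball both
    \<open>p\<close> and the shifted point avoid \<open>K\<close>; inside it the mean value theorem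
    bounds the quotient by \<open>B\<close>.\<close>
  define W where "W p = B * indicator (cball 0 (R + norm v)) p" for p :: 'a
  have bound: "\<bar>h k p\<bar> \<le> W p" for k p
  proof (cases "p \<in> cball 0 (R + norm v)")
    case True
    let ?t = "inverse (real (Suc k))"
    have "0 < ?t" by simp
    from MVT2[OF this deriv_at] obtain z where "g (p + ?t *\<^sub>R v) - g (p + 0 *\<^sub>R v) = (?t - 0) * g' (p + z *\<^sub>R v)"
      by blast
    then have "h k p = g' (p + z *\<^sub>R v)" by (simp add: h_def add.commute)
    with B True show ?thesis by (simp add: W_def)
  next
    case False
    let ?t = "inverse (real (Suc k))"
    have "norm (?t *\<^sub>R v) \<le> norm v"
      by (simp add: mult_left_le_one_le inverse_le_1_iff)
    moreover have "norm p \<le> norm (?t *\<^sub>R v + p) + norm (?t *\<^sub>R v)"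
      by (metis add_diff_cancel_left' norm_triangle_ineq4)
    moreover have "R + norm v < norm p" using False by simp
    ultimately have "\<not> norm (?t *\<^sub>R v + p) \<le> R" "\<not> norm p \<le> R"
      using norm_ge_zero[of v] by linarith+
    then have "?t *\<^sub>R v + p \<notin> K" "p \<notin> K" using R by blast+
    then have "h k p = 0" using g0 by (simp add: h_def)
    moreover have "0 \<le> W p" by (simp add: W_def B_def)
    ultimately show ?thesis by simp
  qed
  have meas: "g \<in> borel_measurable borel" "g' \<in> borel_measurable borel"
    using cg cg' by (auto intro: borel_measurable_continuous_onI)
  have "(\<lambda>k. \<integral>p. h k p \<partial>lborel) \<longlonglongrightarrow> (\<integral>p. g' p \<partial>lborel)"
  proof (rule integral_dominated_convergence[where w=W])
    show "integrable lborel W"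
      unfolding W_def by (intro integrable_mult_right integrable_real_indicator emeasure_bounded_finite bounded_cball) auto
    show "AE p in lborel. norm (h k p) \<le> W p" for k using bound by simp
    show "AE p in lborel. (\<lambda>k. h k p) \<longlonglongrightarrow> g' p"
    proof (rule AE_I2)
      fix p
      have "((\<lambda>t. (g (p + t *\<^sub>R v) - g p) / t) \<longlongrightarrow> g' p) (at 0)"
        using deriv[of p] by (simp add: DERIV_def)
      moreover have "filterlim (\<lambda>k. inverse (real (Suc k))) (at 0) sequentially"
        using LIMSEQ_inverse_real_of_nat by (simp add: filterlim_at)
      ultimately have "(\<lambda>k. (g (p + inverse (real (Suc k)) *\<^sub>R v) - g p) / inverse (real (Suc k))) \<longlonglongrightarrow> g' p"
        by (rule filterlim_compose)
      then show "(\<lambda>k. h k p) \<longlonglongrightarrow> g' p"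
        by (simp add: h_def divide_inverse mult.commute add.commute)
    qed
    show "h k \<in> borel_measurable lborel" for k
      unfolding h_def using meas by measurable
  qed (use meas in simp)
  moreover have "(\<integral>p. h k p \<partial>lborel) = 0" for k
  proof -
    have int: "integrable lborel g"
      by (rule integrable_compact_support[OF K]) (use cg g0 in \<open>auto intro: continuous_on_subset\<close>)
    define c where "c = inverse (real (Suc k)) *\<^sub>R v"
    have "integrable lborel (\<lambda>p. g (c + p))"
    proof (rule integrable_compact_support[OF compact_translation[OF K, of "- c"]])
      show "continuous_on ((+) (- c) ` K) (\<lambda>p. g (c + p))"
        by (intro continuous_on_compose2[OF cg] continuous_intros) auto
      show "g (c + p) = 0" if "p \<notin> (+) (- c) ` K" for p
        using that by (intro g0) (metis add.commute add_diff_cancel_left' diff_conv_add_uminus imageI)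
    qed
    moreover have "h k p = real (Suc k) * (g (c + p) - g p)" for p by (simp only: h_def c_def)
    ultimately show ?thesis
      using int integral_shift[OF meas(1), of c] by simp
  qed
  ultimately show ?thesis by (simp add: LIMSEQ_const_iff)
qed

lemma set_integral_compact_support:
  fixes f :: "'a::euclidean_space \<Rightarrow> real"
  assumes "compact K" "K \<subseteq> S" "continuous_on S f" "\<And>p. p \<in> S \<Longrightarrow> p \<notin> K \<Longrightarrow> f p = 0"
  shows "integrable lborel (\<lambda>p. if p \<in> S then f p else 0)"
    and "(LINT p:S|lborel. f p) = (\<integral>p. (if p \<in> S then f p else 0) \<partial>lborel)"
proof -
  show "integrable lborel (\<lambda>p. if p \<in> S then f p else 0)"
  proof (rule integrable_compact_support[OF assms(1)])
    have "continuous_on K f" using assms by (auto intro: continuous_on_subset)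
    then show "continuous_on K (\<lambda>p. if p \<in> S then f p else 0)"
      using assms(2) by (subst continuous_on_cong[OF refl]) auto
  qed (use assms in auto)
  show "(LINT p:S|lborel. f p) = (\<integral>p. (if p \<in> S then f p else 0) \<partial>lborel)"
    unfolding set_lebesgue_integral_def by (rule Bochner_Integration.integral_cong) (auto simp: indicator_def)
qed

lemma continuous_on_zero_extension:
  fixes f :: "'a::euclidean_space \<Rightarrow> real"
  assumes "open S" "compact K" "K \<subseteq> S" "continuous_on S f" "\<And>p. p \<in> S \<Longrightarrow> p \<notin> K \<Longrightarrow> f p = 0"
  shows "continuous_on UNIV (\<lambda>p. if p \<in> S then f p else 0)"
proof -
  have "continuous_on (S \<union> - K) (\<lambda>p. if p \<in> S then f p else 0)"
  proof (rule continuous_on_open_Un)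
    show "continuous_on S (\<lambda>p. if p \<in> S then f p else 0)"
      using assms(4) by (rule continuous_on_eq) simp
    show "continuous_on (- K) (\<lambda>p. if p \<in> S then f p else 0)"
      by (rule continuous_on_eq[OF continuous_on_const[of _ 0]]) (use assms(5) in auto)
  qed (use assms compact_imp_closed in \<open>auto simp: open_Compl\<close>)
  moreover have "S \<union> - K = UNIV" using assms(3) by auto
  ultimately show ?thesis by simp
qed

text \<open>The product of \<open>w\<close> and \<open>\<psi>\<close>, continued by zero, is
  compactly supported in \<open>S\<close>, so its derivative along \<open>v\<close> has integral
  zero. Boundary regularity of \<open>S\<close> does not enter.\<close>

lemma integration_by_parts:
  fixes w w' \<psi> \<psi>' :: "'a::euclidean_space \<Rightarrow> real"
  assumes S: "open S" "compact K" "K \<subseteq> S"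
    and w: "\<And>p. p \<in> S \<Longrightarrow> ((\<lambda>t. w (p + t *\<^sub>R v)) has_real_derivative w' p) (at 0)"
    and cw: "continuous_on S w" "continuous_on S w'"
    and \<psi>: "\<And>p. p \<in> S \<Longrightarrow> ((\<lambda>t. \<psi> (p + t *\<^sub>R v)) has_real_derivative \<psi>' p) (at 0)"
    and c\<psi>: "continuous_on S \<psi>" "continuous_on S \<psi>'"
    and supp: "\<And>p. p \<notin> K \<Longrightarrow> \<psi> p = 0" "\<And>p. p \<notin> K \<Longrightarrow> \<psi>' p = 0"
  shows "(LINT p:S|lborel. w p * \<psi>' p) = - (LINT p:S|lborel. w' p * \<psi> p)"
proof -
  let ?z = "\<lambda>f p. if p \<in> S then f p else (0::real)"
  define g where "g = ?z (\<lambda>p. w p * \<psi> p)"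
  define g' where "g' = ?z (\<lambda>p. w' p * \<psi> p + w p * \<psi>' p)"
  have "(\<integral>p. g' p \<partial>lborel) = 0"
  proof (rule integral_directional_derivative_eq_0[where g=g and v=v and K=K])
    fix p
    show "((\<lambda>t. g (p + t *\<^sub>R v)) has_real_derivative g' p) (at 0)"
    proof (cases "p \<in> S")
      case True
      let ?T = "(\<lambda>t::real. p + t *\<^sub>R v) -` S"
      have T: "open ?T" by (intro open_vimage S(1) continuous_intros)
      have "((\<lambda>t. w (p + t *\<^sub>R v) * \<psi> (p + t *\<^sub>R v)) has_real_derivative g' p) (at 0)"
        using DERIV_mult[OF w[OF True] \<psi>[OF True]] True by (simp add: g'_def mult.commute)
      then show ?thesis
        by (rule has_field_derivative_transform_within_open[OF _ T]) (use True in \<open>auto simp: g_def\<close>)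
    next
      case False
      let ?T = "(\<lambda>t::real. p + t *\<^sub>R v) -` (- K)"
      have T: "open ?T" using S(2) by (intro open_vimage open_Compl compact_imp_closed continuous_intros)
      have "((\<lambda>t. 0) has_real_derivative g' p) (at 0)" using False by (simp add: g'_def)
      then show ?thesis
        by (rule has_field_derivative_transform_within_open[OF _ T]) (use False S supp in \<open>auto simp: g_def\<close>)
    qed
  next
    show "continuous_on UNIV g" unfolding g_def
      by (rule continuous_on_zero_extension[OF S]) (use cw c\<psi> supp in \<open>auto intro!: continuous_intros\<close>)
    show "continuous_on UNIV g'" unfolding g'_def
      by (rule continuous_on_zero_extension[OF S]) (use cw c\<psi> supp in \<open>auto intro!: continuous_intros\<close>)
  qed (use S supp in \<open>auto simp: g_def g'_def\<close>)
  moreover have "g' = (\<lambda>p. ?z (\<lambda>p. w' p * \<psi> p) p + ?z (\<lambda>p. w p * \<psi>' p) p)"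
    by (auto simp: g'_def)
  moreover have "integrable lborel (?z (\<lambda>p. w' p * \<psi> p))" "integrable lborel (?z (\<lambda>p. w p * \<psi>' p))"
    using cw c\<psi> supp by (auto intro!: set_integral_compact_support(1)[OF S(2,3)] continuous_intros)
  ultimately have "(\<integral>p. ?z (\<lambda>p. w' p * \<psi> p) p \<partial>lborel) + (\<integral>p. ?z (\<lambda>p. w p * \<psi>' p) p \<partial>lborel) = 0"
    by simp
  moreover have "(LINT p:S|lborel. w' p * \<psi> p) = (\<integral>p. ?z (\<lambda>p. w' p * \<psi> p) p \<partial>lborel)"
    "(LINT p:S|lborel. w p * \<psi>' p) = (\<integral>p. ?z (\<lambda>p. w p * \<psi>' p) p \<partial>lborel)"
    using cw c\<psi> supp by (auto intro!: set_integral_compact_support(2)[OF S(2,3)] continuous_intros)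
  ultimately show ?thesis by simp
qed

lemma pd_zero_off_closed:
  assumes "closed K" "\<And>p. p \<notin> K \<Longrightarrow> f p = 0" "p \<notin> K"
  shows "pdx f p = 0" "pdy f p = 0"
proof -
  have "((\<lambda>_. 0) has_derivative (\<lambda>_. 0)) (at p)" by simp
  then have "(f has_derivative (\<lambda>_. 0)) (at p)"
    by (rule has_derivative_transform_within_open[where s="- K"]) (use assms in \<open>auto simp: open_Compl\<close>)
  from pdx_pdy_eqI(2,3)[OF this] show "pdx f p = 0" "pdy f p = 0" by simp_all
qed

lemma Ck_on_imp_continuous: "Ck_on k S f \<Longrightarrow> continuous_on S f"
  by (cases k) (auto intro!: continuous_at_imp_continuous_on differentiable_imp_continuous_within)

lemma smooth_pd:
  assumes "\<forall>k. Ck_on k UNIV f"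
  shows "\<forall>k. Ck_on k UNIV (pdx f)" "\<forall>k. Ck_on k UNIV (pdy f)" "continuous_on UNIV f" "\<And>p. f differentiable (at p)"
proof -
  have "Ck_on (Suc k) UNIV f" for k using assms by blast
  then show "\<forall>k. Ck_on k UNIV (pdx f)" "\<forall>k. Ck_on k UNIV (pdy f)" "\<And>p. f differentiable (at p)" by auto
  show "continuous_on UNIV f" using assms Ck_on_imp_continuous by blast
qed

lemma ibp_pdx_pdy:
  assumes S: "open S" "compact K" "K \<subseteq> S"
    and \<psi>: "\<forall>k. Ck_on k UNIV \<psi>" and supp: "\<And>p. p \<notin> K \<Longrightarrow> \<psi> p = 0"
    and w: "continuous_on S w"
  shows "\<lbrakk>\<And>p. p \<in> S \<Longrightarrow> ((\<lambda>t. w (p + t *\<^sub>R (1, 0))) has_real_derivative w' p) (at 0); continuous_on S w'\<rbrakk> \<Longrightarrow>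
      (LINT p:S|lborel. w p * pdx \<psi> p) = - (LINT p:S|lborel. w' p * \<psi> p)"
    and "\<lbrakk>\<And>p. p \<in> S \<Longrightarrow> ((\<lambda>t. w (p + t *\<^sub>R (0, 1))) has_real_derivative w' p) (at 0); continuous_on S w'\<rbrakk> \<Longrightarrow>
      (LINT p:S|lborel. w p * pdy \<psi> p) = - (LINT p:S|lborel. w' p * \<psi> p)"
    and "\<lbrakk>\<And>p. p \<in> S \<Longrightarrow> ((\<lambda>t. w (p + t *\<^sub>R (m, n))) has_real_derivative w' p) (at 0); continuous_on S w'\<rbrakk> \<Longrightarrow>
      (LINT p:S|lborel. w p * (m * pdx \<psi> p + n * pdy \<psi> p)) = - (LINT p:S|lborel. w' p * \<psi> p)"
proof -
  note s = smooth_pd[OF \<psi>]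
  have c: "continuous_on S \<psi>" "continuous_on S (pdx \<psi>)" "continuous_on S (pdy \<psi>)"
    using s(3) smooth_pd(3)[OF s(1)] smooth_pd(3)[OF s(2)] by (auto intro: continuous_on_subset)
  have z: "pdx \<psi> p = 0" "pdy \<psi> p = 0" if "p \<notin> K" for p
    using pd_zero_off_closed[OF compact_imp_closed[OF S(2)] supp that] by auto
  have dd: "((\<lambda>t. \<psi> (p + t *\<^sub>R (c, d))) has_real_derivative c * pdx \<psi> p + d * pdy \<psi> p) (at 0)" for p c d
    by (rule directional_derivative[OF s(4)])
  have gen: "(LINT p:S|lborel. w p * (m * pdx \<psi> p + n * pdy \<psi> p)) = - (LINT p:S|lborel. w' p * \<psi> p)"
    if "\<And>p. p \<in> S \<Longrightarrow> ((\<lambda>t. w (p + t *\<^sub>R (m, n))) has_real_derivative w' p) (at 0)" "continuous_on S w'" for w' m n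
    by (rule integration_by_parts[OF S that(1) w that(2) dd c(1)]) (auto simp: z supp intro!: continuous_intros c)
  show "\<lbrakk>\<And>p. p \<in> S \<Longrightarrow> ((\<lambda>t. w (p + t *\<^sub>R (m, n))) has_real_derivative w' p) (at 0); continuous_on S w'\<rbrakk> \<Longrightarrow>
      (LINT p:S|lborel. w p * (m * pdx \<psi> p + n * pdy \<psi> p)) = - (LINT p:S|lborel. w' p * \<psi> p)"
    by (rule gen)
  show "(LINT p:S|lborel. w p * pdx \<psi> p) = - (LINT p:S|lborel. w' p * \<psi> p)"
    if "\<And>p. p \<in> S \<Longrightarrow> ((\<lambda>t. w (p + t *\<^sub>R (1, 0))) has_real_derivative w' p) (at 0)" "continuous_on S w'"
    using gen[OF that] by simp
  show "(LINT p:S|lborel. w p * pdy \<psi> p) = - (LINT p:S|lborel. w' p * \<psi> p)"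
    if "\<And>p. p \<in> S \<Longrightarrow> ((\<lambda>t. w (p + t *\<^sub>R (0, 1))) has_real_derivative w' p) (at 0)" "continuous_on S w'"
    using gen[OF that] by simp
qed

section \<open>Test functions\<close>

primrec Ck_real :: "nat \<Rightarrow> (real \<Rightarrow> real) \<Rightarrow> bool" where
  "Ck_real 0 f \<longleftrightarrow> continuous_on UNIV f"
| "Ck_real (Suc k) f \<longleftrightarrow> (\<exists>f'. (\<forall>x. (f has_real_derivative f' x) (at x)) \<and> Ck_real k f')"

lemma Ck_real_continuous: "Ck_real k f \<Longrightarrow> continuous_on UNIV f"
  by (cases k) (auto intro: DERIV_continuous_on has_field_derivative_at_within)

lemma Ck_real_SucI:
  "(\<And>x. (f has_real_derivative f' x) (at x)) \<Longrightarrow> Ck_real k f' \<Longrightarrow> Ck_real (Suc k) f"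
  unfolding Ck_real.simps by blast

lemma Ck_real_SucD: "Ck_real (Suc k) f \<Longrightarrow> Ck_real k f"
proof (induction k arbitrary: f)
  case 0
  from Ck_real_continuous[OF this] show ?case by simp
next
  case (Suc k)
  then obtain f' where "\<forall>x. (f has_real_derivative f' x) (at x)" "Ck_real (Suc k) f'" by auto
  with Suc.IH show ?case by auto
qed

lemma Ck_real_derivative:
  assumes "\<forall>k. Ck_real k f" "\<And>x. (f has_real_derivative f' x) (at x)"
  shows "\<forall>k. Ck_real k f'"
proof
  fix k
  have "Ck_real (Suc k) f" using assms(1) by blast
  then obtain g where g: "\<And>x. (f has_real_derivative g x) (at x)" "Ck_real k g" by auto
  have "f' = g" using DERIV_unique assms(2) g(1) by blast
  with g(2) show "Ck_real k f'" by simp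
qed

lemma Ck_real_derivative_ex:
  assumes "\<forall>k. Ck_real k f"
  shows "\<exists>f'. (\<forall>x. (f has_real_derivative f' x) (at x)) \<and> (\<forall>k. Ck_real k f')"
proof -
  have "Ck_real 1 f" using assms by blast
  then obtain f' where f': "\<And>x. (f has_real_derivative f' x) (at x)" by auto
  with Ck_real_derivative[OF assms f'] show ?thesis by blast
qed

lemma Ck_real_lin:
  "Ck_real k f \<Longrightarrow> Ck_real k g \<Longrightarrow> Ck_real k (\<lambda>x. c * f x + d * g x)"
proof (induction k arbitrary: f g)
  case (Suc k)
  then obtain f' g' where "\<forall>x. (f has_real_derivative f' x) (at x)" "Ck_real k f'"
    "\<forall>x. (g has_real_derivative g' x) (at x)" "Ck_real k g'" by auto
  with Suc.IH[of f' g'] show ?case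
    by (auto intro!: exI[of _ "\<lambda>x. c * f' x + d * g' x"] DERIV_add DERIV_cmult)
qed (auto intro!: continuous_intros)

lemma Ck_real_mult:
  "Ck_real k f \<Longrightarrow> Ck_real k g \<Longrightarrow> Ck_real k (\<lambda>x. f x * g x)"
proof (induction k arbitrary: f g)
  case (Suc k)
  then obtain f' g' where f: "\<And>x. (f has_real_derivative f' x) (at x)" "Ck_real k f'"
    and g: "\<And>x. (g has_real_derivative g' x) (at x)" "Ck_real k g'" by auto
  have "Ck_real k f" "Ck_real k g" using Suc.prems by (auto intro: Ck_real_SucD simp del: Ck_real.simps)
  then have "Ck_real k (\<lambda>x. f' x * g x)" "Ck_real k (\<lambda>x. g' x * f x)"
    using Suc.IH f g by auto
  from Ck_real_lin[OF this, of 1 1] have "Ck_real k (\<lambda>x. f' x * g x + g' x * f x)" by simp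
  moreover have "((\<lambda>x. f x * g x) has_real_derivative f' x * g x + g' x * f x) (at x)" for x
    by (rule DERIV_mult[OF f(1) g(1)])
  ultimately show ?case by (intro Ck_real_SucI)
qed (auto intro!: continuous_intros)

lemma Ck_real_affine:
  "Ck_real k f \<Longrightarrow> Ck_real k (\<lambda>x. f (c * x + d))"
proof (induction k arbitrary: f)
  case 0
  then show ?case by (auto intro!: continuous_on_compose2[of UNIV f] continuous_intros)
next
  case (Suc k)
  then obtain f' where f: "\<And>x. (f has_real_derivative f' x) (at x)" "Ck_real k f'" by auto
  have "((\<lambda>x. f (c * x + d)) has_real_derivative f' (c * x + d) * c) (at x)" for x
    by (rule DERIV_chain2[OF f(1)]) (auto intro!: derivative_eq_intros)
  moreover have "Ck_real k (\<lambda>x. f' (c * x + d) * c)"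
    using Ck_real_lin[OF Suc.IH[OF f(2)] Suc.IH[OF f(2)], of c 0] by (simp add: mult.commute)
  ultimately show ?case by (intro Ck_real_SucI)
qed

text \<open>The powers of \<open>1 / x\<close> are included so that the family is closed under
  differentiation up to linear combinations; smoothness then follows by induction for all
  \<open>j\<close> at once.\<close>

definition flat :: "nat \<Rightarrow> real \<Rightarrow> real" where
  "flat j x = (if 0 < x then inverse x ^ j * exp (- inverse x) else 0)"

lemma flat_tendsto_0: "(flat j \<longlongrightarrow> 0) (at 0)"
proof -
  have "((\<lambda>x. inverse x ^ j / exp (inverse x)) \<longlongrightarrow> (0::real)) (at_right 0)"
    by (rule filterlim_compose[OF tendsto_power_div_exp_0 filterlim_inverse_at_top_right])
  then have "(flat j \<longlongrightarrow> 0) (at_right 0)"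
    by (rule Lim_transform_eventually)
      (auto simp: eventually_at_right_field flat_def exp_minus divide_inverse intro!: exI[of _ 1])
  moreover have "(flat j \<longlongrightarrow> 0) (at_left 0)"
    by (rule Lim_transform_eventually[OF tendsto_const])
      (auto simp: eventually_at_left_field flat_def intro!: exI[of _ "-1"])
  ultimately show ?thesis by (simp add: filterlim_split_at)
qed

lemma flat_deriv: "(flat j has_real_derivative flat (j + 2) x - real j * flat (j + 1) x) (at x)"
proof -
  consider "0 < x" | "x < 0" | "x = 0" by linarith
  then show ?thesis
  proof cases
    case 1
    have "((\<lambda>x. inverse x ^ j * exp (- inverse x)) has_real_derivative
        real j * (- (inverse x ^ Suc (Suc 0)) * inverse x ^ (j - Suc 0)) * exp (- inverse x)
        + exp (- inverse x) * (- (- (inverse x ^ Suc (Suc 0)))) * inverse x ^ j) (at x)"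
      using 1 by (intro DERIV_mult DERIV_power DERIV_inverse DERIV_fun_exp DERIV_minus) auto
    moreover have "real j * (- (inverse x ^ Suc (Suc 0)) * inverse x ^ (j - Suc 0)) = - (real j * inverse x ^ (j + 1))"
      by (cases j) auto
    ultimately have "((\<lambda>x. inverse x ^ j * exp (- inverse x)) has_real_derivative
        flat (j + 2) x - real j * flat (j + 1) x) (at x)"
      using 1 by (auto elim!: DERIV_cong simp: flat_def field_simps)
    then show ?thesis
      by (rule has_field_derivative_transform_within_open[where S="{0<..}"]) (use 1 in \<open>auto simp: flat_def\<close>)
  next
    case 2
    have "((\<lambda>x. 0) has_real_derivative flat (j + 2) x - real j * flat (j + 1) x) (at x)"
      using 2 by (simp add: flat_def)
    then show ?thesis
      by (rule has_field_derivative_transform_within_open[where S="{..<0}"]) (use 2 in \<open>auto simp: flat_def\<close>)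
  next
    case 3
    \<comment> \<open>At the origin the difference quotient is itself the next member of the family,
      which tends to zero.\<close>
    have "(\<lambda>h. (flat j (0 + h) - flat j 0) / h) = flat (Suc j)"
      by (auto simp: flat_def fun_eq_iff field_simps)
    with 3 show ?thesis
      using flat_tendsto_0[of "Suc j"] by (simp add: DERIV_def flat_def[of _ 0])
  qed
qed

lemma Ck_real_flat: "Ck_real k (flat j)"
proof (induction k arbitrary: j)
  case 0
  then show ?case using DERIV_continuous_on[OF has_field_derivative_at_within[OF flat_deriv]] by simp
next
  case (Suc k)
  from Ck_real_lin[OF Suc[of "j + 2"] Suc[of "j + 1"], of 1 "- real j"]
  show ?case by (intro Ck_real_SucI[OF flat_deriv]) simp
qed

definition bump :: "real \<Rightarrow> real" where
  "bump x = flat 0 (1 - x) * flat 0 (1 + x)"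

lemma Ck_real_bump: "Ck_real k bump"
  using Ck_real_mult[OF Ck_real_affine[OF Ck_real_flat, of k 0 "-1" 1] Ck_real_affine[OF Ck_real_flat, of k 0 1 1]]
  by (simp add: bump_def[abs_def] add.commute)

lemma bump_nonneg: "0 \<le> bump x" and bump_0: "0 < bump 0" and bump_eq_0: "1 \<le> \<bar>x\<bar> \<Longrightarrow> bump x = 0"
  by (auto simp: bump_def flat_def)

lemma bump_cont: "continuous_on UNIV bump"
  using Ck_real_bump[of 0] by simp

lemma antiderivative_ex:
  fixes f :: "real \<Rightarrow> real"
  assumes "continuous_on UNIV f"
  shows "\<exists>F. F c = d \<and> (\<forall>x. (F has_real_derivative f x) (at x))"
proof -
  have "isCont f x" for x using assms by (simp add: continuous_on_eq_continuous_at)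
  then obtain F where "\<And>x. (F has_real_derivative f x) (at x)"
    using einterval_antiderivative[of "-\<infinity>" "\<infinity>" f]
    by (auto simp: has_real_derivative_iff_has_vector_derivative)
  then have "((\<lambda>x. F x - F c + d) has_real_derivative f x) (at x)" for x
    by (auto intro!: derivative_eq_intros)
  then show ?thesis by (intro exI[of _ "\<lambda>x. F x - F c + d"]) simp
qed

text \<open>Being constant on each side of the bump, a primitive cancels against a translate of
  itself far away. Differences of translates are thus compactly supported, and their derivative is a
  difference of two bumps.\<close>

lemma bump_primitive:
  obtains H where "\<And>x. (H has_real_derivative bump x) (at x)" "\<forall>k. Ck_real k H"
    "\<And>x. x \<le> -1 \<Longrightarrow> H x = H (-1)" "\<And>x. 1 \<le> x \<Longrightarrow> H x = H 1"
proof -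
  obtain H where H: "\<And>x. (H has_real_derivative bump x) (at x)"
    using antiderivative_ex[OF bump_cont] by blast
  have "Ck_real k H" for k
  proof -
    have "Ck_real (Suc k) H" using H Ck_real_bump[of k] by auto
    then show ?thesis by (rule Ck_real_SucD)
  qed
  moreover have "H x = H (-1)" if "x \<le> -1" for x
  proof (cases "x = -1")
    case False
    with that have "x < -1" by simp
    from MVT2[OF this H] obtain z where "z < -1" "H (-1) - H x = (-1 - x) * bump z" by auto
    with bump_eq_0[of z] show ?thesis by simp
  qed simp
  moreover have "H x = H 1" if "1 \<le> x" for x
  proof (cases "x = 1")
    case False
    with that have "1 < x" by simp
    from MVT2[OF this H] obtain z where "1 < z" "H x - H 1 = (x - 1) * bump z" by auto
    with bump_eq_0[of z] show ?thesis by simp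
  qed simp
  ultimately show ?thesis using H by (intro that[of H]) blast+
qed

section \<open>Product test functions in rotated coordinates\<close>

lemma pd_lin:
  assumes "\<And>p. f differentiable (at p)" "\<And>p. g differentiable (at p)"
  shows "pdx (\<lambda>p. a * f p + b * g p) = (\<lambda>p. a * pdx f p + b * pdx g p)"
    "pdy (\<lambda>p. a * f p + b * g p) = (\<lambda>p. a * pdy f p + b * pdy g p)"
    "\<And>p. (\<lambda>p. a * f p + b * g p) differentiable (at p)"
proof -
  have "((\<lambda>p. a * f p + b * g p) has_derivative
      (\<lambda>h. a * frechet_derivative f (at p) h + b * frechet_derivative g (at p) h)) (at p)" for p
    using assms[of p] unfolding frechet_derivative_works
    by (intro has_derivative_add has_derivative_mult_right)
  note * = pdx_pdy_eqI[OF this]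
  show "pdx (\<lambda>p. a * f p + b * g p) = (\<lambda>p. a * pdx f p + b * pdx g p)"
    "pdy (\<lambda>p. a * f p + b * g p) = (\<lambda>p. a * pdy f p + b * pdy g p)"
    using *(2,3) by (auto simp: pdx_def pdy_def)
  show "\<And>p. (\<lambda>p. a * f p + b * g p) differentiable (at p)" by (rule *(1))
qed

lemma Ck_on_lin:
  "Ck_on k UNIV f \<Longrightarrow> Ck_on k UNIV g \<Longrightarrow> Ck_on k UNIV (\<lambda>p. a * f p + b * g p)"
proof (induction k arbitrary: f g)
  case (Suc k)
  then have d: "\<And>p. f differentiable (at p)" "\<And>p. g differentiable (at p)" by auto
  with Suc show ?case by (simp add: pd_lin[OF d])
qed (auto intro!: continuous_intros)

text \<open>The two coordinates are orthogonal: the first is constant along \<open>(m, n)\<close>,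
  the second increases along it with rate \<open>m * m + n * n\<close>.\<close>

definition sep :: "real \<Rightarrow> real \<Rightarrow> (real \<Rightarrow> real) \<Rightarrow> (real \<Rightarrow> real) \<Rightarrow> real \<times> real \<Rightarrow> real" where
  "sep m n P R p = P (n * fst p - m * snd p) * R (m * fst p + n * snd p)"

lemma sep_pd:
  assumes P: "\<And>x. (P has_real_derivative P' x) (at x)" and R: "\<And>x. (R has_real_derivative R' x) (at x)"
  shows "\<And>p. sep m n P R differentiable (at p)"
    and "pdx (sep m n P R) = (\<lambda>p. n * sep m n P' R p + m * sep m n P R' p)"
    and "pdy (sep m n P R) = (\<lambda>p. (- m) * sep m n P' R p + n * sep m n P R' p)"
proof -
  have "(sep m n P R has_derivative
      (\<lambda>h. P (n * fst p - m * snd p) * ((m * fst h + n * snd h) * R' (m * fst p + n * snd p)) +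
           (n * fst h - m * snd h) * P' (n * fst p - m * snd p) * R (m * fst p + n * snd p))) (at p)" for p
    unfolding sep_def[abs_def]
    by (intro has_derivative_mult DERIV_compose_FDERIV[OF P] DERIV_compose_FDERIV[OF R]
        has_derivative_diff has_derivative_add has_derivative_mult_right has_derivative_fst has_derivative_snd
        has_derivative_ident)
  note * = pdx_pdy_eqI[OF this]
  show "\<And>p. sep m n P R differentiable (at p)" by (rule *(1))
  show "pdx (sep m n P R) = (\<lambda>p. n * sep m n P' R p + m * sep m n P R' p)"
    "pdy (sep m n P R) = (\<lambda>p. (- m) * sep m n P' R p + n * sep m n P R' p)"
    by (auto simp: *(2,3) sep_def algebra_simps)
qed

lemma Ck_on_sep: "Ck_real k P \<Longrightarrow> Ck_real k R \<Longrightarrow> Ck_on k UNIV (sep m n P R)"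
proof (induction k arbitrary: P R)
  case 0
  then show ?case
    unfolding sep_def[abs_def]
    by (auto intro!: continuous_intros intro: continuous_on_compose2[of UNIV P] continuous_on_compose2[of UNIV R])
next
  case (Suc k)
  then obtain P' R' where P: "\<And>x. (P has_real_derivative P' x) (at x)" "Ck_real k P'"
    and R: "\<And>x. (R has_real_derivative R' x) (at x)" "Ck_real k R'" by auto
  have "Ck_real k P" "Ck_real k R" using Suc.prems by (auto intro: Ck_real_SucD simp del: Ck_real.simps)
  with P(2) R(2) Suc.IH show ?case
    unfolding Ck_on.simps sep_pd(2,3)[OF P(1) R(1)]
    by (intro conjI ballI sep_pd(1)[OF P(1) R(1)] Ck_on_lin) blast+
qed

lemma Ck_on_2D:
  assumes "Ck_on 2 S u"
  shows "continuous_on S u" "continuous_on S (pdx u)" "continuous_on S (pdy u)"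
    "continuous_on S (pdx (pdx u))" "continuous_on S (pdy (pdx u))" "continuous_on S (pdx (pdy u))"
    "continuous_on S (pdy (pdy u))"
    "\<And>p. p \<in> S \<Longrightarrow> u differentiable (at p)" "\<And>p. p \<in> S \<Longrightarrow> pdx u differentiable (at p)"
    "\<And>p. p \<in> S \<Longrightarrow> pdy u differentiable (at p)"
proof -
  have 2: "Ck_on (Suc (Suc 0)) S u" using assms by (simp only: numeral_2_eq_2)
  then have 1: "Ck_on (Suc 0) S (pdx u)" "Ck_on (Suc 0) S (pdy u)" by auto
  show "continuous_on S u" "continuous_on S (pdx u)" "continuous_on S (pdy u)"
    by (rule Ck_on_imp_continuous[OF 2] Ck_on_imp_continuous[OF 1(1)] Ck_on_imp_continuous[OF 1(2)])+
  show "continuous_on S (pdx (pdx u))" "continuous_on S (pdy (pdx u))" "continuous_on S (pdx (pdy u))"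
    "continuous_on S (pdy (pdy u))"
    "\<And>p. p \<in> S \<Longrightarrow> u differentiable (at p)" "\<And>p. p \<in> S \<Longrightarrow> pdx u differentiable (at p)"
    "\<And>p. p \<in> S \<Longrightarrow> pdy u differentiable (at p)"
    using 2 1 by simp_all
qed

text \<open>In the coordinates of \<^const>\<open>sep\<close> the field \<open>m \<partial>\<^sub>x + n \<partial>\<^sub>y\<close> differentiates the second
  factor only, so testing with \<open>sep m n P R\<close> tests \<open>\<partial>\<^sub>x \<partial>\<^sub>y u\<close> against \<open>sep m n P R'\<close>.\<close>

lemma weak_equation_sep:
  assumes mn: "m > 0" "n > 0" and S: "open S" and u: "Ck_on 2 S u"
    and weak: "\<And>\<phi>. test_function S \<phi> \<Longrightarrow>
        - (LINT p:S|lborel. u p * (m * pdx (pdx (pdy \<phi>)) p + n * pdy (pdx (pdy \<phi>)) p)) = 0"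
    and P: "\<forall>k. Ck_real k P" and R: "\<forall>k. Ck_real k R" and R': "\<And>x. (R has_real_derivative R' x) (at x)"
    and K: "compact K" "K \<subseteq> S" "\<And>p. p \<notin> K \<Longrightarrow> sep m n P R p = 0"
  shows "(LINT p:S|lborel. pdy (pdx u) p * sep m n P R' p) = 0"
proof -
  let ?T = "sep m n"
  from Ck_real_derivative_ex[OF P] obtain P1 where P1: "\<forall>x. (P has_real_derivative P1 x) (at x)" "\<forall>k. Ck_real k P1"
    by (elim exE conjE) (rule that)
  from Ck_real_derivative_ex[OF P1(2)] obtain P2 where P2: "\<forall>x. (P1 has_real_derivative P2 x) (at x)" "\<forall>k. Ck_real k P2"
    by (elim exE conjE) (rule that)
  from Ck_real_derivative_ex[OF P2(2)] obtain P3 where P3: "\<forall>x. (P2 has_real_derivative P3 x) (at x)" "\<forall>k. Ck_real k P3"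
    by (elim exE conjE) (rule that)
  from Ck_real_derivative_ex[OF Ck_real_derivative[OF R R']] obtain R2 where R2: "\<forall>x. (R' has_real_derivative R2 x) (at x)" "\<forall>k. Ck_real k R2"
    by (elim exE conjE) (rule that)
  from Ck_real_derivative_ex[OF R2(2)] obtain R3 where R3: "\<forall>x. (R2 has_real_derivative R3 x) (at x)" "\<forall>k. Ck_real k R3"
    by (elim exE conjE) (rule that)
  note dd = P1(1)[rule_format] P2(1)[rule_format] R2(1)[rule_format] R3(1)[rule_format] P3(1)[rule_format]
  have Tsmooth: "\<forall>k. Ck_on k UNIV (?T P R)" using Ck_on_sep P R by blast
  have dsmooth: "\<forall>k. Ck_on k UNIV (?T P R')" using Ck_on_sep P Ck_real_derivative[OF R R'] by blast
  have clK: "closed K" using K(1) by (rule compact_imp_closed)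
  \<comment> \<open>The field turns the factor \<open>R\<close> into \<open>(m * m + n * n)\<close>
    times \<open>R'\<close>, and the derivatives of a function vanishing off a closed set vanish
    there as well.\<close>
  have supp: "?T P R' p = 0" if "p \<notin> K" for p
  proof -
    have "m * pdx (?T P R) p + n * pdy (?T P R) p = 0"
      using pd_zero_off_closed[OF clK K(3) that] by simp
    then have "(m * m + n * n) * ?T P R' p = 0"
      by (simp add: sep_pd[OF dd(1) R'] algebra_simps)
    then show ?thesis using mn by (simp add: add_pos_pos)
  qed
  have cl: "closure {p. ?T P R p \<noteq> 0} \<subseteq> K"
    using K(3) by (intro closure_minimal[OF _ clK]) auto
  then have "compact (closure {p. ?T P R p \<noteq> 0})"
    using K(1) bounded_subset unfolding compact_eq_bounded_closed by blast
  with cl K(2) Tsmooth have "test_function S (?T P R)"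
    unfolding test_function_def by blast
  note W = weak[OF this]
  let ?l = "\<lambda>p. (m * m + n * n) * pdx (pdy (?T P R')) p"
  note pds = sep_pd[OF dd(1) R'] sep_pd[OF dd(1) dd(3)] sep_pd[OF dd(1) dd(4)] sep_pd[OF dd(2) R']
    sep_pd[OF dd(2) dd(3)] sep_pd[OF dd(5) R']
  \<comment> \<open>The derivatives commute on products of this form, so the field can be applied to
    the factor \<open>R\<close> before the two other derivatives.\<close>
  have fields: "m * pdx (pdx (pdy (?T P R))) p + n * pdy (pdx (pdy (?T P R))) p = ?l p" for p
    by (simp only: pds pd_lin) (simp add: algebra_simps)
  from W have "(LINT p:S|lborel. u p * pdx (pdy (?T P R')) p) = 0"
  proof -
    have "(LINT p:S|lborel. u p * ?l p) = (m * m + n * n) * (LINT p:S|lborel. u p * pdx (pdy (?T P R')) p)"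
      by (subst set_integral_mult_right[symmetric]) (simp add: algebra_simps)
    moreover have "m * m + n * n > 0" using mn by (simp add: add_pos_pos)
    ultimately show ?thesis using W mn unfolding fields by auto
  qed
  moreover have "(LINT p:S|lborel. u p * pdx (pdy (?T P R')) p) = - (LINT p:S|lborel. pdx u p * pdy (?T P R') p)"
  proof (rule ibp_pdx_pdy(1)[OF S K(1,2) smooth_pd(2)[OF dsmooth]])
    show "pdy (?T P R') p = 0" if "p \<notin> K" for p using pd_zero_off_closed(2)[OF clK supp that] .
    show "continuous_on S u" "continuous_on S (pdx u)" by (rule Ck_on_2D[OF u])+
    show "((\<lambda>t. u (p + t *\<^sub>R (1, 0))) has_real_derivative pdx u p) (at 0)" if "p \<in> S" for p
      using directional_derivative[OF Ck_on_2D(8)[OF u that], of 1 0] by simp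
  qed
  moreover have "(LINT p:S|lborel. pdx u p * pdy (?T P R') p) = - (LINT p:S|lborel. pdy (pdx u) p * ?T P R' p)"
  proof (rule ibp_pdx_pdy(2)[OF S K(1,2) dsmooth supp])
    show "continuous_on S (pdx u)" "continuous_on S (pdy (pdx u))" by (rule Ck_on_2D[OF u])+
    show "((\<lambda>t. pdx u (p + t *\<^sub>R (0, 1))) has_real_derivative pdy (pdx u) p) (at 0)" if "p \<in> S" for p
      using directional_derivative[OF Ck_on_2D(9)[OF u that], of 0 1] by simp
  qed
  ultimately show ?thesis by simp
qed

text \<open>A bump of scale \<open>\<epsilon>\<close> around \<open>q\<close> aligned with
  \<open>(m, n)\<close>. Up to the factor \<open>1 / \<epsilon>\<close>, differences of two such
  bumps on one line are of the form \<open>sep m n P R'\<close>. It is not normalized, as its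
  integral does not depend on \<open>q\<close>.\<close>

definition sbox :: "real \<Rightarrow> real \<Rightarrow> real \<Rightarrow> real \<times> real \<Rightarrow> real \<times> real \<Rightarrow> real" where
  "sbox m n \<epsilon> q p = bump ((n * fst (p - q) - m * snd (p - q)) / \<epsilon>) * bump ((m * fst (p - q) + n * snd (p - q)) / \<epsilon>)"

text \<open>Let \<open>s\<close>, \<open>r\<close> be the rotated coordinates of
  \<open>(x, y)\<close> and \<open>N = m * m + n * n\<close>. Then \<open>N x = n s + m r\<close>
  and \<open>N y = n r - m s\<close>; the factor 2 arises from adding the bounds for the two
  components.\<close>

lemma norm_le_coords:
  fixes p :: "real \<times> real"
  assumes mn: "m > 0" "n > 0" and "\<bar>n * fst p - m * snd p\<bar> \<le> e" "\<bar>m * fst p + n * snd p\<bar> \<le> e"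
  shows "norm p \<le> 2 * (m + n) / (m * m + n * n) * e"
proof -
  define s r N where "s = n * fst p - m * snd p" and "r = m * fst p + n * snd p" and "N = m * m + n * n"
  have N: "N > 0" using mn by (simp add: N_def add_pos_pos)
  have ns: "\<bar>n * s\<bar> \<le> n * e" "\<bar>m * s\<bar> \<le> m * e" "\<bar>n * r\<bar> \<le> n * e" "\<bar>m * r\<bar> \<le> m * e"
    using assms by (auto simp: abs_mult s_def r_def intro!: mult_left_mono)
  have "N * fst p = n * s + m * r" "N * snd p = n * r - m * s"
    by (simp_all add: s_def r_def N_def algebra_simps)
  then have "\<bar>N * fst p\<bar> \<le> n * e + m * e" "\<bar>N * snd p\<bar> \<le> n * e + m * e"
    using ns by linarith+
  then have "N * \<bar>fst p\<bar> \<le> (m + n) * e" "N * \<bar>snd p\<bar> \<le> (m + n) * e"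
    using N by (auto simp: abs_mult algebra_simps)
  then have "\<bar>fst p\<bar> + \<bar>snd p\<bar> \<le> 2 * (m + n) / N * e"
    using N by (simp add: field_simps)
  moreover have "norm p \<le> \<bar>fst p\<bar> + \<bar>snd p\<bar>"
    using norm_Pair_le[of "fst p" "snd p"] by simp
  ultimately show ?thesis by (simp add: N_def)
qed

section \<open>Mollification and constancy along lines\<close>

context
  fixes m n :: real
  assumes mn: "m > 0" "n > 0"
begin

lemma sbox_nonneg: "0 \<le> sbox m n \<epsilon> q p"
  by (simp add: sbox_def bump_nonneg)

lemma sbox_cont: "continuous_on UNIV (sbox m n \<epsilon> q)"
  unfolding sbox_def[abs_def] divide_inverse
  by (intro continuous_on_mult continuous_on_compose2[OF bump_cont] continuous_intros) auto

lemma sbox_support: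
  assumes "0 < \<epsilon>" "2 * (m + n) / (m * m + n * n) * \<epsilon> \<le> \<rho>" "p \<notin> cball q \<rho>"
  shows "sbox m n \<epsilon> q p = 0"
proof (rule ccontr)
  assume "sbox m n \<epsilon> q p \<noteq> 0"
  then have "\<not> 1 \<le> \<bar>(n * fst (p - q) - m * snd (p - q)) / \<epsilon>\<bar>" "\<not> 1 \<le> \<bar>(m * fst (p - q) + n * snd (p - q)) / \<epsilon>\<bar>"
    using bump_eq_0 unfolding sbox_def mult_eq_0_iff by blast+
  then have "\<bar>n * fst (p - q) - m * snd (p - q)\<bar> \<le> \<epsilon>" "\<bar>m * fst (p - q) + n * snd (p - q)\<bar> \<le> \<epsilon>"
    using assms(1) unfolding abs_divide by (simp_all add: not_le divide_less_eq)
  from norm_le_coords[OF mn this] assms(2,3) show False by (simp add: dist_norm norm_minus_commute)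
qed

lemma sbox_integrable: "0 < \<epsilon> \<Longrightarrow> integrable lborel (sbox m n \<epsilon> q)"
  by (rule integrable_compact_support[OF compact_cball[of q "2 * (m + n) / (m * m + n * n) * \<epsilon>"]])
    (blast intro: continuous_on_subset[OF sbox_cont] sbox_support order_refl)+

lemma sbox_integral: "(\<integral>p. sbox m n \<epsilon> q p \<partial>lborel) = (\<integral>p. sbox m n \<epsilon> 0 p \<partial>lborel)"
proof -
  have "sbox m n \<epsilon> 0 \<in> borel_measurable borel"
    by (rule borel_measurable_continuous_onI[OF sbox_cont])
  from integral_shift[OF this, of "- q"] show ?thesis by (simp add: sbox_def)
qed

lemma sbox_integral_pos:
  assumes "0 < \<epsilon>"
  shows "0 < (\<integral>p. sbox m n \<epsilon> 0 p \<partial>lborel)"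
proof -
  define c where "c = sbox m n \<epsilon> 0 0 / 2"
  have c: "0 < c" by (simp add: c_def sbox_def bump_0)
  obtain d where d: "0 < d" "\<And>p. dist p 0 < d \<Longrightarrow> dist (sbox m n \<epsilon> 0 p) (sbox m n \<epsilon> 0 0) < c"
    using sbox_cont c unfolding continuous_on_iff by (metis UNIV_I)
  have ge: "c * indicator (ball 0 d) p \<le> sbox m n \<epsilon> 0 p" for p
  proof (cases "p \<in> ball 0 d")
    case True
    then have "\<bar>sbox m n \<epsilon> 0 p - 2 * c\<bar> < c" using d(2)[of p] by (simp add: dist_real_def c_def dist_commute)
    then show ?thesis using True by simp
  qed (simp add: sbox_nonneg)
  have "0 < c * measure lborel (ball (0::real \<times> real) d)"
    using c content_ball_pos[OF d(1)] by simp
  also have "\<dots> = (\<integral>p. c * indicator (ball (0::real \<times> real) d) p \<partial>lborel)" by simp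
  also have "\<dots> \<le> (\<integral>p. sbox m n \<epsilon> 0 p \<partial>lborel)"
    by (intro integral_mono ge sbox_integrable assms integrable_mult_right integrable_real_indicator
        emeasure_bounded_finite bounded_ball) auto
  finally show ?thesis .
qed

text \<open>The kernel is concentrated near \<open>q\<close>, where \<open>w\<close> is close to
  \<open>w q\<close> by continuity. The error is measured relative to the mass of the kernel, which
  tends to zero with \<open>\<epsilon>\<close>.\<close>

lemma sbox_average:
  assumes S: "open S" "continuous_on S w" "q \<in> S" and "0 < \<eta>"
  shows "\<exists>\<epsilon>0>0. \<forall>\<epsilon>. 0 < \<epsilon> \<and> \<epsilon> < \<epsilon>0 \<longrightarrow>
    \<bar>(LINT p:S|lborel. w p * sbox m n \<epsilon> q p) - w q * (\<integral>p. sbox m n \<epsilon> 0 p \<partial>lborel)\<bar>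
      \<le> \<eta> * (\<integral>p. sbox m n \<epsilon> 0 p \<partial>lborel)"
proof -
  obtain d1 where d1: "0 < d1" "ball q d1 \<subseteq> S" using S open_contains_ball by blast
  obtain d2 where d2: "0 < d2" "\<And>p. p \<in> S \<Longrightarrow> dist p q < d2 \<Longrightarrow> dist (w p) (w q) < \<eta>"
    using S(2,3) \<open>0 < \<eta>\<close> unfolding continuous_on_iff by metis
  define \<rho> where "\<rho> = min d1 d2 / 2"
  have \<rho>: "0 < \<rho>" using d1 d2 by (simp add: \<rho>_def)
  have close: "dist q p < d1" "dist p q < d2" if "p \<in> cball q \<rho>" for p
    using that d1 d2 by (auto simp: \<rho>_def dist_commute)
  have cb1: "cball q \<rho> \<subseteq> S" using close(1) d1(2) by (auto simp: subset_iff)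
  have cb2: "\<bar>w p - w q\<bar> \<le> \<eta>" if "p \<in> cball q \<rho>" for p
    using d2(2)[of p] close(2)[OF that] cb1 that by (auto simp: dist_real_def)
  define C where "C = 2 * (m + n) / (m * m + n * n)"
  have C: "0 < C" using mn by (simp add: C_def add_pos_pos)
  have "\<bar>(LINT p:S|lborel. w p * sbox m n \<epsilon> q p) - w q * (\<integral>p. sbox m n \<epsilon> 0 p \<partial>lborel)\<bar>
      \<le> \<eta> * (\<integral>p. sbox m n \<epsilon> 0 p \<partial>lborel)" if "0 < \<epsilon>" "\<epsilon> < \<rho> / C" for \<epsilon>
  proof -
    have \<epsilon>: "0 < \<epsilon>" "C * \<epsilon> \<le> \<rho>" using that C by (auto simp: field_simps)
    let ?\<kappa> = "sbox m n \<epsilon> q" and ?I = "\<integral>p. sbox m n \<epsilon> 0 p \<partial>lborel"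
    have supp: "?\<kappa> p = 0" if "p \<notin> cball q \<rho>" for p
      using sbox_support[OF \<epsilon>(1) _ that] \<epsilon>(2) by (simp add: C_def)
    let ?z = "\<lambda>p. if p \<in> S then w p * ?\<kappa> p else 0"
    have wc: "continuous_on S (\<lambda>p. w p * ?\<kappa> p)"
      by (intro continuous_on_mult S(2) continuous_on_subset[OF sbox_cont]) simp
    have w0: "w p * ?\<kappa> p = 0" if "p \<notin> cball q \<rho>" for p using supp[OF that] by simp
    note int = set_integral_compact_support[OF compact_cball cb1 wc w0]
    have \<kappa>int: "integrable lborel ?\<kappa>" by (rule sbox_integrable[OF \<epsilon>(1)])
    have pt: "\<bar>?z p - w q * ?\<kappa> p\<bar> \<le> \<eta> * ?\<kappa> p" for p
    proof (cases "p \<in> cball q \<rho>")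
      case True
      then have "?z p - w q * ?\<kappa> p = (w p - w q) * ?\<kappa> p" using cb1 by (auto simp: left_diff_distrib)
      moreover have "\<bar>(w p - w q) * ?\<kappa> p\<bar> \<le> \<eta> * ?\<kappa> p"
        unfolding abs_mult using cb2[OF True] sbox_nonneg[of \<epsilon> q p] by (simp add: mult_right_mono)
      ultimately show ?thesis by (simp only:)
    qed (simp add: supp)
    have eq: "(\<integral>p. ?z p - w q * ?\<kappa> p \<partial>lborel) = (\<integral>p. ?z p \<partial>lborel) - w q * ?I"
      using int(1) \<kappa>int by (simp add: sbox_integral[of \<epsilon> q])
    have "\<bar>\<integral>p. ?z p - w q * ?\<kappa> p \<partial>lborel\<bar> \<le> (\<integral>p. \<bar>?z p - w q * ?\<kappa> p\<bar> \<partial>lborel)"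
      by (rule integral_abs_bound)
    also have "\<dots> \<le> (\<integral>p. \<eta> * ?\<kappa> p \<partial>lborel)"
      using int(1) \<kappa>int by (intro integral_mono pt) auto
    also have "\<dots> = \<eta> * ?I" by (simp add: sbox_integral[of \<epsilon> q])
    finally show ?thesis using int(2) eq by simp
  qed
  moreover have "0 < \<rho> / C" using \<rho> C by simp
  ultimately show ?thesis by blast
qed

lemma weak_line_const:
  assumes S: "open S" and u: "Ck_on 2 S u"
    and weak: "\<And>\<phi>. test_function S \<phi> \<Longrightarrow>
        - (LINT p:S|lborel. u p * (m * pdx (pdx (pdy \<phi>)) p + n * pdy (pdx (pdy \<phi>)) p)) = 0"
    and seg: "closed_segment q (q + t *\<^sub>R (m, n)) \<subseteq> S" and t: "0 \<le> t"
  shows "pdy (pdx u) q = pdy (pdx u) (q + t *\<^sub>R (m, n))"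
proof -
  define w where "w = pdy (pdx u)"
  define q' where "q' = q + t *\<^sub>R (m, n)"
  define s where "s p = n * fst p - m * snd p" for p :: "real \<times> real"
  define r where "r p = m * fst p + n * snd p" for p :: "real \<times> real"
  define N where "N = m * m + n * n"
  have N: "N > 0" using mn by (simp add: N_def add_pos_pos)
  have cw: "continuous_on S w" using Ck_on_2D(5)[OF u] by (simp only: w_def)
  have qS: "q \<in> S" "q' \<in> S" using seg by (auto simp: q'_def)
  have s': "s q' = s q" and r': "r q' = r q + t * N"
    by (simp_all add: s_def r_def q'_def N_def algebra_simps)
  have tN: "0 \<le> t * N" using t N by simp
  obtain H where H: "\<And>x. (H has_real_derivative bump x) (at x)" "\<forall>k. Ck_real k H"
    "\<And>x. x \<le> -1 \<Longrightarrow> H x = H (-1)" "\<And>x. 1 \<le> x \<Longrightarrow> H x = H 1"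
    using bump_primitive by metis
  define C where "C = 2 * (m + n) / N"
  have C: "0 < C" using mn N by (simp add: C_def)
  obtain d where d: "0 < d" "(\<Union>x\<in>closed_segment q q'. ball x d) \<subseteq> S"
    using compact_subset_open_imp_ball_epsilon_subset[OF compact_segment S seg] by (auto simp: q'_def)
  have eq: "(LINT p:S|lborel. w p * sbox m n \<epsilon> q p) = (LINT p:S|lborel. w p * sbox m n \<epsilon> q' p)"
    if \<epsilon>: "0 < \<epsilon>" "C * \<epsilon> < d" for \<epsilon>
  proof -
    define P where "P x = bump ((x - s q) / \<epsilon>)" for x
    \<comment> \<open>\<open>R\<close> vanishes outside the range from
      \<open>r q - \<epsilon>\<close> to \<open>r q' + \<epsilon>\<close>, whereas \<open>R'\<close>
      is the difference of the bumps at \<open>r q\<close> and \<open>r q'\<close>, divided by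
      \<open>\<epsilon>\<close>.\<close>
    define R where "R x = H ((x - r q) / \<epsilon>) - H ((x - r q') / \<epsilon>)" for x
    define R' where "R' x = (bump ((x - r q) / \<epsilon>) - bump ((x - r q') / \<epsilon>)) / \<epsilon>" for x
    have aff: "Ck_real k (\<lambda>x. f ((x - c) / \<epsilon>))" if "Ck_real k f" for k f c
    proof -
      have "(x - c) / \<epsilon> = 1 / \<epsilon> * x + (- c / \<epsilon>)" for x by (simp add: diff_divide_distrib)
      with Ck_real_affine[OF that, of "1 / \<epsilon>" "- c / \<epsilon>"] show ?thesis by (simp only:)
    qed
    have Ps: "\<forall>k. Ck_real k P" unfolding P_def[abs_def] using aff Ck_real_bump by blast
    have Rs: "\<forall>k. Ck_real k R"
    proof
      fix k
      have "Ck_real k H" using H(2) by blast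
      from Ck_real_lin[OF aff[OF this] aff[OF this], of 1 "r q" "-1" "r q'"] show "Ck_real k R"
        by (simp add: R_def[abs_def])
    qed
    have Rd: "(R has_real_derivative R' x) (at x)" for x
    proof -
      have "((\<lambda>x. (x - c) / \<epsilon>) has_real_derivative 1 / \<epsilon>) (at x)" for c
        using DERIV_cdivide[OF DERIV_diff[OF DERIV_ident DERIV_const]] by simp
      then have "((\<lambda>x. H ((x - c) / \<epsilon>)) has_real_derivative bump ((x - c) / \<epsilon>) * (1 / \<epsilon>)) (at x)" for c
        by (rule DERIV_chain2[OF H(1)])
      from DERIV_diff[OF this[of "r q"] this[of "r q'"]] show ?thesis
        by (simp add: R_def[abs_def] R'_def diff_divide_distrib)
    qed
    define K where "K = {p. \<bar>s p - s q\<bar> \<le> \<epsilon> \<and> r q - \<epsilon> \<le> r p \<and> r p \<le> r q' + \<epsilon>}"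
    have near: "\<exists>x\<in>closed_segment q q'. dist x p \<le> C * \<epsilon>" if "p \<in> K" for p
    proof -
      \<comment> \<open>The clamp selects the point of the segment with the same coordinate
        \<open>r\<close> as \<open>p\<close>, or the closer end point if \<open>p\<close> projects
        beyond the segment.\<close>
      define c where "c = min (max (r p - r q) 0) (t * N) / N"
      have cN: "c * N = min (max (r p - r q) 0) (t * N)" using N by (simp add: c_def)
      have "0 \<le> c * N" "c * N \<le> t * N" unfolding cN using tN by simp_all
      then have c: "0 \<le> c" "c \<le> t" using N by (simp_all add: zero_le_mult_iff)
      define x where "x = q + c *\<^sub>R (m, n)"
      have x: "x \<in> closed_segment q q'"
      proof (cases "t = 0")
        case False
        then have "(c / t) *\<^sub>R q' = (c / t) *\<^sub>R q + c *\<^sub>R (m, n)"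
          unfolding q'_def by (simp only: scaleR_add_right scaleR_scaleR) simp
        then have "x = (1 - c / t) *\<^sub>R q + (c / t) *\<^sub>R q'"
          unfolding x_def by (simp only: scaleR_diff_left scaleR_one) simp
        then show ?thesis using c t False unfolding in_segment by (intro exI[of _ "c / t"]) auto
      next
        case True
        then have "c = 0" using c by simp
        then have "x = q" by (simp only: x_def scaleR_zero_left add_0_right)
        then show ?thesis by simp
      qed
      have "r x = r q + c * N" "s x = s q" by (simp_all add: r_def s_def x_def N_def algebra_simps)
      then have "\<bar>s p - s x\<bar> \<le> \<epsilon>" "\<bar>r p - r x\<bar> \<le> \<epsilon>"
        using that \<epsilon> r' tN cN by (auto simp: K_def min_def max_def abs_le_iff)
      then have "norm (p - x) \<le> C * \<epsilon>"
        unfolding C_def N_def by (intro norm_le_coords[OF mn]) (simp_all add: s_def r_def algebra_simps)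
      with x show ?thesis by (auto simp: dist_norm norm_minus_commute)
    qed
    have KS: "K \<subseteq> S"
    proof
      fix p assume "p \<in> K"
      from near[OF this] \<epsilon>(2) obtain x where "x \<in> closed_segment q q'" "p \<in> ball x d" by auto
      with d(2) show "p \<in> S" by blast
    qed
    have "closed K"
      unfolding K_def s_def r_def by (intro closed_Collect_conj closed_Collect_le continuous_intros)
    moreover have "bounded K"
    proof -
      obtain B where B: "\<And>x. x \<in> closed_segment q q' \<Longrightarrow> norm x \<le> B"
        using bounded_closed_segment bounded_iff by metis
      have "norm p \<le> B + C * \<epsilon>" if "p \<in> K" for p
      proof -
        from near[OF that] obtain x where x: "x \<in> closed_segment q q'" "dist x p \<le> C * \<epsilon>" by blast
        have "norm p \<le> norm x + dist x p"
          using norm_triangle_ineq2[of p x] by (simp add: dist_norm norm_minus_commute)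
        with B[OF x(1)] x(2) show ?thesis by linarith
      qed
      then show ?thesis unfolding bounded_iff by blast
    qed
    ultimately have K: "compact K" by (simp add: compact_eq_bounded_closed)
    have K0: "sep m n P R p = 0" if "p \<notin> K" for p
    proof -
      have "P (s p) = 0 \<or> R (r p) = 0"
      proof (cases "\<bar>s p - s q\<bar> \<le> \<epsilon>")
        case False
        then have "1 \<le> \<bar>(s p - s q) / \<epsilon>\<bar>" using \<epsilon> by (simp add: abs_divide)
        then show ?thesis by (simp add: P_def bump_eq_0)
      next
        case True
        then consider "r p < r q - \<epsilon>" | "r q' + \<epsilon> < r p" using \<open>p \<notin> K\<close> by (auto simp: K_def)
        then show ?thesis
        proof cases
          case 1
          then have "r p - r q \<le> -1 * \<epsilon>" "r p - r q' \<le> -1 * \<epsilon>" using r' tN by linarith+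
          then have "(r p - r q) / \<epsilon> \<le> -1" "(r p - r q') / \<epsilon> \<le> -1"
            using \<epsilon>(1) by (simp_all only: pos_divide_le_eq)
          from this[THEN H(3)] have "R (r p) = 0" by (simp add: R_def)
          then show ?thesis ..
        next
          case 2
          then have "1 * \<epsilon> \<le> r p - r q" "1 * \<epsilon> \<le> r p - r q'" using r' tN by linarith+
          then have "1 \<le> (r p - r q) / \<epsilon>" "1 \<le> (r p - r q') / \<epsilon>"
            using \<epsilon>(1) by (simp_all only: pos_le_divide_eq)
          from this[THEN H(4)] have "R (r p) = 0" by (simp add: R_def)
          then show ?thesis ..
        qed
      qed
      then show ?thesis by (auto simp: sep_def s_def r_def)
    qed
    have "(LINT p:S|lborel. w p * sep m n P R' p) = 0"
      unfolding w_def by (rule weak_equation_sep[OF mn S u weak Ps Rs Rd K KS K0])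
    moreover have "w p * sep m n P R' p = (1 / \<epsilon>) * (w p * sbox m n \<epsilon> q p - w p * sbox m n \<epsilon> q' p)" for p
    proof -
      have 1: "n * fst (p - q) - m * snd (p - q) = s p - s q" "n * fst (p - q') - m * snd (p - q') = s p - s q"
        "m * fst (p - q) + n * snd (p - q) = r p - r q" "m * fst (p - q') + n * snd (p - q') = r p - r q'"
        using s' by (simp_all add: s_def r_def algebra_simps)
      have "sep m n P R' p = P (s p) * R' (r p)" by (simp add: sep_def s_def r_def)
      moreover have "sbox m n \<epsilon> q p = P (s p) * bump ((r p - r q) / \<epsilon>)" "sbox m n \<epsilon> q' p = P (s p) * bump ((r p - r q') / \<epsilon>)"
        unfolding sbox_def 1 P_def by simp_all
      ultimately show ?thesis
        by (simp only: R'_def) (simp add: right_diff_distrib diff_divide_distrib)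
    qed
    ultimately have "(LINT p:S|lborel. (1 / \<epsilon>) * (w p * sbox m n \<epsilon> q p - w p * sbox m n \<epsilon> q' p)) = 0"
      by (simp only:)
    then have 0: "(LINT p:S|lborel. w p * sbox m n \<epsilon> q p - w p * sbox m n \<epsilon> q' p) = 0"
      using \<epsilon>(1) by (simp only: set_integral_mult_right mult_eq_0_iff divide_eq_0_iff) simp
    have int: "set_integrable lborel S (\<lambda>p. w p * sbox m n \<epsilon> x p)" if "x \<in> closed_segment q q'" for x
    proof -
      have "cball x (C * \<epsilon>) \<subseteq> ball x d" using \<epsilon>(2) by auto
      then have "cball x (C * \<epsilon>) \<subseteq> S" using d(2) that by blast
      moreover have "continuous_on S (\<lambda>p. w p * sbox m n \<epsilon> x p)"
        by (intro continuous_on_mult cw continuous_on_subset[OF sbox_cont]) simp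
      moreover have "w p * sbox m n \<epsilon> x p = 0" if "p \<notin> cball x (C * \<epsilon>)" for p
        using sbox_support[OF \<epsilon>(1) _ that] by (simp add: C_def N_def)
      ultimately have "integrable lborel (\<lambda>p. if p \<in> S then w p * sbox m n \<epsilon> x p else 0)"
        by (rule set_integral_compact_support(1)[OF compact_cball])
      moreover have "(\<lambda>p. if p \<in> S then w p * sbox m n \<epsilon> x p else 0) = (\<lambda>p. indicator S p *\<^sub>R (w p * sbox m n \<epsilon> x p))"
        by (rule ext) (simp add: indicator_def)
      ultimately show ?thesis unfolding set_integrable_def by (simp only:)
    qed
    show ?thesis using 0 set_integral_diff(2)[OF int int, of q q'] by simp
  qed
  have "\<bar>w q - w q'\<bar> \<le> 0 + e" if "0 < e" for e
  proof -
    have "0 < e / 2" using that by simp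
    from sbox_average[OF S cw qS(1) this] obtain e1 where e1: "0 < e1" "\<forall>\<epsilon>. 0 < \<epsilon> \<and> \<epsilon> < e1 \<longrightarrow>
      \<bar>(LINT p:S|lborel. w p * sbox m n \<epsilon> q p) - w q * (\<integral>p. sbox m n \<epsilon> 0 p \<partial>lborel)\<bar> \<le> e / 2 * (\<integral>p. sbox m n \<epsilon> 0 p \<partial>lborel)"
      by (elim exE conjE) (rule that)
    from sbox_average[OF S cw qS(2) \<open>0 < e / 2\<close>] obtain e2 where e2: "0 < e2" "\<forall>\<epsilon>. 0 < \<epsilon> \<and> \<epsilon> < e2 \<longrightarrow>
      \<bar>(LINT p:S|lborel. w p * sbox m n \<epsilon> q' p) - w q' * (\<integral>p. sbox m n \<epsilon> 0 p \<partial>lborel)\<bar> \<le> e / 2 * (\<integral>p. sbox m n \<epsilon> 0 p \<partial>lborel)"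
      by (elim exE conjE) (rule that)
    define \<epsilon> where "\<epsilon> = min (min e1 e2) (d / C) / 2"
    have "0 < min (min e1 e2) (d / C)" using e1(1) e2(1) d(1) C by simp
    moreover have "min (min e1 e2) (d / C) \<le> e1" "min (min e1 e2) (d / C) \<le> e2" "min (min e1 e2) (d / C) \<le> d / C"
      by simp_all
    ultimately have \<epsilon>: "0 < \<epsilon>" "\<epsilon> < e1" "\<epsilon> < e2" "\<epsilon> < d / C" unfolding \<epsilon>_def by linarith+
    then have "C * \<epsilon> < d" using C by (simp add: field_simps)
    define I where "I = (\<integral>p. sbox m n \<epsilon> 0 p \<partial>lborel)"
    have I: "0 < I" using sbox_integral_pos[OF \<epsilon>(1)] by (simp add: I_def)
    have "\<bar>w q * I - w q' * I\<bar> \<le> e / 2 * I + e / 2 * I"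
      using e1(2)[rule_format, of \<epsilon>] e2(2)[rule_format, of \<epsilon>] \<epsilon> eq[OF \<epsilon>(1) \<open>C * \<epsilon> < d\<close>]
      unfolding I_def[symmetric] by linarith
    also have "\<dots> = e * I" by (simp add: field_simps)
    finally have "\<bar>w q - w q'\<bar> * I \<le> e * I" using I by (simp add: abs_mult flip: left_diff_distrib)
    then show ?thesis using I by simp
  qed
  then have "\<bar>w q - w q'\<bar> \<le> 0" by (rule field_le_epsilon)
  then show ?thesis by (simp add: w_def q'_def)
qed

end

section \<open>The curvilinear triangle\<close>

text \<open>\<open>a s = 0\<close> and \<open>a s = s\<close> mean \<open>x = 0\<close> and
  \<open>y = 0\<close> at the point with parameter \<open>s\<close>. The assumptions thus state that
  the curve meets the axes only at its ends, whose parameters are \<open>- m\<close> and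
  \<open>n\<close>.\<close>

locale wedge = averaging "- m" n a a1 a2 for m n a a1 a2 +
  assumes a_zero: "s \<in> {-m..n} \<Longrightarrow> a s = 0 \<Longrightarrow> s = - m"
    and b_zero: "s \<in> {-m..n} \<Longrightarrow> a s = s \<Longrightarrow> s = n"
begin

lemma m0: "0 < m" and n0: "0 < n"
  using l0 r0 by auto

definition arcpt :: "real \<Rightarrow> real \<times> real" where
  "arcpt s = (a s / n, (a s - s) / m)"

definition \<sigma> :: "real \<times> real \<Rightarrow> real" where
  "\<sigma> p = n * fst p - m * snd p"

text \<open>Makes \<open>a (clip (\<sigma> p))\<close> a continuous function on the whole plane, so
  that openness of \<open>tri\<close> and closedness of \<open>ctri\<close> can be read off from
  their inequalities.\<close>

definition clip :: "real \<Rightarrow> real" where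
  "clip s = max (- m) (min n s)"

text \<open>On the line \<open>\<sigma> = s\<close> the curve has \<open>n x = a s\<close>, so the
  last inequality places the point strictly before the curve in the direction \<open>(m, n)\<close>;
  it is equivalent to \<open>m y < - b s\<close>.\<close>

definition tri :: "(real \<times> real) set" where
  "tri = {p. 0 < fst p \<and> 0 < snd p \<and> - m < \<sigma> p \<and> \<sigma> p < n \<and> n * fst p < a (clip (\<sigma> p))}"

definition ctri :: "(real \<times> real) set" where
  "ctri = {p. 0 \<le> fst p \<and> 0 \<le> snd p \<and> - m \<le> \<sigma> p \<and> \<sigma> p \<le> n \<and> n * fst p \<le> a (clip (\<sigma> p))}"

definition sides :: "(real \<times> real) set" where
  "sides = closed_segment (0, 0) (1, 0) \<union> closed_segment (0, 0) (0, 1) \<union> arcpt ` {-m..n}"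

lemma clip_J: "clip s \<in> J"
  using m0 n0 by (auto simp: clip_def)

lemma clip_id: "s \<in> J \<Longrightarrow> clip s = s"
  by (auto simp: clip_def)

lemma \<sigma>_arcpt: "\<sigma> (arcpt s) = s"
  using m0 n0 by (simp add: \<sigma>_def arcpt_def)

lemma arcpt_bounds: "s \<in> J \<Longrightarrow> 0 \<le> fst (arcpt s) \<and> 0 \<le> snd (arcpt s)"
  using a_range[of s] b_range[of s] m0 n0 by (simp add: arcpt_def b_def)

lemma ctri_coords:
  assumes "p \<in> ctri"
  shows "0 \<le> fst p" "fst p \<le> 1" "0 \<le> snd p" "snd p \<le> 1" "\<sigma> p \<in> J" "n * fst p \<le> a (\<sigma> p)"
    "n * fst p \<in> J" "- m * snd p \<in> J"
proof -
  show J: "\<sigma> p \<in> J" and 1: "0 \<le> fst p" "0 \<le> snd p" using assms by (auto simp: ctri_def)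
  show le: "n * fst p \<le> a (\<sigma> p)" using assms clip_id[OF J] by (simp add: ctri_def)
  have "a (\<sigma> p) \<le> n" using a_range[OF J] by simp
  with le have 2: "n * fst p \<le> n * 1" by simp
  then show "fst p \<le> 1" using n0 by simp
  have "- b (\<sigma> p) \<le> m" using b_range[OF J] by simp
  moreover have "m * snd p \<le> - b (\<sigma> p)" using le by (simp add: b_def \<sigma>_def)
  ultimately have 3: "m * snd p \<le> m * 1" by simp
  then show "snd p \<le> 1" using m0 by simp
  have "0 \<le> n * fst p" "0 \<le> m * snd p" using 1 m0 n0 by simp_all
  with 2 3 show "n * fst p \<in> J" "- m * snd p \<in> J" using m0 n0 by auto
qed

lemma segment_x: "closed_segment (0, 0) (1::real, 0::real) = {p. 0 \<le> fst p \<and> fst p \<le> 1 \<and> snd p = 0}"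
  by (auto simp: in_segment)

lemma segment_y: "closed_segment (0, 0) (0::real, 1::real) = {p. 0 \<le> snd p \<and> snd p \<le> 1 \<and> fst p = 0}"
  by (auto simp: in_segment)

lemma sides_subset: "sides \<subseteq> ctri"
proof
  fix p assume "p \<in> sides"
  then consider "0 \<le> fst p \<and> fst p \<le> 1 \<and> snd p = 0" | "0 \<le> snd p \<and> snd p \<le> 1 \<and> fst p = 0"
    | s where "s \<in> J" "p = arcpt s"
    by (auto simp: sides_def segment_x segment_y)
  then show "p \<in> ctri"
  proof cases
    case 1
    then have s: "\<sigma> p = n * fst p" by (simp add: \<sigma>_def)
    have "0 \<le> n * fst p" "n * fst p \<le> n" using 1 n0 by (simp_all add: mult_left_le)
    then have J: "\<sigma> p \<in> J" using s m0 by simp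
    show ?thesis using 1 J b_range[OF J] clip_id[OF J] by (simp add: ctri_def b_def s)
  next
    case 2
    then have s: "\<sigma> p = - (m * snd p)" by (simp add: \<sigma>_def)
    have "0 \<le> m * snd p" "m * snd p \<le> m" using 2 m0 by (simp_all add: mult_left_le)
    then have J: "\<sigma> p \<in> J" using s n0 by simp
    show ?thesis using 2 J a_range[OF J] clip_id[OF J] by (simp add: ctri_def)
  next
    case 3
    then show ?thesis using arcpt_bounds[OF 3(1)] \<sigma>_arcpt[of s] clip_id[OF 3(1)] n0 by (simp add: ctri_def arcpt_def)
  qed
qed

lemma tri_sides_disjoint: "p \<in> tri \<Longrightarrow> p \<notin> sides"
proof
  assume p: "p \<in> tri" "p \<in> sides"
  then obtain s where s: "s \<in> J" "p = arcpt s"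
    by (auto simp: sides_def segment_x segment_y tri_def)
  then show False using p(1) \<sigma>_arcpt[of s] clip_id[OF s(1)] n0 by (simp add: tri_def arcpt_def)
qed

lemma tri_subset: "tri \<subseteq> ctri"
  by (auto simp: tri_def ctri_def)

lemma ctri_eq: "ctri = tri \<union> sides"
proof
  show "tri \<union> sides \<subseteq> ctri" using tri_subset sides_subset by blast
  show "ctri \<subseteq> tri \<union> sides"
  proof
    fix p assume p: "p \<in> ctri"
    note c = ctri_coords[OF p]
    consider "fst p = 0" | "snd p = 0" | "n * fst p = a (\<sigma> p)"
      | "0 < fst p" "0 < snd p" "n * fst p < a (\<sigma> p)"
      using c(1,3,6) by linarith
    then show "p \<in> tri \<union> sides"
    proof cases
      case 1
      then show ?thesis using c by (simp add: sides_def segment_y)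
    next
      case 2
      then show ?thesis using c by (simp add: sides_def segment_x)
    next
      case 3
      have "m * snd p = a (\<sigma> p) - \<sigma> p" using 3 by (simp add: \<sigma>_def)
      then have "p = arcpt (\<sigma> p)" using 3 m0 n0 by (simp add: arcpt_def prod_eq_iff field_simps)
      then show ?thesis using c(5) by (auto simp: sides_def)
    next
      case 4
      have "\<sigma> p \<noteq> - m"
      proof
        assume "\<sigma> p = - m"
        then have "n * fst p < 0" using 4(3) a_l by simp
        with 4 n0 show False by (simp add: mult_less_0_iff)
      qed
      moreover have "\<sigma> p < n"
      proof -
        have "0 < m * snd p" using 4 m0 by simp
        moreover have "n * fst p \<le> n" using c(2) n0 by (simp add: mult_left_le)
        ultimately show ?thesis unfolding \<sigma>_def by linarith
      qed
      ultimately show ?thesis using 4 c(5) clip_id[OF c(5)] by (simp add: tri_def)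
    qed
  qed
qed

section \<open>Interior, closure and frontier of the triangle\<close>

lemma continuous_\<sigma>: "continuous_on S \<sigma>"
  unfolding \<sigma>_def[abs_def] by (intro continuous_intros)

lemma continuous_a_clip: "continuous_on S (\<lambda>p. a (clip (\<sigma> p)))"
proof (rule continuous_on_compose2[OF a_cont])
  show "continuous_on S (\<lambda>p. clip (\<sigma> p))"
    unfolding clip_def by (intro continuous_intros continuous_\<sigma>)
  show "(\<lambda>p. clip (\<sigma> p)) ` S \<subseteq> J" using clip_J by blast
qed

lemma open_slice: "open {p. - m < \<sigma> p \<and> \<sigma> p < n \<and> n * fst p < a (clip (\<sigma> p))}"
  by (intro open_Collect_conj open_Collect_less continuous_\<sigma> continuous_a_clip continuous_intros)

lemma open_tri: "open tri"
proof -
  have "open {p::real \<times> real. 0 < fst p \<and> 0 < snd p}"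
    by (intro open_Collect_conj open_Collect_less continuous_intros)
  moreover have "tri = {p. 0 < fst p \<and> 0 < snd p} \<inter> {p. - m < \<sigma> p \<and> \<sigma> p < n \<and> n * fst p < a (clip (\<sigma> p))}"
    by (auto simp: tri_def)
  ultimately show ?thesis using open_slice by (simp only: open_Int)
qed

lemma closed_ctri: "closed ctri"
  unfolding ctri_def
  by (intro closed_Collect_conj closed_Collect_le continuous_\<sigma> continuous_a_clip continuous_intros)

lemma bounded_ctri: "bounded ctri"
proof -
  have "norm p \<le> 2" if "p \<in> ctri" for p
    using ctri_coords(1-4)[OF that] norm_Pair_le[of "fst p" "snd p"] by simp
  then show ?thesis unfolding bounded_iff by blast
qed

text \<open>Left of the triangle the ray goes left, below it goes down. Elsewhere it follows
  \<open>(m, n)\<close>: there \<open>\<sigma>\<close> stays fixed while \<open>n x\<close>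
  increases, so a point beyond the curve stays beyond it.\<close>

lemma ray_avoids_ctri:
  assumes "p \<notin> ctri"
  obtains v where "v \<noteq> 0" "\<And>t. 0 \<le> t \<Longrightarrow> p + t *\<^sub>R v \<notin> ctri"
proof -
  consider "fst p < 0" | "snd p < 0" | "0 \<le> fst p" "0 \<le> snd p" by linarith
  then show ?thesis
  proof cases
    case 1
    have "p + t *\<^sub>R (-1, 0) \<notin> ctri" if "0 \<le> t" for t
      using ctri_coords(1)[of "p + t *\<^sub>R (-1, 0)"] 1 that by auto
    then show ?thesis by (intro that[of "(-1, 0)"]) (auto simp: zero_prod_def)
  next
    case 2
    have "p + t *\<^sub>R (0, -1) \<notin> ctri" if "0 \<le> t" for t
      using ctri_coords(3)[of "p + t *\<^sub>R (0, -1)"] 2 that by auto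
    then show ?thesis by (intro that[of "(0, -1)"]) (auto simp: zero_prod_def)
  next
    case 3
    have "p + t *\<^sub>R (m, n) \<notin> ctri" if "0 \<le> t" for t
    proof
      assume c: "p + t *\<^sub>R (m, n) \<in> ctri"
      have s: "\<sigma> (p + t *\<^sub>R (m, n)) = \<sigma> p" by (simp add: \<sigma>_def algebra_simps)
      have "n * fst p \<le> n * fst (p + t *\<^sub>R (m, n))" using that m0 n0 by simp
      then have "n * fst p \<le> a (\<sigma> p)" using ctri_coords(6)[OF c] s by simp
      moreover have "\<sigma> p \<in> J" using ctri_coords(5)[OF c] s by simp
      ultimately have "p \<in> ctri" using 3 clip_id[of "\<sigma> p"] by (simp add: ctri_def)
      with assms show False ..
    qed
    then show ?thesis using m0 by (intro that[of "(m, n)"]) (auto simp: zero_prod_def)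
  qed
qed

text \<open>The open sets \<open>tri\<close> and the complement of \<open>ctri\<close> cover the
  complement of the boundary, so a component meeting \<open>tri\<close> stays in it and is bounded;
  every point outside \<open>ctri\<close> starts an unbounded ray. This takes the place of the
  Jordan curve theorem.\<close>

lemma inside_sides: "inside sides = tri"
proof
  show "tri \<subseteq> inside sides"
  proof
    fix p assume p: "p \<in> tri"
    let ?C = "connected_component_set (- sides) p"
    have sub: "?C \<subseteq> - sides" by (rule connected_component_subset)
    have split: "- sides \<subseteq> tri \<union> - ctri" using ctri_eq by blast
    have "p \<in> ?C" using tri_sides_disjoint[OF p] by simp
    then have "?C \<inter> tri \<noteq> {}" using p by blast
    moreover have "tri \<inter> - ctri \<inter> ?C = {}" using tri_subset by blast
    ultimately have "- ctri \<inter> ?C = {}"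
      using connectedD[OF connected_connected_component open_tri, of "- ctri" "- sides" p] closed_ctri sub split
      by (auto simp: open_Compl)
    then have "bounded ?C" using bounded_subset[OF bounded_ctri] by blast
    then show "p \<in> inside sides" using tri_sides_disjoint[OF p] by (simp add: inside_def)
  qed
  show "inside sides \<subseteq> tri"
  proof
    fix p assume p: "p \<in> inside sides"
    show "p \<in> tri"
    proof (rule ccontr)
      assume "p \<notin> tri"
      then have "p \<notin> ctri" using p ctri_eq by (auto simp: inside_def)
      then obtain v where v: "v \<noteq> 0" "\<And>t. 0 \<le> t \<Longrightarrow> p + t *\<^sub>R v \<notin> ctri" by (rule ray_avoids_ctri) blast
      let ?R = "(\<lambda>t. p + t *\<^sub>R v) ` {0..}"
      have "connected ?R" by (intro connected_continuous_image continuous_intros) auto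
      moreover have "p \<in> ?R" by (rule image_eqI[of _ _ 0]) auto
      moreover have "?R \<subseteq> - sides" using v(2) sides_subset by auto
      ultimately have "?R \<subseteq> connected_component_set (- sides) p"
        by (intro connected_component_maximal)
      moreover have "bounded (connected_component_set (- sides) p)" using p by (simp add: inside_def)
      ultimately have "bounded ?R" by (rule bounded_subset[rotated])
      then obtain B where B: "\<And>t. 0 \<le> t \<Longrightarrow> norm (p + t *\<^sub>R v) \<le> B" unfolding bounded_iff by auto
      define t where "t = (\<bar>B\<bar> + norm p + 1) / norm v"
      have "0 \<le> t" by (simp add: t_def)
      have "t * norm v = \<bar>B\<bar> + norm p + 1" using v(1) by (simp add: t_def)
      moreover have "norm (t *\<^sub>R v) \<le> norm (p + t *\<^sub>R v) + norm p"
        using norm_triangle_ineq4[of "p + t *\<^sub>R v" p] by simp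
      ultimately show False using B[OF \<open>0 \<le> t\<close>] \<open>0 \<le> t\<close> by simp
    qed
  qed
qed

text \<open>A small move along \<open>(1, 1)\<close> makes both coordinates positive, and the other
  inequalities are open conditions.\<close>

lemma closure_near_slice:
  assumes "0 \<le> fst p" "0 \<le> snd p" "- m < \<sigma> p" "\<sigma> p < n" "n * fst p < a (\<sigma> p)"
  shows "p \<in> closure tri"
proof -
  let ?O = "{p. - m < \<sigma> p \<and> \<sigma> p < n \<and> n * fst p < a (clip (\<sigma> p))}"
  have "p \<in> ?O" using assms clip_id[of "\<sigma> p"] by simp
  have "((\<lambda>\<epsilon>. p + \<epsilon> *\<^sub>R (1, 1)) \<longlongrightarrow> p + 0 *\<^sub>R (1, 1)) (at_right (0::real))"
    by (intro tendsto_intros)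
  then have lim: "((\<lambda>\<epsilon>. p + \<epsilon> *\<^sub>R (1, 1)) \<longlongrightarrow> p) (at_right (0::real))"
    by (simp only: scaleR_zero_left add_0_right)
  from topological_tendstoD[OF lim open_slice \<open>p \<in> ?O\<close>]
  have "\<forall>\<^sub>F \<epsilon> in at_right 0. p + \<epsilon> *\<^sub>R (1, 1) \<in> ?O" .
  moreover have "\<forall>\<^sub>F \<epsilon> in at_right (0::real). 0 < \<epsilon>" by (simp add: eventually_at_right_less)
  ultimately have "\<forall>\<^sub>F \<epsilon> in at_right 0. p + \<epsilon> *\<^sub>R (1, 1) \<in> tri"
    by eventually_elim (use assms in \<open>auto simp: tri_def\<close>)
  then have "\<forall>\<^sub>F \<epsilon> in at_right 0. p + \<epsilon> *\<^sub>R (1, 1) \<in> closure tri"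
    by eventually_elim (use closure_subset in blast)
  from Lim_in_closed_set[OF closed_closure this _ lim] show ?thesis by simp
qed

text \<open>The curve is approached along \<open>- (m, n)\<close>, which keeps
  \<open>\<sigma>\<close> fixed and lowers \<open>n x\<close> below \<open>a s\<close>. Off the ends
  the point has positive coordinates by \<open>a_zero\<close> and \<open>b_zero\<close>, so nearby
  points do too.\<close>

lemma arcpt_in_closure:
  assumes "s \<in> {-m<..<n}"
  shows "arcpt s \<in> closure tri"
proof -
  have J: "s \<in> J" using assms by auto
  have "a s \<noteq> 0" "a s \<noteq> s" using a_zero[OF J] b_zero[OF J] assms by auto
  then have pos: "0 < a s" "0 < a s - s" using a_range[OF J] b_range[OF J] by (auto simp: b_def)
  have "((\<lambda>\<epsilon>. arcpt s + \<epsilon> *\<^sub>R (- m, - n)) \<longlongrightarrow> arcpt s + 0 *\<^sub>R (- m, - n)) (at_right (0::real))"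
    by (intro tendsto_intros)
  then have lim: "((\<lambda>\<epsilon>. arcpt s + \<epsilon> *\<^sub>R (- m, - n)) \<longlongrightarrow> arcpt s) (at_right (0::real))"
    by (simp only: scaleR_zero_left add_0_right)
  have "open {p::real \<times> real. 0 < fst p \<and> 0 < snd p}"
    by (intro open_Collect_conj open_Collect_less continuous_intros)
  moreover have "arcpt s \<in> {p. 0 < fst p \<and> 0 < snd p}"
    using pos m0 n0 by (simp add: arcpt_def)
  ultimately have "\<forall>\<^sub>F \<epsilon> in at_right 0. arcpt s + \<epsilon> *\<^sub>R (- m, - n) \<in> {p. 0 < fst p \<and> 0 < snd p}"
    by (rule topological_tendstoD[OF lim])
  moreover have "\<forall>\<^sub>F \<epsilon> in at_right (0::real). 0 < \<epsilon>" by (simp add: eventually_at_right_less)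
  ultimately have "\<forall>\<^sub>F \<epsilon> in at_right 0. arcpt s + \<epsilon> *\<^sub>R (- m, - n) \<in> closure tri"
  proof eventually_elim
    case (elim \<epsilon>)
    have \<sigma>: "\<sigma> (arcpt s + \<epsilon> *\<^sub>R (- m, - n)) = s" using \<sigma>_arcpt[of s] by (simp add: \<sigma>_def algebra_simps)
    have "n * fst (arcpt s + \<epsilon> *\<^sub>R (- m, - n)) = a s - \<epsilon> * (m * n)"
      using n0 by (simp add: arcpt_def algebra_simps)
    moreover have "0 < \<epsilon> * (m * n)" using elim m0 n0 by simp
    ultimately have "arcpt s + \<epsilon> *\<^sub>R (- m, - n) \<in> tri"
      unfolding tri_def mem_Collect_eq \<sigma> using elim assms clip_id[OF J] by simp
    then show ?case using closure_subset by blast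
  qed
  from Lim_in_closed_set[OF closed_closure this _ lim] show ?thesis by simp
qed

lemma axes_in_closure:
  assumes "0 \<le> x" "x < 1"
  shows "(x, 0) \<in> closure tri" "(0, x) \<in> closure tri"
proof -
  have "0 \<le> n * x" "n * x < n * 1" "0 \<le> m * x" "m * x < m * 1"
    using assms m0 n0 by simp_all
  then have J: "n * x \<in> J" "- (m * x) \<in> J" and lt: "n * x < n" "m * x < m" "- m < n * x" "- (m * x) < n"
    using m0 n0 by auto
  have "a (n * x) \<noteq> n * x" using b_zero[OF J(1)] lt by auto
  moreover have "n * x \<le> a (n * x)" using b_range[OF J(1)] by (simp add: b_def)
  ultimately show "(x, 0) \<in> closure tri"
    using assms lt by (intro closure_near_slice) (simp_all add: \<sigma>_def)
  have "a (- (m * x)) \<noteq> 0" using a_zero[OF J(2)] lt by auto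
  moreover have "0 \<le> a (- (m * x))" using a_range[OF J(2)] by simp
  ultimately show "(0, x) \<in> closure tri"
    using assms lt by (intro closure_near_slice) (simp_all add: \<sigma>_def)
qed

lemma corners_in_closure: "(1, 0) \<in> closure tri" "(0, 1) \<in> closure tri"
proof -
  have ev: "\<forall>\<^sub>F x in at_left (1::real). 0 \<le> x \<and> x < 1"
    by (auto simp: eventually_at_left_field intro!: exI[of _ 0])
  have 1: "\<forall>\<^sub>F x in at_left 1. (x, 0) \<in> closure tri" and 2: "\<forall>\<^sub>F x in at_left 1. (0, x) \<in> closure tri"
    using ev by (eventually_elim, use axes_in_closure in blast)+
  have lim: "((\<lambda>x. (x, 0)) \<longlongrightarrow> (1, 0)) (at_left (1::real))" "((\<lambda>x. (0, x)) \<longlongrightarrow> (0, 1)) (at_left (1::real))"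
    by (intro tendsto_Pair tendsto_const tendsto_ident_at)+
  show "(1, 0) \<in> closure tri"
    by (rule Lim_in_closed_set[OF closed_closure 1 trivial_limit_at_left_real lim(1)])
  show "(0, 1) \<in> closure tri"
    by (rule Lim_in_closed_set[OF closed_closure 2 trivial_limit_at_left_real lim(2)])
qed

lemma arcpt_ends: "arcpt (- m) = (0, 1)" "arcpt n = (1, 0)"
  using m0 n0 by (simp_all add: arcpt_def a_l a_r)

lemma closure_tri: "closure tri = ctri"
proof
  show "closure tri \<subseteq> ctri" by (rule closure_minimal[OF tri_subset closed_ctri])
  have "sides \<subseteq> closure tri"
  proof
    fix p assume "p \<in> sides"
    then consider "0 \<le> fst p" "fst p < 1" "snd p = 0" | "0 \<le> snd p" "snd p < 1" "fst p = 0"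
      | "p = (1, 0)" | "p = (0, 1)" | s where "s \<in> {-m<..<n}" "p = arcpt s"
      unfolding sides_def segment_x segment_y
    proof (elim UnE imageE CollectE conjE)
      fix s assume s: "p = arcpt s" "s \<in> J"
      then consider "s = - m" | "s = n" | "s \<in> {-m<..<n}" by fastforce
      then show thesis using s(1) arcpt_ends that by cases auto
    qed (use that in \<open>metis less_eq_real_def prod.collapse\<close>)+
    then show "p \<in> closure tri"
    proof cases
      case 1
      with axes_in_closure(1)[of "fst p"] show ?thesis by (metis prod.collapse)
    next
      case 2
      with axes_in_closure(2)[of "snd p"] show ?thesis by (metis prod.collapse)
    qed (use corners_in_closure arcpt_in_closure in auto)
  qed
  then show "ctri \<subseteq> closure tri" using ctri_eq closure_subset by blast
qed

lemma frontier_tri: "frontier tri = sides"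
  using tri_sides_disjoint ctri_eq
  by (auto simp: frontier_def closure_tri interior_open[OF open_tri])

text \<open>Lowering \<open>x\<close> lowers \<open>\<sigma>\<close> and hence \<open>b\<close>,
  which preserves \<open>m y < - b (\<sigma> p)\<close>; lowering \<open>y\<close> then raises
  \<open>\<sigma>\<close> and \<open>a\<close>, which preserves the equivalent inequality
  \<open>n x < a (\<sigma> p)\<close>.\<close>

lemma tri_downward:
  assumes "p \<in> tri" "0 < x" "x \<le> fst p" "0 < y" "y \<le> snd p"
  shows "(x, y) \<in> tri"
proof -
  have pc: "p \<in> ctri" using assms(1) tri_subset by blast
  note c = ctri_coords[OF pc]
  have p: "n * fst p < a (\<sigma> p)" using assms(1) clip_id[OF c(5)] by (simp add: tri_def)
  have nx: "0 < n * x" "n * x \<le> n * fst p" and my: "0 < m * y" "m * y \<le> m * snd p"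
    using assms m0 n0 by simp_all
  have mp: "m * snd p < m"
  proof -
    have "m * snd p < - b (\<sigma> p)" using p by (simp add: b_def \<sigma>_def)
    with b_range[OF c(5)] show ?thesis by simp
  qed
  let ?s = "n * x - m * snd p" and ?t = "n * x - m * y"
  have s: "?s \<in> J" "?s \<le> \<sigma> p" using nx mp c(5) by (auto simp: \<sigma>_def)
  have "n * fst p \<le> n" using c(2) n0 by (simp add: mult_left_le)
  then have t: "?t \<in> J" "?s \<le> ?t" "?t < n" "- m < ?t" using nx my mp by auto
  have "b ?s \<le> b (\<sigma> p)" using b_mono[OF s(1) c(5) s(2)] .
  then have "n * x < a ?s" using p by (simp add: b_def \<sigma>_def)
  also have "a ?s \<le> a ?t" using a_mono[OF s(1) t(1,2)] .
  finally show ?thesis using t clip_id[OF t(1)] assms by (simp add: tri_def \<sigma>_def)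
qed

end

section \<open>Solutions and the functional equation\<close>

text \<open>The second derivative is continued by its end values and integrated twice, with
  constants matched at \<open>l\<close>. Data on the whole line give solutions whose derivatives are
  continuous on the plane, so their extension to the closure is immediate.\<close>

lemma C2_extend:
  assumes "C2_interval l r f" "l < r"
  shows "\<exists>F F1 F2. (\<forall>x. (F has_real_derivative F1 x) (at x)) \<and> (\<forall>x. (F1 has_real_derivative F2 x) (at x)) \<and>
    continuous_on UNIV F2 \<and> (\<forall>t\<in>{l..r}. F t = f t)"
proof -
  obtain f1 f2 where f: "C2_with l r f f1 f2" using assms(1) by (auto simp: C2_interval_iff)
  define F2 where "F2 x = f2 (max l (min r x))" for x
  have "continuous_on UNIV F2"
    unfolding F2_def
  proof (rule continuous_on_compose2[OF C2_withD(3)[OF f]])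
    show "continuous_on UNIV (\<lambda>x. max l (min r x))" by (intro continuous_intros)
  qed (use assms in auto)
  from antiderivative_ex[OF this, of l "f1 l"] obtain F1 where F1: "F1 l = f1 l" "\<forall>x. (F1 has_real_derivative F2 x) (at x)"
    by (elim exE conjE) (rule that)
  then have cF1: "continuous_on UNIV F1"
    using DERIV_continuous_on has_field_derivative_at_within by blast
  from antiderivative_ex[OF this, of l "f l"] obtain F where F: "F l = f l" "\<forall>x. (F has_real_derivative F1 x) (at x)"
    by (elim exE conjE) (rule that)
  have l: "l \<in> {l..r}" using assms(2) by simp
  have F1eq: "F1 t = f1 t" if "t \<in> {l..r}" for t
  proof -
    have "((\<lambda>t. F1 t - f1 t) has_real_derivative 0) (at t within {l..r})" if "t \<in> {l..r}" for t
    proof -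
      have "F2 t = f2 t" using that by (simp add: F2_def)
      with DERIV_diff[OF has_field_derivative_at_within[OF F1(2)[rule_format]] C2_withD(2)[OF f that]]
      show ?thesis by (metis diff_self)
    qed
    from const_of_deriv_zero_within[OF this that l] F1(1) show ?thesis by simp
  qed
  have "F t = f t" if "t \<in> {l..r}" for t
  proof -
    have "((\<lambda>t. F t - f t) has_real_derivative 0) (at t within {l..r})" if "t \<in> {l..r}" for t
      using DERIV_diff[OF has_field_derivative_at_within[OF F(2)[rule_format]] C2_withD(1)[OF f that]] F1eq[OF that]
      by (metis diff_self)
    from const_of_deriv_zero_within[OF this that l] F(1) show ?thesis by simp
  qed
  with F(2) F1(2) \<open>continuous_on UNIV F2\<close> show ?thesis by blast
qed

lemma partial_derivatives:
  assumes "f differentiable (at (x, y))"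
  shows "((\<lambda>x. f (x, y)) has_real_derivative pdx f (x, y)) (at x)"
    and "((\<lambda>y. f (x, y)) has_real_derivative pdy f (x, y)) (at y)"
proof -
  let ?f' = "frechet_derivative f (at (x, y))"
  have f': "(f has_derivative ?f') (at (x, y))" using assms by (simp add: frechet_derivative_works)
  have lin: "linear ?f'" using assms by (rule linear_frechet_derivative)
  have "((\<lambda>x. (x, y)) has_derivative (\<lambda>h. (h, 0))) (at x)" "((\<lambda>y. (x, y)) has_derivative (\<lambda>h. (0, h))) (at y)"
    by (auto intro!: derivative_eq_intros)
  from diff_chain_at[OF this(1) f'] diff_chain_at[OF this(2) f']
  have *: "((\<lambda>x. f (x, y)) has_derivative (\<lambda>h. ?f' (h, 0))) (at x)"
    "((\<lambda>y. f (x, y)) has_derivative (\<lambda>h. ?f' (0, h))) (at y)"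
    by (simp_all add: o_def)
  have "(\<lambda>h. ?f' (h, 0)) = (*) (pdx f (x, y))"
  proof
    fix h
    have "?f' (h *\<^sub>R (1, 0)) = h *\<^sub>R ?f' (1, 0)" by (rule linear_scale[OF lin])
    then show "?f' (h, 0) = pdx f (x, y) * h" by (simp add: pdx_def)
  qed
  moreover have "(\<lambda>h. ?f' (0, h)) = (*) (pdy f (x, y))"
  proof
    fix h
    have "?f' (h *\<^sub>R (0, 1)) = h *\<^sub>R ?f' (0, 1)" by (rule linear_scale[OF lin])
    then show "?f' (0, h) = pdy f (x, y) * h" by (simp add: pdy_def)
  qed
  ultimately show "((\<lambda>x. f (x, y)) has_real_derivative pdx f (x, y)) (at x)"
    "((\<lambda>y. f (x, y)) has_real_derivative pdy f (x, y)) (at y)"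
    using * by (simp_all only: has_field_derivative_def)
qed

section \<open>From a solution to the functional equation\<close>

context wedge
begin

text \<open>The point where the line \<open>\<sigma> = s\<close> enters the closed first quadrant:
  on the first axis for \<open>s \<ge> 0\<close>, on the second for
  \<open>s \<le> 0\<close>.\<close>

definition foot :: "real \<Rightarrow> real \<times> real" where
  "foot s = (max s 0 / n, max (- s) 0 / m)"

lemma foot_in_ctri:
  assumes "s \<in> J"
  shows "foot s \<in> ctri"
proof -
  have "foot s \<in> sides"
  proof (cases "0 \<le> s")
    case True
    then show ?thesis using assms n0 m0 by (simp add: foot_def sides_def segment_x)
  next
    case False
    then show ?thesis
      using assms n0 m0 by (simp add: foot_def sides_def segment_y divide_le_0_iff le_divide_eq)
  qed
  then show ?thesis using sides_subset by blast
qed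

lemma foot_cont: "continuous_on S foot"
  unfolding foot_def[abs_def] divide_inverse by (intro continuous_intros)

text \<open>From \<open>p\<close> the line of direction \<open>(m, n)\<close> runs backwards inside
  the triangle to its foot on an axis. The value at the foot, supplied by the continuous extension
  to the closure, depends on \<open>\<sigma> p\<close> only, and continuously.\<close>

lemma mixed_derivative_depends_on_\<sigma>:
  assumes sol: "C2_solution m n tri g u"
  shows "\<exists>h. continuous_on UNIV h \<and> (\<forall>p\<in>tri. pdy (pdx u) p = h (\<sigma> p))"
proof -
  let ?w = "pdy (pdx u)"
  have u: "Ck_on 2 tri u" and weak: "\<And>\<phi>. test_function tri \<phi> \<Longrightarrow>
        - (LINT p:tri|lborel. u p * (m * pdx (pdx (pdy \<phi>)) p + n * pdy (pdx (pdy \<phi>)) p)) = 0"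
    using sol by (simp_all add: C2_solution_def C2_closure_def generalized_solution_def)
  have "extends_to_closure tri ?w"
    using sol by (simp add: C2_solution_def C2_closure_def)
  then obtain W where W: "continuous_on ctri W" "\<And>p. p \<in> tri \<Longrightarrow> W p = ?w p"
    unfolding extends_to_closure_def closure_tri by blast
  define h where "h s = W (foot (clip s))" for s
  have "continuous_on UNIV h"
    unfolding h_def
  proof (rule continuous_on_compose2[OF W(1)])
    show "continuous_on UNIV (\<lambda>s. foot (clip s))"
      unfolding clip_def by (intro continuous_on_compose2[OF foot_cont[of UNIV]] continuous_intros) auto
    show "(\<lambda>s. foot (clip s)) ` UNIV \<subseteq> ctri" using foot_in_ctri clip_J by blast
  qed
  moreover have "?w p = h (\<sigma> p)" if p: "p \<in> tri" for p
  proof -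
    note c = ctri_coords[OF subsetD[OF tri_subset p]]
    have pos: "0 < fst p" "0 < snd p" using p by (auto simp: tri_def)
    \<comment> \<open>The time at which the backward line from \<open>p\<close> meets the first
      axis.\<close>
    define t0 where "t0 = min (fst p / m) (snd p / n)"
    have t0: "0 < t0" using pos m0 n0 by (simp add: t0_def)
    have inside: "p - t *\<^sub>R (m, n) \<in> tri" if "0 \<le> t" "t < t0" for t
    proof -
      have "t * m < fst p" "t * n < snd p"
        using that m0 n0 by (auto simp: t0_def pos_less_divide_eq)
      then have "(fst p - t * m, snd p - t * n) \<in> tri"
        using that m0 n0 by (intro tri_downward[OF p]) auto
      moreover have "p - t *\<^sub>R (m, n) = (fst p - t * m, snd p - t * n)" by (simp add: prod_eq_iff)
      ultimately show ?thesis by (simp only:)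
    qed
    have const: "W (p - t *\<^sub>R (m, n)) = ?w p" if "0 \<le> t" "t < t0" for t
    proof -
      let ?q = "p - t *\<^sub>R (m, n)"
      have "closed_segment ?q (?q + t *\<^sub>R (m, n)) \<subseteq> tri"
      proof
        fix x assume "x \<in> closed_segment ?q (?q + t *\<^sub>R (m, n))"
        then obtain c where c: "0 \<le> c" "c \<le> 1" "x = (1 - c) *\<^sub>R ?q + c *\<^sub>R (?q + t *\<^sub>R (m, n))"
          unfolding in_segment by blast
        have "x = p - ((1 - c) * t) *\<^sub>R (m, n)"
          unfolding c(3) by (simp add: prod_eq_iff algebra_simps)
        moreover have "(1 - c) * t \<le> t" using c that by (simp add: mult_left_le_one_le)
        ultimately show "x \<in> tri" using inside[of "(1 - c) * t"] c that by simp
      qed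
      from weak_line_const[OF m0 n0 open_tri u weak this that(1)] have "?w ?q = ?w p"
        by (simp only: diff_add_cancel)
      then show ?thesis using W(2)[OF inside[OF that]] by simp
    qed
    have foot: "p - t0 *\<^sub>R (m, n) = foot (\<sigma> p)"
    proof (cases "fst p / m \<le> snd p / n")
      case True
      then have "n * fst p \<le> m * snd p" using m0 n0 by (simp add: field_simps)
      then show ?thesis using True m0 n0 by (simp add: prod_eq_iff t0_def foot_def \<sigma>_def field_simps)
    next
      case False
      then have "m * snd p \<le> n * fst p" using m0 n0 by (simp add: field_simps)
      then show ?thesis using False m0 n0 by (simp add: prod_eq_iff t0_def foot_def \<sigma>_def min_def field_simps)
    qed
    have "((\<lambda>t. p - t *\<^sub>R (m, n)) \<longlongrightarrow> p - t0 *\<^sub>R (m, n)) (at_left t0)"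
      by (intro tendsto_intros)
    then have lim: "((\<lambda>t. p - t *\<^sub>R (m, n)) \<longlongrightarrow> foot (\<sigma> p)) (at_left t0)" by (simp only: foot)
    have ev: "\<forall>\<^sub>F t in at_left t0. 0 \<le> t \<and> t < t0"
      using t0 by (auto simp: eventually_at_left_field intro!: exI[of _ 0])
    have "\<forall>\<^sub>F t in at_left t0. p - t *\<^sub>R (m, n) \<in> ctri"
      using ev by eventually_elim (use inside tri_subset in blast)
    with continuous_on_tendsto_compose[OF W(1) lim foot_in_ctri[OF c(5)]]
    have 1: "((\<lambda>t. W (p - t *\<^sub>R (m, n))) \<longlongrightarrow> W (foot (\<sigma> p))) (at_left t0)" .
    have "\<forall>\<^sub>F t in at_left t0. ?w p = W (p - t *\<^sub>R (m, n))"
      using ev by eventually_elim (use const in simp)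
    then have "((\<lambda>t. W (p - t *\<^sub>R (m, n))) \<longlongrightarrow> ?w p) (at_left t0)"
      by (rule Lim_transform_eventually[OF tendsto_const])
    from tendsto_unique[OF trivial_limit_at_left_real this 1] show ?thesis
      using clip_id[OF c(5)] by (simp add: h_def)
  qed
  ultimately show ?thesis by blast
qed

definition represents :: "(real \<Rightarrow> real) \<Rightarrow> (real \<times> real \<Rightarrow> real) \<Rightarrow> (real \<times> real \<Rightarrow> real) \<Rightarrow> bool" where
  "represents F g u \<longleftrightarrow>
    (\<forall>p\<in>ctri. u p = g (fst p, 0) + g (0, snd p) - g (0, 0) + F (\<sigma> p) - F (n * fst p) - F (- m * snd p) + F 0)"

text \<open>Subtracting a function \<open>F (n x - m y)\<close> with the same mixed derivative
  leaves one whose rectangle differences vanish. Continuity of \<open>u\<close> lets the rectangle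
  extend to the axes, and density carries the identity from \<open>tri\<close> to
  \<open>ctri\<close>.\<close>

lemma representation:
  assumes sol: "C2_solution m n tri g u"
  shows "\<exists>F f e. C2_with (- m) n F f e \<and> represents F g u"
proof -
  obtain h where h: "continuous_on UNIV h" "\<And>p. p \<in> tri \<Longrightarrow> pdy (pdx u) p = h (\<sigma> p)"
    using mixed_derivative_depends_on_\<sigma>[OF sol] by blast
  \<comment> \<open>The mixed derivative of \<open>F (n x - m y)\<close> is
    \<open>- m n F''\<close>, which has to equal \<open>h\<close>.\<close>
  define e where "e s = - h s / (m * n)" for s
  have ce: "continuous_on UNIV e" unfolding e_def using m0 n0 by (intro continuous_intros h) simp
  from antiderivative_ex[OF this, of 0 0] obtain f where "f 0 = 0" and f: "\<forall>x. (f has_real_derivative e x) (at x)"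
    by (elim exE conjE) (rule that)
  then have cf: "continuous_on UNIV f"
    using DERIV_continuous_on has_field_derivative_at_within by blast
  from antiderivative_ex[OF cf, of 0 0] obtain F where "F 0 = 0" and F: "\<forall>x. (F has_real_derivative f x) (at x)"
    by (elim exE conjE) (rule that)
  then have cF: "continuous_on UNIV F"
    using DERIV_continuous_on has_field_derivative_at_within by blast
  have u: "Ck_on 2 tri u" and cu: "continuous_on ctri u" and ug: "\<And>p. p \<in> sides \<Longrightarrow> u p = g p"
    using sol by (auto simp: C2_solution_def C2_closure_def generalized_solution_def closure_tri frontier_tri)
  define v where "v x y = u (x, y) - F (n * x - m * y)" for x y
  have v1: "((\<lambda>x. v x y) has_real_derivative pdx u (x, y) - n * f (n * x - m * y)) (at x)" if "(x, y) \<in> tri" for x y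
    unfolding v_def using partial_derivatives(1)[OF Ck_on_2D(8)[OF u that]]
    by (auto intro!: derivative_eq_intros DERIV_chain2[OF F[rule_format]])
  have v2: "((\<lambda>y. pdx u (x, y) - n * f (n * x - m * y)) has_real_derivative 0) (at y)" if "(x, y) \<in> tri" for x y
  proof -
    have "((\<lambda>y. pdx u (x, y) - n * f (n * x - m * y)) has_real_derivative
        pdy (pdx u) (x, y) - n * (e (n * x - m * y) * (- m))) (at y)"
      using partial_derivatives(2)[OF Ck_on_2D(9)[OF u that]]
      by (auto intro!: derivative_eq_intros DERIV_chain2[OF f[rule_format]])
    moreover have "pdy (pdx u) (x, y) - n * (e (n * x - m * y) * (- m)) = 0"
      using h(2)[OF that] m0 n0 by (simp add: \<sigma>_def e_def)
    ultimately show ?thesis by simp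
  qed
  \<comment> \<open>The corner is \<open>(\<epsilon>, \<epsilon>)\<close> rather than the origin
    because the derivatives live in the open triangle; \<open>tri_downward\<close> keeps the
    rectangle inside.\<close>
  have rect: "v x y - v x \<epsilon> = v \<epsilon> y - v \<epsilon> \<epsilon>" if p: "(x, y) \<in> tri" and \<epsilon>: "0 < \<epsilon>" "\<epsilon> \<le> x" "\<epsilon> \<le> y" for x y \<epsilon>
  proof -
    have in_tri: "(x', y') \<in> tri" if "x' \<in> {\<epsilon>..x}" "y' \<in> {\<epsilon>..y}" for x' y'
      using that \<epsilon> by (intro tri_downward[OF p]) auto
    have "((\<lambda>x. v x y - v x \<epsilon>) has_real_derivative 0) (at x' within {\<epsilon>..x})" if x': "x' \<in> {\<epsilon>..x}" for x'
    proof -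
      have ye: "y \<in> {\<epsilon>..y}" "\<epsilon> \<in> {\<epsilon>..y}" using \<epsilon> by auto
      have "pdx u (x', y) - n * f (n * x' - m * y) = pdx u (x', \<epsilon>) - n * f (n * x' - m * \<epsilon>)"
        by (rule const_of_deriv_zero_within[OF has_field_derivative_at_within[OF v2[OF in_tri[OF x']]] ye])
      with DERIV_diff[OF v1[OF in_tri[OF x' ye(1)]] v1[OF in_tri[OF x' ye(2)]]]
      show ?thesis by (simp add: has_field_derivative_at_within)
    qed
    from const_of_deriv_zero_within[OF this, of x \<epsilon>] \<epsilon> show ?thesis by simp
  qed
  define \<Delta> where "\<Delta> p = u p - F (\<sigma> p) - (u (fst p, 0) - F (n * fst p)) - (u (0, snd p) - F (- m * snd p)) + (u (0, 0) - F 0)" for p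
  have axes: "(fst p, 0) \<in> sides" "(0, snd p) \<in> sides" if "p \<in> ctri" for p
    using ctri_coords[OF that] by (auto simp: sides_def segment_x segment_y)
  have origin: "(0, 0) \<in> sides" by (auto simp: sides_def segment_x)
  have "\<Delta> p = 0" if p: "p \<in> tri" for p
  proof -
    obtain x y where xy: "p = (x, y)" by (cases p)
    have pc: "p \<in> ctri" using p tri_subset by blast
    have pos: "0 < x" "0 < y" using p by (auto simp: xy tri_def)
    have ev: "\<forall>\<^sub>F \<epsilon> in at_right 0. 0 < \<epsilon> \<and> \<epsilon> \<le> x \<and> \<epsilon> \<le> y"
      using pos by (auto simp: eventually_at_right_field intro!: exI[of _ "min x y"])
    have tr: "(x', y') \<in> ctri" if "0 < x'" "x' \<le> x" "0 < y'" "y' \<le> y" for x' y'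
      using tri_downward[OF p] that tri_subset by (auto simp: xy)
    have id: "((\<lambda>\<epsilon>. \<epsilon>) \<longlongrightarrow> 0) (at_right (0::real))" by (rule tendsto_ident_at)
    have evs: "\<forall>\<^sub>F \<epsilon> in at_right 0. (x, \<epsilon>) \<in> ctri" "\<forall>\<^sub>F \<epsilon> in at_right 0. (\<epsilon>, y) \<in> ctri"
      "\<forall>\<^sub>F \<epsilon> in at_right 0. (\<epsilon>, \<epsilon>) \<in> ctri"
      by (rule eventually_mono[OF ev], use tr pos in simp)+
    have in_c: "(x, 0) \<in> ctri" "(0, y) \<in> ctri" "(0, 0) \<in> ctri"
      using axes[OF pc] origin sides_subset by (auto simp: xy)
    have ulim: "((\<lambda>\<epsilon>. u (x, \<epsilon>)) \<longlongrightarrow> u (x, 0)) (at_right 0)" "((\<lambda>\<epsilon>. u (\<epsilon>, y)) \<longlongrightarrow> u (0, y)) (at_right 0)"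
      "((\<lambda>\<epsilon>. u (\<epsilon>, \<epsilon>)) \<longlongrightarrow> u (0, 0)) (at_right 0)"
      by (rule continuous_on_tendsto_compose[OF cu _ in_c(1) evs(1)] continuous_on_tendsto_compose[OF cu _ in_c(2) evs(2)]
          continuous_on_tendsto_compose[OF cu _ in_c(3) evs(3)]; intro tendsto_Pair tendsto_const id)+
    have Flim: "((\<lambda>\<epsilon>. F (n * \<alpha> \<epsilon> - m * \<beta> \<epsilon>)) \<longlongrightarrow> F (n * a' - m * b')) (at_right 0)"
      if "(\<alpha> \<longlongrightarrow> a') (at_right 0)" "(\<beta> \<longlongrightarrow> b') (at_right 0)" for \<alpha> \<beta> :: "real \<Rightarrow> real" and a' b'
      by (rule continuous_on_tendsto_compose[OF cF]) (auto intro!: tendsto_intros that)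
    have "((\<lambda>\<epsilon>. v x \<epsilon> + v \<epsilon> y - v \<epsilon> \<epsilon>) \<longlongrightarrow> v x 0 + v 0 y - v 0 0) (at_right 0)"
      unfolding v_def by (intro tendsto_add tendsto_diff ulim Flim tendsto_const id)
    moreover have "\<forall>\<^sub>F \<epsilon> in at_right 0. v x y = v x \<epsilon> + v \<epsilon> y - v \<epsilon> \<epsilon>"
      using ev by eventually_elim (use rect[OF p[unfolded xy]] in \<open>auto simp: algebra_simps\<close>)
    then have "((\<lambda>\<epsilon>. v x \<epsilon> + v \<epsilon> y - v \<epsilon> \<epsilon>) \<longlongrightarrow> v x y) (at_right 0)"
      by (rule Lim_transform_eventually[OF tendsto_const])
    ultimately have "v x y = v x 0 + v 0 y - v 0 0"
      using tendsto_unique[OF trivial_limit_at_right_real] by blast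
    then show ?thesis by (simp add: \<Delta>_def v_def xy \<sigma>_def)
  qed
  moreover have "continuous_on (closure tri) \<Delta>"
  proof -
    have 1: "continuous_on ctri (\<lambda>p. u (fst p, 0))"
      by (rule continuous_on_compose2[OF cu], intro continuous_intros) (use axes(1) sides_subset in blast)
    have 2: "continuous_on ctri (\<lambda>p. u (0, snd p))"
      by (rule continuous_on_compose2[OF cu], intro continuous_intros) (use axes(2) sides_subset in blast)
    have 3: "continuous_on ctri (\<lambda>p. F (q p))" if "continuous_on ctri q" for q
      by (rule continuous_on_compose2[OF cF that]) simp
    show ?thesis
      unfolding closure_tri \<Delta>_def
      by (intro continuous_on_add continuous_on_diff cu 1 2 3 continuous_\<sigma> continuous_on_mult
          continuous_on_minus continuous_on_const continuous_on_fst continuous_on_snd continuous_on_id)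
  qed
  ultimately have \<Delta>0: "\<Delta> p = 0" if "p \<in> ctri" for p
    using continuous_constant_on_closure[of tri \<Delta> 0 p] that by (simp add: closure_tri)
  have "C2_with (- m) n F f e"
    unfolding C2_with_def
    using F f ce by (auto intro: has_field_derivative_at_within continuous_on_subset)
  moreover have "represents F g u"
    unfolding represents_def
  proof
    fix p assume p: "p \<in> ctri"
    show "u p = g (fst p, 0) + g (0, snd p) - g (0, 0) + F (\<sigma> p) - F (n * fst p) - F (- m * snd p) + F 0"
      using \<Delta>0[OF p] ug[OF axes(1)[OF p]] ug[OF axes(2)[OF p]] ug[OF origin] by (simp add: \<Delta>_def)
  qed
  ultimately show ?thesis by blast
qed

end

text \<open>The general solution of the factored equation: the summands lie in the kernels of
  \<open>\<partial>\<^sub>y\<close>, \<open>\<partial>\<^sub>x\<close> and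
  \<open>m \<partial>\<^sub>x + n \<partial>\<^sub>y\<close>, in this order.\<close>

definition tsum :: "real \<Rightarrow> real \<Rightarrow> (real \<Rightarrow> real) \<Rightarrow> (real \<Rightarrow> real) \<Rightarrow> (real \<Rightarrow> real) \<Rightarrow> real \<times> real \<Rightarrow> real" where
  "tsum m n A B C p = A (fst p) + B (snd p) + C (n * fst p - m * snd p)"

lemma tsum_pd:
  assumes A: "\<And>x. (A has_real_derivative A' x) (at x)" and B: "\<And>x. (B has_real_derivative B' x) (at x)"
    and C: "\<And>x. (C has_real_derivative C' x) (at x)"
  shows "\<And>p. tsum m n A B C differentiable (at p)"
    and "pdx (tsum m n A B C) = tsum m n A' (\<lambda>_. 0) (\<lambda>s. n * C' s)"
    and "pdy (tsum m n A B C) = tsum m n (\<lambda>_. 0) B' (\<lambda>s. (- m) * C' s)"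
proof -
  have "(tsum m n A B C has_derivative
      (\<lambda>h. fst h * A' (fst p) + snd h * B' (snd p) + (n * fst h - m * snd h) * C' (n * fst p - m * snd p))) (at p)" for p
    unfolding tsum_def[abs_def]
    by (intro has_derivative_add has_derivative_diff DERIV_compose_FDERIV[OF A] DERIV_compose_FDERIV[OF B]
        DERIV_compose_FDERIV[OF C] has_derivative_mult_right has_derivative_fst has_derivative_snd has_derivative_ident)
  note * = pdx_pdy_eqI[OF this]
  show "\<And>p. tsum m n A B C differentiable (at p)" by (rule *(1))
  show "pdx (tsum m n A B C) = tsum m n A' (\<lambda>_. 0) (\<lambda>s. n * C' s)"
    "pdy (tsum m n A B C) = tsum m n (\<lambda>_. 0) B' (\<lambda>s. (- m) * C' s)"
    by (auto simp: *(2,3) tsum_def)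
qed

lemma tsum_cont:
  assumes "continuous_on UNIV A" "continuous_on UNIV B" "continuous_on UNIV C"
  shows "continuous_on S (tsum m n A B C)"
  unfolding tsum_def[abs_def]
  by (intro continuous_on_add continuous_on_compose2[OF assms(1)] continuous_on_compose2[OF assms(2)]
      continuous_on_compose2[OF assms(3)] continuous_intros) simp_all

lemma DERIV_imp_continuous_UNIV: "(\<And>x. (f has_real_derivative f' x) (at x)) \<Longrightarrow> continuous_on UNIV f"
  using DERIV_continuous_on has_field_derivative_at_within by blast

context
  fixes m n :: real and A A1 A2 B B1 B2 C C1 C2
  assumes A: "\<And>x. (A has_real_derivative A1 x) (at x)" "\<And>x. (A1 has_real_derivative A2 x) (at x)" "continuous_on UNIV A2"
    and B: "\<And>x. (B has_real_derivative B1 x) (at x)" "\<And>x. (B1 has_real_derivative B2 x) (at x)" "continuous_on UNIV B2"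
    and C: "\<And>x. (C has_real_derivative C1 x) (at x)" "\<And>x. (C1 has_real_derivative C2 x) (at x)" "continuous_on UNIV C2"
begin

lemmas tsum_pd1 = tsum_pd[OF A(1) B(1) C(1)]
lemmas tsum_pdx2 = tsum_pd[OF A(2) DERIV_const DERIV_cmult[OF C(2)]]
lemmas tsum_pdy2 = tsum_pd[OF DERIV_const B(2) DERIV_cmult[OF C(2)]]

lemma tsum_C2_closure: "C2_closure S (tsum m n A B C)"
proof -
  have c0: "continuous_on UNIV A" "continuous_on UNIV B" "continuous_on UNIV C"
    by (rule DERIV_imp_continuous_UNIV[OF A(1)] DERIV_imp_continuous_UNIV[OF B(1)] DERIV_imp_continuous_UNIV[OF C(1)])+
  have c1: "continuous_on UNIV A1" "continuous_on UNIV B1" "continuous_on UNIV C1"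
    by (rule DERIV_imp_continuous_UNIV[OF A(2)] DERIV_imp_continuous_UNIV[OF B(2)] DERIV_imp_continuous_UNIV[OF C(2)])+
  have second: "continuous_on UNIV (pdx (pdx (tsum m n A B C)))" "continuous_on UNIV (pdx (pdy (tsum m n A B C)))"
    "continuous_on UNIV (pdy (pdx (tsum m n A B C)))" "continuous_on UNIV (pdy (pdy (tsum m n A B C)))"
    unfolding tsum_pd1(2,3) tsum_pdx2(2,3) tsum_pdy2(2,3)
    by (intro tsum_cont continuous_on_mult continuous_on_const A(3) B(3) C(3))+
  have first: "continuous_on UNIV (pdx (tsum m n A B C))" "continuous_on UNIV (pdy (tsum m n A B C))"
    unfolding tsum_pd1(2,3) by (intro tsum_cont continuous_on_mult continuous_on_const c1)+
  have diff: "pdx (tsum m n A B C) differentiable (at p)" "pdy (tsum m n A B C) differentiable (at p)" for p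
    unfolding tsum_pd1(2,3) by (rule tsum_pdx2(1) tsum_pdy2(1))+
  have "Ck_on 2 S (tsum m n A B C)"
    unfolding numeral_2_eq_2 Ck_on.simps
    by (intro conjI ballI tsum_pd1(1) diff continuous_on_subset[OF second(1)] continuous_on_subset[OF second(2)]
        continuous_on_subset[OF second(3)] continuous_on_subset[OF second(4)] subset_UNIV)
  moreover have ext: "extends_to_closure S v" if "continuous_on UNIV v" for v
    unfolding extends_to_closure_def using continuous_on_subset[OF that subset_UNIV] by blast
  moreover have "\<forall>v\<in>{pdx (tsum m n A B C), pdy (tsum m n A B C), pdx (pdx (tsum m n A B C)),
      pdx (pdy (tsum m n A B C)), pdy (pdx (tsum m n A B C)), pdy (pdy (tsum m n A B C))}. extends_to_closure S v"
    using ext first second by blast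
  ultimately show ?thesis
    unfolding C2_closure_def using tsum_cont[OF c0] by blast
qed

text \<open>Moving \<open>m \<partial>\<^sub>x + n \<partial>\<^sub>y\<close>, then \<open>\<partial>\<^sub>x\<close>, then \<open>\<partial>\<^sub>y\<close> onto the sum annihilates one summand each.\<close>

lemma tsum_weak:
  assumes S: "open S" and \<phi>: "test_function S \<phi>"
  shows "- (LINT p:S|lborel. tsum m n A B C p * (m * pdx (pdx (pdy \<phi>)) p + n * pdy (pdx (pdy \<phi>)) p)) = 0"
proof -
  define K where "K = closure {p. \<phi> p \<noteq> 0}"
  have K: "compact K" "K \<subseteq> S" and sm: "\<forall>k. Ck_on k UNIV \<phi>"
    using \<phi> by (auto simp: test_function_def K_def)
  have clK: "closed K" by (simp add: K_def)
  have z0: "\<phi> p = 0" if "p \<notin> K" for p using that closure_subset[of "{p. \<phi> p \<noteq> 0}"] by (auto simp: K_def)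
  have z1: "pdy \<phi> p = 0" if "p \<notin> K" for p using pd_zero_off_closed(2)[OF clK z0 that] .
  have z2: "pdx (pdy \<phi>) p = 0" if "p \<notin> K" for p using pd_zero_off_closed(1)[OF clK z1 that] .
  note sm1 = smooth_pd(2)[OF sm]
  note sm2 = smooth_pd(1)[OF sm1]
  have c1: "continuous_on UNIV A1" "continuous_on UNIV B1" "continuous_on UNIV C1"
    by (rule DERIV_imp_continuous_UNIV[OF A(2)] DERIV_imp_continuous_UNIV[OF B(2)] DERIV_imp_continuous_UNIV[OF C(2)])+
  let ?w1 = "tsum m n (\<lambda>x. m * A1 x) (\<lambda>y. n * B1 y) (\<lambda>_. 0)"
  let ?w2 = "tsum m n (\<lambda>x. m * A2 x) (\<lambda>_. 0) (\<lambda>_. 0)"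
  have cw: "continuous_on S (tsum m n A B C)" "continuous_on S ?w1" "continuous_on S ?w2" "continuous_on S (\<lambda>p. 0 :: real)"
    by (intro tsum_cont continuous_on_mult continuous_on_const c1 A(3) DERIV_imp_continuous_UNIV[OF A(1)]
        DERIV_imp_continuous_UNIV[OF B(1)] DERIV_imp_continuous_UNIV[OF C(1)])+
  have d1: "((\<lambda>t. tsum m n A B C (p + t *\<^sub>R (m, n))) has_real_derivative ?w1 p) (at 0)" for p
    using directional_derivative[of "tsum m n A B C" p m n, OF tsum_pd1(1)]
    unfolding tsum_pd1(2,3) by (rule DERIV_cong) (simp add: tsum_def algebra_simps)
  have d2: "((\<lambda>t. ?w1 (p + t *\<^sub>R (1, 0))) has_real_derivative ?w2 p) (at 0)" for p
    using directional_derivative[of ?w1 p 1 0, OF tsum_pd(1)[OF DERIV_cmult[OF A(2)] DERIV_cmult[OF B(2)] DERIV_const]]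
    unfolding tsum_pd(2,3)[OF DERIV_cmult[OF A(2)] DERIV_cmult[OF B(2)] DERIV_const]
    by (rule DERIV_cong) (simp add: tsum_def)
  have d3: "((\<lambda>t. ?w2 (p + t *\<^sub>R (0, 1))) has_real_derivative 0) (at 0)" for p
    by (simp add: tsum_def)
  have "(LINT p:S|lborel. tsum m n A B C p * (m * pdx (pdx (pdy \<phi>)) p + n * pdy (pdx (pdy \<phi>)) p))
      = - (LINT p:S|lborel. ?w1 p * pdx (pdy \<phi>) p)"
    by (rule ibp_pdx_pdy(3)[OF S K sm2 z2 cw(1) d1 cw(2)])
  also have "(LINT p:S|lborel. ?w1 p * pdx (pdy \<phi>) p) = - (LINT p:S|lborel. ?w2 p * pdy \<phi> p)"
    by (rule ibp_pdx_pdy(1)[OF S K sm1 z1 cw(2) d2 cw(3)])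
  also have "(LINT p:S|lborel. ?w2 p * pdy \<phi> p) = - (LINT p:S|lborel. 0 * \<phi> p)"
    by (rule ibp_pdx_pdy(2)[OF S K sm z0 cw(3) d3 cw(4)])
  finally show ?thesis by simp
qed

end

section \<open>Composition, products and inverses of \<open>C\<^sup>2\<close> functions on
  intervals\<close>

lemma C2_compose:
  assumes F: "C2_with l r F f e" and h: "C2_with c d h h1 h2" and im: "h ` {c..d} \<subseteq> {l..r}"
  shows "C2_with c d (\<lambda>s. F (h s)) (\<lambda>s. h1 s * f (h s)) (\<lambda>s. h2 s * f (h s) + h1 s * (h1 s * e (h s)))"
proof -
  note F' = C2_withD[OF F] and h' = C2_withD[OF h]
  have "((\<lambda>s. h1 s * f (h s)) has_real_derivative h2 s * f (h s) + h1 s * (h1 s * e (h s))) (at s within {c..d})"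
    if "s \<in> {c..d}" for s
    using DERIV_mult[OF h'(2)[OF that] chain_within[OF F'(2) h'(1)[OF that] im that]]
    by (rule DERIV_cong) (simp_all add: algebra_simps)
  then show ?thesis
    unfolding C2_with_def
    by (intro conjI ballI chain_within[OF F'(1) h'(1) im] continuous_on_add continuous_on_mult h'
        continuous_on_compose2[OF F'(5) h'(4) im] continuous_on_compose2[OF F'(3) h'(4) im])
qed

lemma C2_lin:
  assumes "C2_with l r F f e" "C2_with l r G g h"
  shows "C2_with l r (\<lambda>s. c * F s + d * G s) (\<lambda>s. c * f s + d * g s) (\<lambda>s. c * e s + d * h s)"
  unfolding C2_with_def
  by (intro conjI ballI DERIV_add DERIV_cmult continuous_on_add continuous_on_mult continuous_on_const
      C2_withD[OF assms(1)] C2_withD[OF assms(2)])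

lemma C2_mult:
  assumes "C2_with l r F f e" "C2_with l r G g h"
  shows "C2_with l r (\<lambda>s. F s * G s) (\<lambda>s. f s * G s + g s * F s)
    (\<lambda>s. (e s * G s + g s * f s) + (h s * F s + f s * g s))"
  unfolding C2_with_def
  by (intro conjI ballI DERIV_add DERIV_mult continuous_on_add continuous_on_mult
      C2_withD[OF assms(1)] C2_withD[OF assms(2)])

lemma C2_id: "C2_with l r (\<lambda>s. s) (\<lambda>_. 1) (\<lambda>_. 0)"
  and C2_const: "C2_with l r (\<lambda>_. c) (\<lambda>_. 0) (\<lambda>_. 0)"
  unfolding C2_with_def by (intro conjI ballI DERIV_ident DERIV_const continuous_on_const)+

text \<open>Substituting \<open>\<tau> x\<close> into the difference quotient of \<open>h\<close>
  gives the reciprocal of that of \<open>\<tau>\<close>; working relative to sets includes the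
  one-sided derivatives at end points.\<close>

lemma inverse_derivative_within:
  fixes h :: "real \<Rightarrow> real"
  assumes h: "\<And>t. t \<in> {l..r} \<Longrightarrow> (h has_real_derivative h1 t) (at t within {l..r})"
    and ne: "\<And>t. t \<in> {l..r} \<Longrightarrow> h1 t \<noteq> 0"
    and \<tau>: "\<And>s. s \<in> T \<Longrightarrow> \<tau> s \<in> {l..r} \<and> h (\<tau> s) = s" and c\<tau>: "continuous_on T \<tau>" and s: "s \<in> T"
  shows "(\<tau> has_real_derivative inverse (h1 (\<tau> s))) (at s within T)"
proof -
  have "((\<lambda>z. (h z - h (\<tau> s)) / (z - \<tau> s)) \<longlongrightarrow> h1 (\<tau> s)) (at (\<tau> s) within {l..r})"
    using h[of "\<tau> s"] \<tau>[OF s] by (simp add: has_field_derivative_iff)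
  moreover have "filterlim \<tau> (at (\<tau> s) within {l..r}) (at s within T)"
    unfolding filterlim_at
  proof
    show "\<forall>\<^sub>F x in at s within T. \<tau> x \<in> {l..r} \<and> \<tau> x \<noteq> \<tau> s"
      unfolding eventually_at_filter using \<tau> s by (intro always_eventually) metis
    show "(\<tau> \<longlongrightarrow> \<tau> s) (at s within T)" using c\<tau> s by (simp add: continuous_on_def)
  qed
  ultimately have "((\<lambda>x. (h (\<tau> x) - h (\<tau> s)) / (\<tau> x - \<tau> s)) \<longlongrightarrow> h1 (\<tau> s)) (at s within T)"
    by (rule filterlim_compose)
  then have "((\<lambda>x. inverse ((h (\<tau> x) - h (\<tau> s)) / (\<tau> x - \<tau> s))) \<longlongrightarrow> inverse (h1 (\<tau> s))) (at s within T)"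
    using ne \<tau>[OF s] by (intro tendsto_inverse) auto
  then have "((\<lambda>x. (\<tau> x - \<tau> s) / (x - s)) \<longlongrightarrow> inverse (h1 (\<tau> s))) (at s within T)"
  proof (rule Lim_transform_eventually)
    show "\<forall>\<^sub>F x in at s within T. inverse ((h (\<tau> x) - h (\<tau> s)) / (\<tau> x - \<tau> s)) = (\<tau> x - \<tau> s) / (x - s)"
      unfolding eventually_at_filter using \<tau> s by (intro always_eventually) simp
  qed
  then show ?thesis by (simp add: has_field_derivative_iff)
qed

text \<open>The formula for \<open>\<tau>1\<close> belongs to the conclusion because it later
  expresses the slope \<open>a1\<close> by the velocity of the curve.\<close>

lemma C2_inverse:
  assumes h: "C2_with l r h h1 h2" and pos: "\<And>t. t \<in> {l..r} \<Longrightarrow> 0 < h1 t" and lr: "l < r"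
  shows "\<exists>\<tau> \<tau>1 \<tau>2. C2_with (h l) (h r) \<tau> \<tau>1 \<tau>2 \<and> (\<forall>s\<in>{h l..h r}. \<tau> s \<in> {l..r} \<and> h (\<tau> s) = s \<and> \<tau>1 s = inverse (h1 (\<tau> s))) \<and>
    (\<forall>t\<in>{l..r}. h t \<in> {h l..h r} \<and> \<tau> (h t) = t)"
proof -
  have less: "h x < h y" if "x \<in> {l..r}" "y \<in> {l..r}" "x < y" for x y
  proof -
    have "l \<le> x" "y \<le> r" using that by simp_all
    from mvt_within[OF C2_withD(1)[OF h] this(1) that(3) this(2)]
    obtain z where z: "z \<in> {x<..<y}" "h y - h x = h1 z * (y - x)" by blast
    moreover have "0 < h1 z" using z that by (intro pos) auto
    ultimately have "0 < h y - h x" using that by simp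
    then show ?thesis by simp
  qed
  then have inj: "inj_on h {l..r}" by (intro linorder_inj_onI') (metis less_irrefl)
  have range: "h t \<in> {h l..h r}" if "t \<in> {l..r}" for t
    using less[of l t] less[of t r] that lr by (cases "t = l"; cases "t = r") (auto intro: less_imp_le)
  have surj: "h ` {l..r} = {h l..h r}"
  proof
    show "h ` {l..r} \<subseteq> {h l..h r}" using range by blast
    show "{h l..h r} \<subseteq> h ` {l..r}"
    proof
      fix s assume "s \<in> {h l..h r}"
      then obtain x where "l \<le> x" "x \<le> r" "h x = s"
        using IVT'[of h l s r] C2_withD(4)[OF h] lr by auto
      then show "s \<in> h ` {l..r}" by auto
    qed
  qed
  define \<tau> where "\<tau> = the_inv_into {l..r} h"
  have \<tau>h: "\<tau> (h t) = t" if "t \<in> {l..r}" for t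
    unfolding \<tau>_def using the_inv_into_f_f[OF inj that] .
  have \<tau>: "\<tau> s \<in> {l..r} \<and> h (\<tau> s) = s" if "s \<in> {h l..h r}" for s
    using that \<tau>h unfolding surj[symmetric] by auto
  have "continuous_on (h ` {l..r}) \<tau>"
    by (rule continuous_on_inv[OF C2_withD(4)[OF h] compact_Icc]) (use \<tau>h in blast)
  then have c\<tau>: "continuous_on {h l..h r} \<tau>" by (simp only: surj)
  define \<tau>1 where "\<tau>1 s = inverse (h1 (\<tau> s))" for s
  have ne: "h1 t \<noteq> 0" if "t \<in> {l..r}" for t using pos[OF that] by simp
  have d1: "(\<tau> has_real_derivative \<tau>1 s) (at s within {h l..h r})" if "s \<in> {h l..h r}" for s
    unfolding \<tau>1_def by (rule inverse_derivative_within[OF C2_withD(1)[OF h] ne \<tau> c\<tau> that])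
  define \<tau>2 where "\<tau>2 s = - (inverse (h1 (\<tau> s)) * (\<tau>1 s * h2 (\<tau> s)) * inverse (h1 (\<tau> s)))" for s
  have im: "\<tau> ` {h l..h r} \<subseteq> {l..r}" using \<tau> by blast
  have d2: "(\<tau>1 has_real_derivative \<tau>2 s) (at s within {h l..h r})" if "s \<in> {h l..h r}" for s
  proof -
    have "h1 (\<tau> s) \<noteq> 0" using ne \<tau>[OF that] by blast
    from DERIV_inverse'[OF chain_within[OF C2_withD(2)[OF h] d1[OF that] im that] this]
    show ?thesis by (simp only: \<tau>1_def[abs_def] \<tau>2_def)
  qed
  have "continuous_on {h l..h r} \<tau>2"
  proof -
    have 1: "continuous_on {h l..h r} (\<lambda>s. h1 (\<tau> s))" "continuous_on {h l..h r} (\<lambda>s. h2 (\<tau> s))"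
      by (rule continuous_on_compose2[OF C2_withD(5)[OF h] c\<tau> im] continuous_on_compose2[OF C2_withD(3)[OF h] c\<tau> im])+
    then have "continuous_on {h l..h r} (\<lambda>s. inverse (h1 (\<tau> s)))"
      using ne \<tau> by (intro continuous_on_inverse) blast+
    then show ?thesis
      unfolding \<tau>2_def \<tau>1_def by (intro continuous_on_minus continuous_on_mult 1)
  qed
  then have "C2_with (h l) (h r) \<tau> \<tau>1 \<tau>2" using d1 d2 by (simp add: C2_with_def)
  then show ?thesis
    using \<tau> \<tau>h range \<tau>1_def by blast
qed

section \<open>From the functional equation to a solution, and the obstruction\<close>

context wedge
begin

lemma arc_coords: "s \<in> J \<Longrightarrow> a s / n \<in> {0..1}" "s \<in> J \<Longrightarrow> (a s - s) / m \<in> {0..1}"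
  using a_range[of s] b_range[of s] m0 n0 by (auto simp: b_def field_simps)

text \<open>The representation formula read backwards. The choice of \<open>A\<close> and
  \<open>B\<close> gives the right values on the axes for any \<open>F\<close>; on the curve the
  boundary condition is precisely \<open>eq\<close>.\<close>

lemma build_solution:
  assumes gx: "C2_interval 0 1 (\<lambda>x. g (x, 0))" and gy: "C2_interval 0 1 (\<lambda>y. g (0, y))"
    and F: "C2_interval (- m) n F"
    and eq: "\<And>s. s \<in> J \<Longrightarrow> g (arcpt s) = g (a s / n, 0) + g (0, (a s - s) / m) - g (0, 0) + F s - F (a s) - F (b s) + F 0"
  shows "\<exists>u. C2_solution m n tri g u"
proof -
  have "- m < n" using m0 n0 by simp
  from C2_extend[OF F this] obtain C C1 C2 where
    C: "\<forall>x. (C has_real_derivative C1 x) (at x)" "\<forall>x. (C1 has_real_derivative C2 x) (at x)" "continuous_on UNIV C2"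
    and CF: "\<forall>t\<in>J. C t = F t" by (elim exE conjE) (rule that)
  from C2_extend[OF gx zero_less_one] obtain X X1 X2 where
    X: "\<forall>x. (X has_real_derivative X1 x) (at x)" "\<forall>x. (X1 has_real_derivative X2 x) (at x)" "continuous_on UNIV X2"
    and Xg: "\<forall>t\<in>{0..1}. X t = g (t, 0)" by (elim exE conjE) (rule that)
  from C2_extend[OF gy zero_less_one] obtain Y Y1 Y2 where
    Y: "\<forall>x. (Y has_real_derivative Y1 x) (at x)" "\<forall>x. (Y1 has_real_derivative Y2 x) (at x)" "continuous_on UNIV Y2"
    and Yg: "\<forall>t\<in>{0..1}. Y t = g (0, t)" by (elim exE conjE) (rule that)
  define A where "A x = X x - C (n * x)" for x
  define A1 where "A1 x = X1 x - C1 (n * x) * n" for x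
  define A2 where "A2 x = X2 x - C2 (n * x) * n * n" for x
  \<comment> \<open>The constant compensates for the value at the origin, which is counted in both
    axis functions.\<close>
  define B where "B y = Y y - C (- m * y) + (C 0 - g (0, 0))" for y
  define B1 where "B1 y = Y1 y - C1 (- m * y) * (- m) + 0" for y
  define B2 where "B2 y = Y2 y - C2 (- m * y) * (- m) * (- m) + 0" for y
  have lin: "((\<lambda>x. c * x) has_real_derivative c) (at x)" for c x :: real
    using DERIV_cmult[OF DERIV_ident, of c] by simp
  note ch = DERIV_chain2[OF C(1)[rule_format] lin] DERIV_chain2[OF C(2)[rule_format] lin]
  have A: "(A has_real_derivative A1 x) (at x)" "(A1 has_real_derivative A2 x) (at x)" for x
    unfolding A_def[abs_def] A1_def[abs_def] A2_def
    by (intro DERIV_diff DERIV_cmult_right ch X(1)[rule_format] X(2)[rule_format])+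
  have B: "(B has_real_derivative B1 x) (at x)" "(B1 has_real_derivative B2 x) (at x)" for x
    unfolding B_def[abs_def] B1_def[abs_def] B2_def
    by (intro DERIV_add DERIV_const DERIV_diff DERIV_cmult_right ch Y(1)[rule_format] Y(2)[rule_format])+
  have C2c: "continuous_on UNIV (\<lambda>x. C2 (c * x))" for c
    by (intro continuous_on_compose2[OF C(3)] continuous_intros) simp
  have AB2: "continuous_on UNIV A2" "continuous_on UNIV B2"
    unfolding A2_def B2_def
    by (intro continuous_on_add continuous_on_diff continuous_on_mult C2c X(3) Y(3) continuous_on_const)+
  define u where "u = tsum m n A B C"
  have "C2_closure tri u"
    unfolding u_def by (rule tsum_C2_closure[OF A AB2(1) B AB2(2) C(1)[rule_format] C(2)[rule_format] C(3)])
  moreover have "generalized_solution m n tri g u"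
    unfolding generalized_solution_def
  proof (intro conjI allI impI ballI)
    show "continuous_on (closure tri) u" using \<open>C2_closure tri u\<close> by (simp add: C2_closure_def)
    show "- (LINT p:tri|lborel. u p * (m * pdx (pdx (pdy \<phi>)) p + n * pdy (pdx (pdy \<phi>)) p)) = 0"
      if "test_function tri \<phi>" for \<phi>
      unfolding u_def
      by (rule tsum_weak[OF A AB2(1) B AB2(2) C(1)[rule_format] C(2)[rule_format] C(3) open_tri that])
    show "u p = g p" if "p \<in> frontier tri" for p
    proof -
      obtain x y where xy: "p = (x, y)" by (cases p)
      have "p \<in> sides" using that by (simp only: frontier_tri)
      then consider "x \<in> {0..1}" "y = 0" | "y \<in> {0..1}" "x = 0" | s where "s \<in> J" "p = arcpt s"
        by (auto simp: sides_def segment_x segment_y xy)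
      then show ?thesis
      proof cases
        case 1
        then show ?thesis using Xg Yg by (simp add: u_def tsum_def A_def B_def xy)
      next
        case 2
        then show ?thesis using Xg Yg by (simp add: u_def tsum_def A_def B_def xy)
      next
        case 3
        have "X (a s / n) = g (a s / n, 0)" "Y ((a s - s) / m) = g (0, (a s - s) / m)"
          using Xg Yg arc_coords[OF 3(1)] by blast+
        moreover have "C s = F s" "C (a s) = F (a s)" "C (b s) = F (b s)" "C 0 = F 0"
          using CF 3(1) a_J b_J zero_J by blast+
        moreover have "n * (a s / n) = a s" "- m * ((a s - s) / m) = b s" "n * (a s / n) - m * ((a s - s) / m) = s"
          using m0 n0 by (simp_all add: b_def)
        ultimately show ?thesis
          using eq[OF 3(1)] unfolding 3(2) u_def tsum_def A_def B_def arcpt_def by simp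
      qed
    qed
  qed
  ultimately show ?thesis unfolding C2_solution_def by blast
qed

lemma arc_equation:
  assumes F: "represents F g u"
    and sol: "C2_solution m n tri g u" and s: "s \<in> J"
  shows "g (arcpt s) = g (a s / n, 0) + g (0, (a s - s) / m) - g (0, 0) + F s - F (a s) - F (b s) + F 0"
proof -
  have sd: "arcpt s \<in> sides" using s by (simp add: sides_def)
  then have "u (arcpt s) = g (arcpt s)"
    using sol by (simp add: C2_solution_def generalized_solution_def frontier_tri)
  moreover have "n * (a s / n) = a s" "- m * ((a s - s) / m) = b s" "fst (arcpt s) = a s / n" "snd (arcpt s) = (a s - s) / m"
    using m0 n0 by (simp_all add: b_def arcpt_def)
  ultimately show ?thesis
    using F[unfolded represents_def, rule_format, OF subsetD[OF sides_subset sd]] by (simp only: \<sigma>_arcpt)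
qed

text \<open>At a pair \<open>s, t\<close> exchanged by \<open>a\<close> and \<open>b\<close> with \<open>a' s = 0\<close> and \<open>a' t = 1\<close>, the differentiated
  functional equation reads \<open>f s = f t + G' s\<close> and \<open>f t = f s + G' t\<close>, so \<open>G' s + G' t = 0\<close> is
  necessary. The cubic factor makes \<open>G' t = 0\<close> and \<open>G' s \<noteq> 0\<close>.\<close>

lemma no_solution:
  assumes s: "s \<in> {0..n}" "a (b s) = s" and a1: "a1 s = 0" "a1 (b s) = 1"
  defines "q \<equiv> \<lambda>x. (x - b s)\<^sup>2 * (3 * s - b s - 2 * x)"
  defines "g \<equiv> \<lambda>p. fst p * snd p * q (\<sigma> p)"
  shows "\<not> C2_solution m n tri g u"
proof
  assume sol: "C2_solution m n tri g u"
  obtain F f e where F: "C2_with (- m) n F f e"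
    and rep: "represents F g u"
    using representation[OF sol] by (elim exE conjE) (rule that)
  define t where "t = b s"
  have J: "s \<in> J" using s m0 by simp
  have tJ: "t \<in> J" unfolding t_def by (rule b_J[OF J])
  have at: "a t = s" using s by (simp add: t_def)
  have bt: "b t = t - s" using at by (simp add: b_def)
  have as: "a s = s - t" by (simp add: t_def b_def)
  \<comment> \<open>The factor \<open>x y\<close> makes \<open>g\<close> vanish on both axes, so the
    defect in the functional equation is the restriction of \<open>g\<close> to the curve.\<close>
  define G where "G x = a x / n * ((a x - x) / m) * q x" for x
  define G1 where "G1 x = ((a1 x / n) * ((a x - x) / m) + ((a1 x - 1) / m) * (a x / n)) * q x
    + (2 * (x - t) * (3 * s - t - 2 * x) + (- 2) * (x - t)\<^sup>2) * (a x / n * ((a x - x) / m))" for x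
  have im: "a ` J \<subseteq> J" "b ` J \<subseteq> J" using a_J b_J by blast+
  have Gd: "(G has_real_derivative G1 x) (at x within J)" if "x \<in> J" for x
  proof -
    have "(q has_real_derivative 2 * (x - t) * (3 * s - t - 2 * x) + (- 2) * (x - t)\<^sup>2) (at x within J)"
      unfolding q_def t_def[symmetric]
      by (auto intro!: derivative_eq_intros)
    then show ?thesis
      unfolding G_def[abs_def] G1_def
      by (intro DERIV_mult DERIV_cdivide DERIV_diff DERIV_ident a_deriv that)
  qed
  have Geq: "F x - F (a x) - F (b x) + F 0 = G x" if "x \<in> J" for x
    using arc_equation[OF rep sol that] \<sigma>_arcpt[of x] by (simp add: g_def G_def arcpt_def)
  have key: "f x - a1 x * f (a x) - (1 - a1 x) * f (b x) + 0 = G1 x" if "x \<in> J" for x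
  proof (rule deriv_within_unique)
    show "((\<lambda>x. F x - F (a x) - F (b x) + F 0) has_real_derivative
        f x - a1 x * f (a x) - (1 - a1 x) * f (b x) + 0) (at x within J)"
      using im by (intro DERIV_add DERIV_diff DERIV_const C2_withD(1)[OF F that]
        chain_within[OF C2_withD(1)[OF F] a_deriv[OF that] _ that] chain_within[OF C2_withD(1)[OF F] b_deriv[OF that] _ that])
    show "((\<lambda>x. F x - F (a x) - F (b x) + F 0) has_real_derivative G1 x) (at x within J)"
      by (rule has_field_derivative_transform_within[OF Gd[OF that] zero_less_one that]) (simp only: Geq)
  qed (use m0 n0 that in auto)
  have "f s - f t = G1 s" "f t - f s = G1 t"
    using key[OF J] key[OF tJ] a1 at by (simp_all add: t_def)
  \<comment> \<open>\<open>q\<close> has a double zero at \<open>t\<close>, and its linear factor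
    makes \<open>s\<close> a critical point. As \<open>a1 s = 0\<close>, only the derivative of the
    coordinate \<open>y\<close> contributes to \<open>G1 s\<close>.\<close>
  moreover have "q t = 0" "G1 t = 0"
    by (simp_all add: q_def G1_def t_def)
  moreover have "G1 s = - ((s - t) / (m * n)) * (s - t)\<^sup>2 * (s - t)"
    unfolding G1_def a1 as q_def t_def[symmetric] by (simp add: power2_eq_square field_simps)
  ultimately have "(s - t) / (m * n) * (s - t)\<^sup>2 * (s - t) = 0" by simp
  then have "s - t = 0" using m0 n0 by simp
  then have "s = - m" using a_zero[OF J] as by simp
  with s m0 show False by simp
qed

end

section \<open>Existence and uniqueness for a fixed pair with a member off
  \<open>\<Omega>\<close>\<close>

locale wedge_good = wedge + averaging_good "- m" n a a1 a2 s0 for s0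
begin

text \<open>\<open>G\<close> is the difference on the curve between \<open>g\<close> and the sum of
  the axis data. It vanishes at both ends since these lie on the axes, as \<open>solvable\<close>
  demands.\<close>

lemma solution_exists:
  assumes gx: "C2_interval 0 1 (\<lambda>x. g (x, 0))" and gy: "C2_interval 0 1 (\<lambda>y. g (0, y))"
    and g\<Gamma>: "C2_interval (- m) n (\<lambda>s. g (arcpt s))"
  shows "\<exists>u. C2_solution m n tri g u"
proof -
  obtain x1 x2 y1 y2 w1 w2 where x: "C2_with 0 1 (\<lambda>x. g (x, 0)) x1 x2" and y: "C2_with 0 1 (\<lambda>y. g (0, y)) y1 y2"
    and w: "C2_with (- m) n (\<lambda>s. g (arcpt s)) w1 w2"
    using gx gy g\<Gamma> by (auto simp: C2_interval_iff)
  have ax: "\<exists>h1 h2. C2_with (- m) n (\<lambda>s. a s / n) h1 h2" "\<exists>h1 h2. C2_with (- m) n (\<lambda>s. (a s - s) / m) h1 h2"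
    using C2_lin[OF a_C2 C2_id, of "1 / n" 0] C2_lin[OF a_C2 C2_id, of "1 / m" "- 1 / m"]
    by (auto simp: diff_divide_distrib)
  have "\<exists>h1 h2. C2_with (- m) n (\<lambda>s. g (a s / n, 0)) h1 h2"
    using ax(1) C2_compose[OF x] arc_coords(1) by blast
  moreover have "\<exists>h1 h2. C2_with (- m) n (\<lambda>s. g (0, (a s - s) / m)) h1 h2"
    using ax(2) C2_compose[OF y] arc_coords(2) by blast
  ultimately obtain h1 h2 k1 k2 where h: "C2_with (- m) n (\<lambda>s. g (a s / n, 0)) h1 h2"
    and k: "C2_with (- m) n (\<lambda>s. g (0, (a s - s) / m)) k1 k2" by blast
  define G where "G s = 1 * g (arcpt s) + (- 1) * (1 * (1 * g (a s / n, 0) + 1 * g (0, (a s - s) / m)) + (- 1) * g (0, 0))" for s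
  have "\<exists>G1 G2. C2_with (- m) n G G1 G2"
    unfolding G_def using C2_lin[OF w C2_lin[OF C2_lin[OF h k] C2_const]] by blast
  then obtain G1 G2 where G: "C2_with (- m) n G G1 G2" by blast
  have "G (- m) = 0" "G n = 0"
    using arcpt_ends m0 n0 by (simp_all add: G_def a_l a_r)
  from solvable[OF G this] obtain F f e where F: "C2_with (- m) n F f e"
    and eq: "\<And>s. s \<in> J \<Longrightarrow> F s = F (a s) + F (b s) - F 0 + G s" by blast
  show ?thesis
  proof (rule build_solution[OF gx gy])
    show "C2_interval (- m) n F" using F by (auto simp: C2_interval_iff)
    show "g (arcpt s) = g (a s / n, 0) + g (0, (a s - s) / m) - g (0, 0) + F s - F (a s) - F (b s) + F 0" if "s \<in> J" for s
      using eq[OF that] by (simp add: G_def)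
  qed
qed

text \<open>The difference of two representing functions solves the homogeneous equation and is
  therefore affine; affine functions cancel in the representation because \<open>\<sigma> p\<close>
  is the sum of \<open>n x\<close> and \<open>- m y\<close>.\<close>

lemma solution_unique:
  assumes "C2_solution m n tri g u" "C2_solution m n tri g v" "p \<in> ctri"
  shows "v p = u p"
proof -
  obtain F f e where F: "C2_with (- m) n F f e"
    and u: "represents F g u"
    using representation[OF assms(1)] by (elim exE conjE) (rule that)
  obtain F' f' e' where F': "C2_with (- m) n F' f' e'"
    and v: "represents F' g v"
    using representation[OF assms(2)] by (elim exE conjE) (rule that)
  define H where "H s = 1 * F s + (- 1) * F' s" for s
  define h where "h s = 1 * f s + (- 1) * f' s" for s
  have H: "C2_with (- m) n H h (\<lambda>s. 1 * e s + (- 1) * e' s)"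
    unfolding H_def[abs_def] h_def[abs_def] by (rule C2_lin[OF F F'])
  have eq: "H s = H (a s) + H (b s) - H 0" if "s \<in> J" for s
    using arc_equation[OF u assms(1) that] arc_equation[OF v assms(2) that] by (simp add: H_def)
  have const: "h s = h 0" if "s \<in> J" for s
    by (rule homogeneous_solution_const[OF H eq that zero_J])
  have affine: "H s = h 0 * s + H 0" if "s \<in> J" for s
  proof -
    have "((\<lambda>s. H s - h 0 * s) has_real_derivative 0) (at s within J)" if "s \<in> J" for s
      using DERIV_diff[OF C2_withD(1)[OF H that] DERIV_cmult[OF DERIV_ident, of "h 0"]] const[OF that] by simp
    from const_of_deriv_zero_within[OF this that zero_J] show ?thesis by simp
  qed
  note c = ctri_coords[OF assms(3)]
  have "H (\<sigma> p) - H (n * fst p) - H (- m * snd p) + H 0 = 0"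
    unfolding affine[OF c(5)] affine[OF c(7)] affine[OF c(8)] by (simp add: \<sigma>_def algebra_simps)
  then show ?thesis using u v assms(3) by (simp add: H_def represents_def)
qed

lemma has_unique_solution:
  assumes "C2_interval 0 1 (\<lambda>x. g (x, 0))" "C2_interval 0 1 (\<lambda>y. g (0, y))" "C2_interval (- m) n (\<lambda>s. g (arcpt s))"
  shows "has_unique_C2_solution m n tri g"
  using solution_exists[OF assms] solution_unique unfolding has_unique_C2_solution_def closure_tri by blast

end

section \<open>The guided curve\<close>

lemma C2_with_param_deriv:
  assumes "C2_with (-1) 1 f f1 f2" "z \<in> {-1..1}"
  shows "param_deriv f z = f1 z"
proof -
  have "(f has_vector_derivative f1 z) (at z within cbox (-1) 1)"
    using C2_withD(1)[OF assms] by (simp add: has_real_derivative_iff_has_vector_derivative)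
  then have "vector_derivative f (at z within cbox (-1) 1) = f1 z"
    using assms(2) by (intro vector_derivative_within_cbox) simp_all
  then show ?thesis by (simp add: param_deriv_def)
qed

text \<open>The signs and the nonvanishing of the velocity give
  \<open>h = n \<alpha>1 - m \<alpha>2\<close> a positive derivative, so its inverse
  \<open>\<tau>\<close> is \<open>C\<^sup>2\<close>. The slope of \<open>a\<close> is the share of
  \<open>n \<alpha>1'\<close> in \<open>h'\<close>: 0 for vertical and 1 for horizontal
  velocity.\<close>

lemma guided_curve:
  fixes m n z0 :: real and \<alpha>1 \<alpha>2 :: "real \<Rightarrow> real"
  defines "\<Gamma> \<equiv> curve \<alpha>1 \<alpha>2"
  assumes mn: "m > 0" "n > 0" and adm: "admissible_curve \<alpha>1 \<alpha>2" and z0: "z0 \<in> {-1..1}"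
    and O1: "(\<alpha>1 z0, \<alpha>2 z0) = zeta1 m n \<Gamma> (0, 1)"
    and Om1: "Omega1 \<alpha>1 \<alpha>2 \<subseteq> (\<lambda>z. (\<alpha>1 z, \<alpha>2 z)) ` {z0<..1}"
    and Om2: "Omega2 \<alpha>1 \<alpha>2 \<subseteq> (\<lambda>z. (\<alpha>1 z, \<alpha>2 z)) ` {-1..<z0}"
  shows "\<exists>a a1 a2 \<tau> \<tau>1 \<tau>2. wedge m n a a1 a2 \<and> C2_with (- m) n \<tau> \<tau>1 \<tau>2 \<and> \<tau> ` {- m..n} = {-1..1} \<and>
    (\<forall>s\<in>{- m..n}. wedge.arcpt m n a s = (\<alpha>1 (\<tau> s), \<alpha>2 (\<tau> s)) \<and>
      (wedge.arcpt m n a s \<in> Omega1 \<alpha>1 \<alpha>2 \<longleftrightarrow> a1 s = 0) \<and> (wedge.arcpt m n a s \<in> Omega2 \<alpha>1 \<alpha>2 \<longleftrightarrow> a1 s = 1))"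
proof -
  obtain p1 q1 p2 q2 where \<alpha>1: "C2_with (-1) 1 \<alpha>1 p1 q1" and \<alpha>2: "C2_with (-1) 1 \<alpha>2 p2 q2"
    using adm by (auto simp: admissible_curve_def C2_interval_iff)
  note pd = C2_with_param_deriv[OF \<alpha>1] C2_with_param_deriv[OF \<alpha>2]
  have "\<forall>z\<in>{-1..1}. param_deriv \<alpha>1 z \<ge> 0 \<and> param_deriv \<alpha>2 z \<le> 0 \<and>
                   (param_deriv \<alpha>1 z, param_deriv \<alpha>2 z) \<noteq> (0, 0)"
    using adm unfolding admissible_curve_def by blast
  then have sgn: "0 \<le> p1 z" "p2 z \<le> 0" "p1 z \<noteq> 0 \<or> p2 z \<noteq> 0" if "z \<in> {-1..1}" for z
    using that pd[OF that] by fastforce+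
  have ends: "\<alpha>1 (-1) = 0" "\<alpha>2 (-1) = 1" "\<alpha>1 1 = 1" "\<alpha>2 1 = 0"
    and axes: "\<Gamma> \<inter> {p. fst p = 0 \<or> snd p = 0} = {(1, 0), (0, 1)}"
    using adm by (auto simp: admissible_curve_def \<Gamma>_def)
  define h where "h z = n * \<alpha>1 z + (- m) * \<alpha>2 z" for z
  define h1 where "h1 z = n * p1 z + (- m) * p2 z" for z
  have h: "C2_with (-1) 1 h h1 (\<lambda>z. n * q1 z + (- m) * q2 z)"
    unfolding h_def[abs_def] h1_def[abs_def] by (rule C2_lin[OF \<alpha>1 \<alpha>2])
  have h1: "0 < h1 z" if "z \<in> {-1..1}" for z
  proof -
    have "0 \<le> n * p1 z" "0 \<le> m * (- p2 z)" using sgn[OF that] mn by (intro mult_nonneg_nonneg; simp)+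
    moreover have "0 < p1 z \<or> 0 < - p2 z" using sgn[OF that] by linarith
    then have "0 < n * p1 z \<or> 0 < m * (- p2 z)" using mn by (blast intro: mult_pos_pos)
    ultimately show ?thesis unfolding h1_def by (elim disjE) simp_all
  qed
  have hends: "h (-1) = - m" "h 1 = n" by (simp_all add: h_def ends)
  have "\<exists>\<tau> \<tau>1 \<tau>2. C2_with (- m) n \<tau> \<tau>1 \<tau>2 \<and>
    (\<forall>s\<in>{- m..n}. \<tau> s \<in> {-1..1} \<and> h (\<tau> s) = s \<and> \<tau>1 s = inverse (h1 (\<tau> s))) \<and>
    (\<forall>t\<in>{-1..1}. h t \<in> {- m..n} \<and> \<tau> (h t) = t)"
    by (rule C2_inverse[OF h, unfolded hends]) (simp_all add: h1)
  then obtain \<tau> \<tau>1 \<tau>2 where \<tau>: "C2_with (- m) n \<tau> \<tau>1 \<tau>2"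
    and \<tau>r: "\<forall>s\<in>{- m..n}. \<tau> s \<in> {-1..1} \<and> h (\<tau> s) = s \<and> \<tau>1 s = inverse (h1 (\<tau> s))"
    and \<tau>h: "\<forall>t\<in>{-1..1}. h t \<in> {- m..n} \<and> \<tau> (h t) = t"
    by (elim exE conjE) (rule that)
  have im: "\<tau> ` {- m..n} \<subseteq> {-1..1}" using \<tau>r by blast
  have surj: "\<tau> ` {- m..n} = {-1..1}"
  proof
    show "{-1..1} \<subseteq> \<tau> ` {- m..n}"
    proof
      fix t :: real assume "t \<in> {-1..1}"
      with \<tau>h show "t \<in> \<tau> ` {- m..n}" by (intro image_eqI[of _ _ "h t"]) auto
    qed
  qed (rule im)
  \<comment> \<open>Injectivity reduces the union in \<open>tangent_space\<close> to a single
    parameter and turns the location of the guiding sets into inequalities between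
    parameters.\<close>
  have inj: "z = z'" if "z \<in> {-1..1}" "z' \<in> {-1..1}" "\<alpha>1 z = \<alpha>1 z'" "\<alpha>2 z = \<alpha>2 z'" for z z'
  proof -
    have "h z = h z'" using that by (simp add: h_def)
    then show ?thesis using \<tau>h that by metis
  qed
  define a where "a s = n * \<alpha>1 (\<tau> s) + 0 * \<alpha>1 (\<tau> s)" for s
  define a1 where "a1 s = n * (\<tau>1 s * p1 (\<tau> s)) + 0 * (\<tau>1 s * p1 (\<tau> s))" for s
  note c = C2_compose[OF \<alpha>1 \<tau> im]
  from C2_lin[OF c c, of n 0] obtain a2 where a: "C2_with (- m) n a a1 a2"
    unfolding a_def[abs_def] a1_def[abs_def] by blast
  have a1: "a1 s * h1 (\<tau> s) = n * p1 (\<tau> s)" if "s \<in> {- m..n}" for s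
    using \<tau>r that h1[of "\<tau> s"] by (simp add: a1_def)
  have a_sub: "a s - s = m * \<alpha>2 (\<tau> s)" if "s \<in> {- m..n}" for s
    using \<tau>r that by (simp add: a_def h_def algebra_simps)
  have a1_0: "a1 s = 0 \<longleftrightarrow> p1 (\<tau> s) = 0" and a1_1: "a1 s = 1 \<longleftrightarrow> p2 (\<tau> s) = 0"
    and a1_r: "0 \<le> a1 s" "a1 s \<le> 1" if s: "s \<in> {- m..n}" for s
  proof -
    have z: "\<tau> s \<in> {-1..1}" using \<tau>r s by blast
    have H: "0 < h1 (\<tau> s)" by (rule h1[OF z])
    have eq: "a1 s = n * p1 (\<tau> s) / h1 (\<tau> s)" using a1[OF s] H by (simp add: field_simps)
    then show "a1 s = 0 \<longleftrightarrow> p1 (\<tau> s) = 0" "0 \<le> a1 s"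
      using H mn sgn(1)[OF z] by (simp_all add: zero_le_mult_iff)
    have rel: "n * p1 (\<tau> s) = h1 (\<tau> s) + m * p2 (\<tau> s)" by (simp add: h1_def)
    show "a1 s = 1 \<longleftrightarrow> p2 (\<tau> s) = 0"
      using H mn unfolding eq rel by (simp add: divide_eq_eq)
    have "m * p2 (\<tau> s) \<le> 0" using sgn(2)[OF z] mn by (simp add: mult_nonneg_nonpos)
    then show "a1 s \<le> 1"
      using H unfolding eq rel by (simp add: divide_le_eq)
  qed
  have tangent: "tangent_space \<alpha>1 \<alpha>2 (\<alpha>1 z, \<alpha>2 z) = span {(p1 z, p2 z)}" if "z \<in> {-1..1}" for z
  proof -
    have "{z' \<in> {-1..1}. (\<alpha>1 z', \<alpha>2 z') = (\<alpha>1 z, \<alpha>2 z)} = {z}" using inj that by blast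
    then show ?thesis using pd[OF that] by (simp add: tangent_space_def)
  qed
  have Om1_iff: "(\<alpha>1 z, \<alpha>2 z) \<in> Omega1 \<alpha>1 \<alpha>2 \<longleftrightarrow> p1 z = 0"
    and Om2_iff: "(\<alpha>1 z, \<alpha>2 z) \<in> Omega2 \<alpha>1 \<alpha>2 \<longleftrightarrow> p2 z = 0" if z: "z \<in> {-1..1}" for z
  proof -
    have cz: "(\<alpha>1 z, \<alpha>2 z) \<in> curve \<alpha>1 \<alpha>2" using z by (auto simp: curve_def)
    have "(0, 1) \<in> span {(p1 z, p2 z)} \<longleftrightarrow> p1 z = 0"
    proof
      assume "p1 z = 0"
      then have "p2 z \<noteq> 0" "(0, 1) = (1 / p2 z) *\<^sub>R (p1 z, p2 z)" using sgn(3)[OF z] by auto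
      then show "(0, 1) \<in> span {(p1 z, p2 z)}" by (simp only: span_singleton) blast
    qed (auto simp: span_singleton)
    then show "(\<alpha>1 z, \<alpha>2 z) \<in> Omega1 \<alpha>1 \<alpha>2 \<longleftrightarrow> p1 z = 0"
      using cz tangent[OF z] by (simp add: Omega1_def)
    have "(1, 0) \<in> span {(p1 z, p2 z)} \<longleftrightarrow> p2 z = 0"
    proof
      assume "p2 z = 0"
      then have "p1 z \<noteq> 0" "(1, 0) = (1 / p1 z) *\<^sub>R (p1 z, p2 z)" using sgn(3)[OF z] by auto
      then show "(1, 0) \<in> span {(p1 z, p2 z)}" by (simp only: span_singleton) blast
    qed (auto simp: span_singleton)
    then show "(\<alpha>1 z, \<alpha>2 z) \<in> Omega2 \<alpha>1 \<alpha>2 \<longleftrightarrow> p2 z = 0"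
      using cz tangent[OF z] by (simp add: Omega2_def)
  qed
  \<comment> \<open>\<open>proj1\<close> sends \<open>(0, 1)\<close> to the origin, so
    \<open>O'\<close> lies on the line through the origin of direction \<open>(m, n)\<close>, where
    \<open>h\<close> vanishes. Uniqueness of the intersection makes the definite description
    usable.\<close>
  have hz0: "h z0 = 0"
  proof -
    have ex: "\<exists>!q. q \<in> \<Gamma> \<and> (\<exists>t. q = (0, 0) + (m * t, n * t))"
    proof -
      have 0: "0 \<in> {- m..n}" using mn by simp
      define z where "z = \<tau> 0"
      have z: "z \<in> {-1..1}" "h z = 0" using \<tau>r 0 by (auto simp: z_def)
      show ?thesis
      proof (rule ex1I[of _ "(\<alpha>1 z, \<alpha>2 z)"], intro conjI exI)
        show "(\<alpha>1 z, \<alpha>2 z) \<in> \<Gamma>" using z by (auto simp: \<Gamma>_def curve_def)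
        show "(\<alpha>1 z, \<alpha>2 z) = (0, 0) + (m * (\<alpha>1 z / m), n * (\<alpha>1 z / m))"
          using z(2) mn by (simp add: h_def field_simps)
      next
        fix q assume q: "q \<in> \<Gamma> \<and> (\<exists>t. q = (0, 0) + (m * t, n * t))"
        then obtain z' where z': "z' \<in> {-1..1}" "q = (\<alpha>1 z', \<alpha>2 z')"
          unfolding \<Gamma>_def curve_def by blast
        from q obtain t where "q = (m * t, n * t)" by auto
        with z'(2) have "\<alpha>1 z' = m * t" "\<alpha>2 z' = n * t" by simp_all
        then have "h z' = 0" by (simp add: h_def)
        then have "z' = z" using \<tau>h z' z by metis
        with z' show "q = (\<alpha>1 z, \<alpha>2 z)" by simp
      qed
    qed
    have "zeta1 m n \<Gamma> (0, 1) = (THE q. q \<in> \<Gamma> \<and> (\<exists>t. q = (0, 0) + (m * t, n * t)))"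
      by (simp add: zeta1_def proj1_def proj3_def)
    with theI'[OF ex] O1 have "\<exists>t. (\<alpha>1 z0, \<alpha>2 z0) = (m * t, n * t)" by simp
    then show ?thesis by (auto simp: h_def)
  qed
  have less_h: "h z < h z'" if "z \<in> {-1..1}" "z' \<in> {-1..1}" "z < z'" for z z'
  proof -
    have "-1 \<le> z" "z' \<le> 1" using that by simp_all
    from mvt_within[OF C2_withD(1)[OF h] this(1) that(3) this(2)]
    obtain x where x: "x \<in> {z<..<z'}" "h z' - h z = h1 x * (z' - z)" by blast
    moreover have "0 < h1 x" using x that by (intro h1) auto
    ultimately have "0 < h z' - h z" using that by simp
    then show ?thesis by simp
  qed
  have averaging: "averaging (- m) n a a1 a2"
  proof
    show "C2_with (- m) n a a1 a2" by (rule a)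
    show "a (- m) = 0" "a n = n"
      using \<tau>h hends ends by (force simp: a_def)+
    show "0 < a1 s" if "s \<in> {- m..0}" for s
    proof -
      have s: "s \<in> {- m..n}" using that mn by auto
      have z: "\<tau> s \<in> {-1..1}" "h (\<tau> s) = s" using \<tau>r s by auto
      have "a1 s \<noteq> 0"
      proof
        assume "a1 s = 0"
        then have "(\<alpha>1 (\<tau> s), \<alpha>2 (\<tau> s)) \<in> Omega1 \<alpha>1 \<alpha>2" using Om1_iff[OF z(1)] a1_0[OF s] by simp
        with Om1 obtain z' where z': "z' \<in> {z0<..1}" "\<alpha>1 z' = \<alpha>1 (\<tau> s)" "\<alpha>2 z' = \<alpha>2 (\<tau> s)" by fastforce
        have "z' \<in> {-1..1}" using z'(1) z0 by simp
        from inj[OF this z(1) z'(2,3)] have "z' = \<tau> s" .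
        then have "h z0 < h (\<tau> s)" using z'(1) by (intro less_h[OF z0 z(1)]) simp
        then show False using hz0 z(2) that by simp
      qed
      then show ?thesis using a1_r[OF s] by simp
    qed
    show "a1 s < 1" if "s \<in> {0..n}" for s
    proof -
      have s: "s \<in> {- m..n}" using that mn by auto
      have z: "\<tau> s \<in> {-1..1}" "h (\<tau> s) = s" using \<tau>r s by auto
      have "a1 s \<noteq> 1"
      proof
        assume "a1 s = 1"
        then have "(\<alpha>1 (\<tau> s), \<alpha>2 (\<tau> s)) \<in> Omega2 \<alpha>1 \<alpha>2" using Om2_iff[OF z(1)] a1_1[OF s] by simp
        with Om2 obtain z' where z': "z' \<in> {-1..<z0}" "\<alpha>1 z' = \<alpha>1 (\<tau> s)" "\<alpha>2 z' = \<alpha>2 (\<tau> s)" by fastforce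
        have "z' \<in> {-1..1}" using z'(1) z0 by simp
        from inj[OF this z(1) z'(2,3)] have "z' = \<tau> s" .
        then have "h (\<tau> s) < h z0" using z'(1) by (intro less_h[OF z(1) z0]) simp
        then show False using hz0 z(2) that by simp
      qed
      then show ?thesis using a1_r[OF s] by simp
    qed
  qed (use mn a1_r in auto)
  have on_axis: "(\<alpha>1 (\<tau> s), \<alpha>2 (\<tau> s)) \<in> {(1, 0), (0, 1)}"
    if "s \<in> {- m..n}" "\<alpha>1 (\<tau> s) = 0 \<or> \<alpha>2 (\<tau> s) = 0" for s
  proof -
    have "(\<alpha>1 (\<tau> s), \<alpha>2 (\<tau> s)) \<in> \<Gamma>" using \<tau>r that(1) unfolding \<Gamma>_def curve_def by blast
    with that(2) have "(\<alpha>1 (\<tau> s), \<alpha>2 (\<tau> s)) \<in> \<Gamma> \<inter> {p. fst p = 0 \<or> snd p = 0}" by simp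
    then show ?thesis by (simp only: axes)
  qed
  have wedge: "wedge m n a a1 a2"
  proof (intro wedge.intro averaging wedge_axioms.intro)
    fix s assume s: "s \<in> {- m..n}"
    have hs: "s = n * \<alpha>1 (\<tau> s) - m * \<alpha>2 (\<tau> s)" using \<tau>r s by (simp add: h_def)
    show "s = - m" if "a s = 0"
    proof -
      have "\<alpha>1 (\<tau> s) = 0" using that mn by (simp add: a_def)
      with on_axis[OF s] hs show ?thesis by auto
    qed
    show "s = n" if "a s = s"
    proof -
      have "\<alpha>2 (\<tau> s) = 0" using that a_sub[OF s] mn by simp
      with on_axis[OF s] hs show ?thesis by auto
    qed
  qed
  have arc: "wedge.arcpt m n a s = (\<alpha>1 (\<tau> s), \<alpha>2 (\<tau> s))" if "s \<in> {- m..n}" for s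
    using a_sub[OF that] mn by (simp add: wedge.arcpt_def[OF wedge] a_def)
  have "\<forall>s\<in>{- m..n}. wedge.arcpt m n a s = (\<alpha>1 (\<tau> s), \<alpha>2 (\<tau> s)) \<and>
      (wedge.arcpt m n a s \<in> Omega1 \<alpha>1 \<alpha>2 \<longleftrightarrow> a1 s = 0) \<and> (wedge.arcpt m n a s \<in> Omega2 \<alpha>1 \<alpha>2 \<longleftrightarrow> a1 s = 1)"
    using arc Om1_iff Om2_iff a1_0 a1_1 im by (auto simp: image_subset_iff)
  with wedge \<tau> surj show ?thesis by blast
qed

theorem proposition4p2p5:
  fixes m n z0 :: real and \<alpha>1 \<alpha>2 :: "real \<Rightarrow> real"
  defines "\<Gamma> \<equiv> curve \<alpha>1 \<alpha>2"
  defines "D \<equiv> curvilinear_triangle \<Gamma>"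
  defines "\<zeta>1 \<equiv> zeta1 m n \<Gamma>" and "\<zeta>2 \<equiv> zeta2 m n \<Gamma>"
  defines "has_good_fixed_point \<equiv>
     (\<exists>q\<in>\<Gamma>. (\<zeta>1 \<circ> \<zeta>2) q = q \<and> q \<notin> Omega \<alpha>1 \<alpha>2) \<or>
     (\<exists>q\<in>\<Gamma>. (\<zeta>2 \<circ> \<zeta>1) q = q \<and> q \<notin> Omega \<alpha>1 \<alpha>2)"
  assumes "m > 0" and "n > 0"
    and "admissible_curve \<alpha>1 \<alpha>2"
    and "z0 \<in> {-1..1}"
    and "(\<alpha>1 z0, \<alpha>2 z0) = \<zeta>1 (0, 1)" and "(\<alpha>1 z0, \<alpha>2 z0) = \<zeta>2 (1, 0)"
    and "Omega1 \<alpha>1 \<alpha>2 \<subseteq> (\<lambda>z. (\<alpha>1 z, \<alpha>2 z)) ` {z0<..1}"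
    and "Omega2 \<alpha>1 \<alpha>2 \<subseteq> (\<lambda>z. (\<alpha>1 z, \<alpha>2 z)) ` {-1..<z0}"
  shows "((\<forall>g. C2_boundary \<alpha>1 \<alpha>2 g \<longrightarrow> (\<exists>u. C2_solution m n D g u)) \<longleftrightarrow> has_good_fixed_point) \<and>
         ((\<forall>g. C2_boundary \<alpha>1 \<alpha>2 g \<longrightarrow> has_unique_C2_solution m n D g) \<longleftrightarrow> has_good_fixed_point)"
proof -
  from guided_curve[OF assms(6-9) assms(10)[unfolded \<zeta>1_def \<Gamma>_def] assms(12,13)]
  obtain a a1 a2 \<tau> \<tau>1 \<tau>2 where w: "wedge m n a a1 a2" and \<tau>: "C2_with (- m) n \<tau> \<tau>1 \<tau>2"
    and surj: "\<tau> ` {- m..n} = {-1..1}"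
    and arcs: "\<forall>s\<in>{- m..n}. wedge.arcpt m n a s = (\<alpha>1 (\<tau> s), \<alpha>2 (\<tau> s)) \<and>
      (wedge.arcpt m n a s \<in> Omega1 \<alpha>1 \<alpha>2 \<longleftrightarrow> a1 s = 0) \<and> (wedge.arcpt m n a s \<in> Omega2 \<alpha>1 \<alpha>2 \<longleftrightarrow> a1 s = 1)"
    by (elim exE conjE) (rule that)
  interpret wedge m n a a1 a2 by (rule w)
  have arc: "arcpt s = (\<alpha>1 (\<tau> s), \<alpha>2 (\<tau> s))" if "s \<in> J" for s using arcs that by blast
  have \<Gamma>: "\<Gamma> = arcpt ` J"
    unfolding \<Gamma>_def curve_def surj[symmetric] image_image using arc by (intro image_cong) auto
  have D: "D = tri"
    unfolding D_def curvilinear_triangle_def \<Gamma> using inside_sides by (simp only: sides_def)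
  \<comment> \<open>\<open>\<sigma>\<close> is constant on lines of direction \<open>(m, n)\<close>
    and recovers the parameter on the curve, so the intersection has parameter
    \<open>\<sigma> p\<close>.\<close>
  have proj: "proj3 m n \<Gamma> p = arcpt (\<sigma> p)" if "\<sigma> p \<in> J" for p
    unfolding proj3_def
  proof (rule the_equality)
    let ?t = "(fst (arcpt (\<sigma> p)) - fst p) / m"
    have "n * fst (arcpt (\<sigma> p)) - m * snd (arcpt (\<sigma> p)) = n * fst p - m * snd p"
      using \<sigma>_arcpt[of "\<sigma> p"] by (simp add: \<sigma>_def)
    then have "arcpt (\<sigma> p) = p + (m * ?t, n * ?t)"
      using m0 by (simp add: prod_eq_iff field_simps)
    then show "arcpt (\<sigma> p) \<in> \<Gamma> \<and> (\<exists>t. arcpt (\<sigma> p) = p + (m * t, n * t))"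
      using that \<Gamma> by blast
    show "q = arcpt (\<sigma> p)" if "q \<in> \<Gamma> \<and> (\<exists>t. q = p + (m * t, n * t))" for q
    proof -
      obtain s t where s: "q = arcpt s" "q = p + (m * t, n * t)" using \<open>q \<in> \<Gamma> \<and> _\<close> \<Gamma> by blast
      have "\<sigma> q = \<sigma> p" unfolding s(2) by (simp add: \<sigma>_def algebra_simps)
      then show ?thesis using \<sigma>_arcpt[of s] s(1) by simp
    qed
  qed
  have \<zeta>1: "\<zeta>1 (arcpt s) = arcpt (a s)" if "s \<in> J" for s
  proof -
    have "\<sigma> (proj1 (arcpt s)) = a s" using n0 by (simp add: \<sigma>_def proj1_def arcpt_def)
    then show ?thesis using proj[of "proj1 (arcpt s)"] a_J[OF that] by (simp add: \<zeta>1_def zeta1_def)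
  qed
  have \<zeta>2: "\<zeta>2 (arcpt s) = arcpt (b s)" if "s \<in> J" for s
  proof -
    have "\<sigma> (proj2 (arcpt s)) = b s" using m0 by (simp add: \<sigma>_def proj2_def arcpt_def b_def)
    then show ?thesis using proj[of "proj2 (arcpt s)"] b_J[OF that] by (simp add: \<zeta>2_def zeta2_def)
  qed
  have arc_inj: "arcpt s = arcpt t \<longleftrightarrow> s = t" for s t using \<sigma>_arcpt by metis
  have Om: "arcpt s \<in> Omega \<alpha>1 \<alpha>2 \<longleftrightarrow> a1 s = 0 \<or> a1 s = 1" if "s \<in> J" for s
    using bspec[OF arcs that] unfolding Omega_def by blast
  have good_iff: "has_good_fixed_point \<longleftrightarrow>
      (\<exists>s\<in>J. a (b s) = s \<and> a1 s \<noteq> 0 \<and> a1 s \<noteq> 1) \<or> (\<exists>s\<in>J. b (a s) = s \<and> a1 s \<noteq> 0 \<and> a1 s \<noteq> 1)"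
  proof -
    have "(\<zeta>1 \<circ> \<zeta>2) (arcpt s) = arcpt s \<longleftrightarrow> a (b s) = s" "(\<zeta>2 \<circ> \<zeta>1) (arcpt s) = arcpt s \<longleftrightarrow> b (a s) = s"
      if "s \<in> J" for s
      using \<zeta>1[OF that] \<zeta>2[OF that] \<zeta>1[OF b_J[OF that]] \<zeta>2[OF a_J[OF that]] by (simp_all add: arc_inj)
    then show ?thesis unfolding has_good_fixed_point_def \<Gamma> using Om by (simp add: bex_simps(7) del: o_apply) 
  qed
  have g\<Gamma>: "C2_interval (- m) n (\<lambda>s. g (arcpt s))" if "C2_boundary \<alpha>1 \<alpha>2 g" for g
  proof -
    obtain w1 w2 where "C2_with (-1) 1 (\<lambda>z. g (\<alpha>1 z, \<alpha>2 z)) w1 w2"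
      using \<open>C2_boundary \<alpha>1 \<alpha>2 g\<close> by (auto simp: C2_boundary_def C2_interval_iff)
    from C2_compose[OF this \<tau>] surj obtain k1 k2 where k: "C2_with (- m) n (\<lambda>s. g (\<alpha>1 (\<tau> s), \<alpha>2 (\<tau> s))) k1 k2" by blast
    have "C2_with (- m) n (\<lambda>s. g (arcpt s)) k1 k2"
      unfolding C2_with_def
    proof (intro conjI ballI C2_withD(2,3)[OF k])
      show "((\<lambda>s. g (arcpt s)) has_real_derivative k1 s) (at s within J)" if "s \<in> J" for s
        by (rule has_field_derivative_transform_within[OF C2_withD(1)[OF k that] zero_less_one that]) (simp add: arc)
    qed
    then show ?thesis by (auto simp: C2_interval_iff)
  qed
  have good: "\<forall>g. C2_boundary \<alpha>1 \<alpha>2 g \<longrightarrow> has_unique_C2_solution m n D g" if has_good_fixed_point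
  proof -
    from that consider s where "s \<in> J" "a (b s) = s" "a1 s \<noteq> 0" | s where "s \<in> J" "b (a s) = s" "a1 s \<noteq> 1"
      unfolding good_iff by blast
    \<comment> \<open>A fixed point \<open>t\<close> of \<open>b \<circ> a\<close> is carried to the
      fixed point \<open>a t\<close> of \<open>a \<circ> b\<close>, whose partner is again
      \<open>t\<close>; both alternatives thus concern one kind of pair.\<close>
    then have "\<exists>s\<in>{0..n}. a (b s) = s \<and> (0 < a1 s \<or> a1 (b s) < 1)"
    proof cases
      case 1
      then have "s \<in> {0..n}" using a_range[OF b_J[OF 1(1)]] by simp
      moreover have "0 < a1 s" using a1_nonneg[OF 1(1)] 1(3) by simp
      ultimately show ?thesis using 1 by blast
    next
      case 2
      have "a1 (b (a s)) < 1" using a1_le_1[OF 2(1)] 2 by simp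
      moreover have "a (b (a s)) = a s" using 2 by simp
      ultimately show ?thesis using a_range[OF 2(1)] by blast
    qed
    then obtain s0 where s0: "s0 \<in> {0..n}" "a (b s0) = s0" "0 < a1 s0 \<or> a1 (b s0) < 1" by blast
    interpret wedge_good m n a a1 a2 s0 by unfold_locales (use s0 in auto)
    show ?thesis unfolding D using has_unique_solution g\<Gamma> by (auto simp: C2_boundary_def)
  qed
  have bad: "\<exists>g. C2_boundary \<alpha>1 \<alpha>2 g \<and> (\<forall>u. \<not> C2_solution m n D g u)" if not_good: "\<not> has_good_fixed_point"
  proof -
    obtain s where s: "s \<in> {0..n}" "a (b s) = s" using fixed_point_exists by blast
    then have J: "s \<in> J" and tJ: "b s \<in> J" using m0 b_J by auto
    \<comment> \<open>In the right half the slope is below 1, so a fixed point in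
      \<open>\<Omega>\<close> must have slope 0 there. For the partner \<open>b s\<close> in the
      left half the slope is positive, hence 1.\<close>
    have a1s: "a1 s = 0"
      using not_good J s a1_less_1[OF s(1)] unfolding good_iff by auto
    have a1t: "a1 (b s) = 1"
    proof -
      have "b (a (b s)) = b s" using s(2) by simp
      then have "a1 (b s) = 0 \<or> a1 (b s) = 1" using not_good tJ unfolding good_iff by blast
      moreover have "0 < a1 (b s)" by (rule a1_pos[OF b_range[OF J]])
      ultimately show ?thesis by auto
    qed
    define q where "q x = (x - b s)\<^sup>2 * (3 * s - b s - 2 * x)" for x
    define g where "g p = fst p * snd p * q (\<sigma> p)" for p
    have "C2_boundary \<alpha>1 \<alpha>2 g"
      unfolding C2_boundary_def
    proof (intro conjI)
      show "continuous_on (frontier (curvilinear_triangle (curve \<alpha>1 \<alpha>2))) g"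
        unfolding g_def q_def by (intro continuous_intros continuous_\<sigma>)
      show "C2_interval 0 1 (\<lambda>x. g (x, 0))" "C2_interval 0 1 (\<lambda>y. g (0, y))"
        using C2_const[of 0 1 0] by (auto simp: g_def C2_interval_iff)
      obtain p1 q1 p2 q2 where \<alpha>: "C2_with (-1) 1 \<alpha>1 p1 q1" "C2_with (-1) 1 \<alpha>2 p2 q2"
        using assms(8) by (auto simp: admissible_curve_def C2_interval_iff)
      let ?h = "\<lambda>z. n * \<alpha>1 z + (- m) * \<alpha>2 z"
      let ?c = "\<lambda>z. 1 * ?h z + (- b s) * 1"
      note lin = C2_lin[OF \<alpha>, of n "- m"]
      note c = C2_lin[OF lin C2_const, of 1 "- b s" 1]
      note P = C2_mult[OF C2_mult[OF \<alpha>] C2_mult[OF C2_mult[OF c c] C2_lin[OF C2_const lin, of "3 * s - b s" 1 "- 2"]]]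
      \<comment> \<open>Written with the coefficients 1 in place, to agree literally with the
        function in \<open>P\<close>.\<close>
      have "g (\<alpha>1 z, \<alpha>2 z) = \<alpha>1 z * \<alpha>2 z * (?c z * ?c z * ((3 * s - b s) * 1 + (- 2) * ?h z))" for z
        by (simp add: g_def q_def \<sigma>_def power2_eq_square)
      then show "C2_interval (-1) 1 (\<lambda>z. g (\<alpha>1 z, \<alpha>2 z))"
        unfolding C2_interval_iff using P by auto
    qed
    moreover have "\<not> C2_solution m n D g u" for u
      using no_solution[OF s a1s a1t, of u] by (simp add: D g_def[abs_def] q_def[abs_def])
    ultimately show ?thesis by blast
  qed
  have unique_ex: "\<exists>u. C2_solution m n D g u" if "has_unique_C2_solution m n D g" for g
    using that by (auto simp: has_unique_C2_solution_def)
  \<comment> \<open>The good case provides unique existence and the other case already excludes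
    existence, so one argument settles both equivalences.\<close>
  from good bad unique_ex show ?thesis by blast
qed

end
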